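(* Let $n\ge 1$, $N\ge 0$ be integers. For $k\in[0,N]_{\mathbb Z}$ let $\mathcal S_k:\mathbb R\to\mathbb R^{2n\times 2n}$ be $C_p^1$ (continuous with piecewise continuous derivative) with $\mathcal S_k(\lambda)$ symplectic and $\Psi(\mathcal S_k(\lambda))\ge 0$ for all $\lambda\in\mathbb R$. Let $Y^{[0]}_k(\lambda)$ be the principal solution at $0$ of $y_{k+1}(\lambda)=\mathcal S_k(\lambda)y_k(\lambda)$, and let $\sigma$ be the set of finite eigenvalues of the Dirichlet problem $y_{k+1}(\lambda)=\mathcal S_k(\lambda)y_k(\lambda)$, $x_0(\lambda)=0=x_{N+1}(\lambda)$. Let $R_k$, $k\in[0,N+1]_{\mathbb Z}$, be symplectic matrices not depending on $\lambda$ with $R_{N+1}=I$. Then for the conjoined basis $R_k^{-1}Y_k^{[0]}(\lambda)$ of the transformed system $\tilde y_{k+1}(\lambda)=\tilde{\mathcal S}_k(\lambda)\tilde y_k(\lambda)$, $\tilde{\mathcal S}_k(\lambda)=R_{k+1}^{-1}\mathcal S_k(\lambda)R_k$, and all $a<b$, $$l_d(R^{-1}Y^{[0]}(b),0,N+1)-l_d(R^{-1}Y^{[0]}(a),0,N+1)+\sum_{a<\nu\le b}n_R(\nu)=\#\{\nu\in\sigma\mid a<\nu\le b\}.$$ Moreover, if there is $\lambda_0\in\mathbb R$ such that $\operatorname{rank}\mathcal B_k(\lambda)=\operatorname{rank}\mathcal B_k(\lambda^-)$ for all $\lambda\le\lambda_0$ and $k\in[0,N]_{\mathbb Z}$, where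 $\mathcal B_k(\lambda)$ is the upper right $n\times n$ block of $\mathcal S_k(\lambda)$, then the sum $\sum_{a<\nu\le b}n_R(\nu)$ is finite as $a\to-\infty$ (i.e. it stays bounded as $a\to-\infty$), and for any $a<\lambda_1=\min\sigma$ the left-hand side of the formula equals the number $\#\{\nu\in\sigma\mid\nu\le b\}$ of finite eigenvalues less than or equal to $b$.
   Context: Notation: $[M,N]_{\mathbb Z}=[M,N]\cap\mathbb Z$; $\mathcal J=\begin{pmatrix}0&I\\-I&0\end{pmatrix}$; $S\in\mathbb R^{2n\times2n}$ is symplectic if $S^T\mathcal JS=\mathcal J$; $\binom{0}{I}$ is the $2n\times n$ matrix with $n\times n$ blocks $0,I$; $A^\dagger$ is the Moore-Penrose inverse; $\operatorname{ind}A$ is the number of negative eigenvalues of a symmetric matrix $A$; $A\ge0$ means symmetric nonnegative definite; $\operatorname{rank}A(\lambda^-)$ is the left-hand limit of $\operatorname{rank}A(\cdot)$ at $\lambda$. For a symplectic $C^1_p$ function $S(\lambda)$ put $\Psi(S(\lambda))=\mathcal J^T\dot S(\lambda)S^{-1}(\lambda)$ (a symmetric matrix), $\dot{}=d/d\lambda$. A solution has the form $y_k=\binom{x_k}{u_k}$ with $x_k,u_k\in\mathbb R^n$. The principal solution at $0$ is the $2n\times n$ matrix solution $Y^{[0]}_k(\lambda)=\binom{X^{[0]}_k(\lambda)}{U^{[0]}_k(\lambda)}$ with $Y^{[0]}_0(\lambda)=\binom0I$. A number $\lambda_0$ is a finite eigenvalue of the Dirichlet problem if $\theta(\lambda_0):=\operatorname{rank}X^{[0]}_{N+1}(\lambda_0^-)-\operatorname{rank}X^{[0]}_{N+1}(\lambda_0)\ge1$;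 $\theta(\lambda_0)$ is its multiplicity, and $\#\{\nu\in\sigma\mid\dots\}$ counts finite eigenvalues with multiplicity $\theta$. (Under the hypotheses all left-hand rank limits used here exist.) Forward focal points. For a discrete symplectic system $y_{k+1}=W_ky_k$, $k\in[0,N]_{\mathbb Z}$, with $W_k=\begin{pmatrix}A_k&B_k\\C_k&D_k\end{pmatrix}$, a conjoined basis is a $2n\times n$ matrix solution $Y_k=\binom{X_k}{U_k}$ with $\operatorname{rank}Y_k=n$, $X_k^TU_k=U_k^TX_k$. Its multiplicity of forward focal points in $(k,k+1]$ is $m_d(Y_k)=\operatorname{rank}M_k+\operatorname{ind}P_k$, where $M_k=(I-X_{k+1}X_{k+1}^\dagger)B_k$, $T_k=I-M_k^\dagger M_k$, $P_k=T_kX_kX_{k+1}^\dagger B_kT_k$ (symmetric), and $l_d(Y,0,N+1)=\sum_{k=0}^Nm_d(Y_k)$. The expression $l_d(R^{-1}Y^{[0]}(\lambda),0,N+1)$ is computed with respect to the transformed system with coefficient matrices $\tilde{\mathcal S}_k(\lambda)$. With $\tilde{\mathcal B}_k(\lambda)$ the upper right $n\times n$ block of $\tilde{\mathcal S}_k(\lambda)$: $\tilde\vartheta_k(\lambda)=\operatorname{rank}\tilde{\mathcal B}_k(\lambda^-)-\operatorname{rank}\tilde{\mathcal B}_k(\lambda)$ and $n_R(\lambda)=\sum_{k=0}^N\tilde\vartheta_k(\lambda)$. *)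

theory Defs
  imports "HOL-Analysis.Analysis"
begin

text \<open>
  The dimension is \<open>n = CARD('n)\<close>. Matrices of size \<open>2n \<times> 2n\<close> and \<open>2n \<times> n\<close> are indexed by the sum
  type \<open>'n + 'n\<close>: \<open>Inl\<close> selects the first and \<open>Inr\<close> the second block of \<open>n\<close> coordinates. The spectral parameter is
  written \<open>t\<close>, or \<open>\<nu>\<close> when it is summed over.
\<close>

type_synonym 'n mat2 = "real ^ ('n + 'n) ^ ('n + 'n)"
type_synonym 'n col2 = "real ^ 'n ^ ('n + 'n)"

definition four_blocks ::
  "real^'n^'n \<Rightarrow> real^'n^'n \<Rightarrow> real^'n^'n \<Rightarrow> real^'n^'n \<Rightarrow> ('n::finite) mat2" where
  "four_blocks A B C D = (\<chi> i j. case (i, j) of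
      (Inl p, Inl q) \<Rightarrow> A $ p $ q
    | (Inl p, Inr q) \<Rightarrow> B $ p $ q
    | (Inr p, Inl q) \<Rightarrow> C $ p $ q
    | (Inr p, Inr q) \<Rightarrow> D $ p $ q)"

definition upper_right :: "('n::finite) mat2 \<Rightarrow> real^'n^'n" where
  "upper_right W = (\<chi> p q. W $ Inl p $ Inr q)"

definition stack :: "real^'n^'n \<Rightarrow> real^'n^'n \<Rightarrow> ('n::finite) col2" where
  "stack X U = (\<chi> i j. case i of Inl p \<Rightarrow> X $ p $ j | Inr p \<Rightarrow> U $ p $ j)"

definition upper :: "('n::finite) col2 \<Rightarrow> real^'n^'n" where
  "upper Y = (\<chi> p j. Y $ Inl p $ j)"

definition lower :: "('n::finite) col2 \<Rightarrow> real^'n^'n" where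
  "lower Y = (\<chi> p j. Y $ Inr p $ j)"

definition symp_J :: "('n::finite) mat2" where
  "symp_J = four_blocks 0 (mat 1) (- mat 1) 0"

definition symplectic :: "('n::finite) mat2 \<Rightarrow> bool" where
  "symplectic S \<longleftrightarrow> transpose S ** symp_J ** S = symp_J"

definition nonneg_definite :: "real^'m^'m \<Rightarrow> bool" where
  "nonneg_definite A \<longleftrightarrow> transpose A = A \<and> (\<forall>v. 0 \<le> v \<bullet> (A *v v))"

text \<open>Moore-Penrose inverse, given by the four Penrose equations.\<close>

definition pinv :: "real^'n^'m \<Rightarrow> real^'m^'n" where
  "pinv A = (THE X. A ** X ** A = A \<and> X ** A ** X = X \<and>
     transpose (A ** X) = A ** X \<and> transpose (X ** A) = X ** A)"

text \<open>
  Number of negative eigenvalues counted with multiplicity. It is only meant for symmetric matrices,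
  for which algebraic and geometric multiplicities agree.
\<close>

definition ind :: "real^'m^'m \<Rightarrow> nat" where
  "ind A = (\<Sum>\<mu> | \<mu> < 0 \<and> (\<exists>v. v \<noteq> 0 \<and> A *v v = \<mu> *\<^sub>R v). dim {v. A *v v = \<mu> *\<^sub>R v})"

text \<open>
  Continuous with piecewise continuous derivative on the whole line: the exceptional points are
  locally finite, and the derivative has finite one-sided limits at them. (The library's
  \<open>piecewise_C1_differentiable_on\<close> does not ask for these limits, and it allows only finitely many
  exceptional points.)
\<close>

definition Cp1 :: "(real \<Rightarrow> 'a::real_normed_vector) \<Rightarrow> bool" where
  "Cp1 f \<longleftrightarrow> continuous_on UNIV f \<and>
     (\<exists>F. (\<forall>a b. finite (F \<inter> {a..b})) \<and> f C1_differentiable_on (- F) \<and>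
        (\<forall>t\<in>F. (\<exists>l. ((\<lambda>x. vector_derivative f (at x)) \<longlongrightarrow> l) (at_left t)) \<and>
               (\<exists>r. ((\<lambda>x. vector_derivative f (at x)) \<longlongrightarrow> r) (at_right t))))"

definition Psi :: "(real \<Rightarrow> ('n::finite) mat2) \<Rightarrow> real \<Rightarrow> 'n mat2" where
  "Psi S t = transpose symp_J ** vector_derivative S (at t) ** matrix_inv (S t)"

text \<open>
  For a \<open>Cp1\<close> function, nonnegativity wherever the derivative exists is the same as
  nonnegativity for both one-sided derivatives at every \<open>t\<close>: pass to the limit at the exceptional
  points.
\<close>

definition Psi_nonneg :: "(real \<Rightarrow> ('n::finite) mat2) \<Rightarrow> bool" where
  "Psi_nonneg S \<longleftrightarrow> (\<forall>t. S differentiable (at t) \<longrightarrow> nonneg_definite (Psi S t))"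

definition left_rank :: "(real \<Rightarrow> real^'n^'m) \<Rightarrow> real \<Rightarrow> nat" where
  "left_rank A t = Lim (at_left t) (\<lambda>s. rank (A s))"

definition rank_drop :: "(real \<Rightarrow> real^'n^'m) \<Rightarrow> real \<Rightarrow> int" where
  "rank_drop A t = int (left_rank A t) - int (rank (A t))"

primrec principal_sol :: "(nat \<Rightarrow> real \<Rightarrow> ('n::finite) mat2) \<Rightarrow> nat \<Rightarrow> real \<Rightarrow> 'n col2" where
  "principal_sol S 0 t = stack 0 (mat 1)"
| "principal_sol S (Suc k) t = S k t ** principal_sol S k t"

definition theta :: "(nat \<Rightarrow> real \<Rightarrow> ('n::finite) mat2) \<Rightarrow> nat \<Rightarrow> real \<Rightarrow> int" where
  "theta S N = rank_drop (\<lambda>t. upper (principal_sol S (N + 1) t))"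

definition finite_eigenvalues :: "(nat \<Rightarrow> real \<Rightarrow> ('n::finite) mat2) \<Rightarrow> nat \<Rightarrow> real set" where
  "finite_eigenvalues S N = {t. theta S N t \<ge> 1}"

definition conjoined_basis ::
  "nat \<Rightarrow> (nat \<Rightarrow> ('n::finite) mat2) \<Rightarrow> (nat \<Rightarrow> 'n col2) \<Rightarrow> bool" where
  "conjoined_basis N W Y \<longleftrightarrow> (\<forall>k\<le>N. Y (k + 1) = W k ** Y k) \<and>
     (\<forall>k\<le>N + 1. rank (Y k) = CARD('n) \<and>
        transpose (upper (Y k)) ** lower (Y k) = transpose (lower (Y k)) ** upper (Y k))"

text \<open>Multiplicity of forward focal points of \<open>Y\<close> in \<open>(k, k + 1]\<close> for the system with coefficients \<open>W\<close>.\<close>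

definition focal_mult ::
  "(nat \<Rightarrow> ('n::finite) mat2) \<Rightarrow> (nat \<Rightarrow> 'n col2) \<Rightarrow> nat \<Rightarrow> nat" where
  "focal_mult W Y k =
    (let X = upper (Y k); X1 = upper (Y (k + 1)); B = upper_right (W k);
         M = (mat 1 - X1 ** pinv X1) ** B;
         T = mat 1 - pinv M ** M;
         P = T ** X ** pinv X1 ** B ** T
     in rank M + ind P)"

definition l_d ::
  "(nat \<Rightarrow> ('n::finite) mat2) \<Rightarrow> (nat \<Rightarrow> 'n col2) \<Rightarrow> nat \<Rightarrow> nat \<Rightarrow> int" where
  "l_d W Y p q = (\<Sum>k = p..<q. int (focal_mult W Y k))"

definition transformed ::
  "(nat \<Rightarrow> real \<Rightarrow> ('n::finite) mat2) \<Rightarrow> (nat \<Rightarrow> 'n mat2) \<Rightarrow> nat \<Rightarrow> real \<Rightarrow> 'n mat2" where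
  "transformed S R k t = matrix_inv (R (k + 1)) ** S k t ** R k"

definition transformed_sol ::
  "(nat \<Rightarrow> real \<Rightarrow> ('n::finite) mat2) \<Rightarrow> (nat \<Rightarrow> 'n mat2) \<Rightarrow> nat \<Rightarrow> real \<Rightarrow> 'n col2" where
  "transformed_sol S R k t = matrix_inv (R k) ** principal_sol S k t"

definition l_d_transformed ::
  "(nat \<Rightarrow> real \<Rightarrow> ('n::finite) mat2) \<Rightarrow> (nat \<Rightarrow> 'n mat2) \<Rightarrow> nat \<Rightarrow> real \<Rightarrow> int" where
  "l_d_transformed S R N t =
     l_d (\<lambda>k. transformed S R k t) (\<lambda>k. transformed_sol S R k t) 0 (N + 1)"

definition n_R ::
  "(nat \<Rightarrow> real \<Rightarrow> ('n::finite) mat2) \<Rightarrow> (nat \<Rightarrow> 'n mat2) \<Rightarrow> nat \<Rightarrow> real \<Rightarrow> int" where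
  "n_R S R N t = (\<Sum>k = 0..N. rank_drop (\<lambda>s. upper_right (transformed S R k s)) t)"

end

theory Submission
  imports Defs
begin

text \<open>
  A Lagrangian plane that is transversal to a reference plane is the graph of a symmetric matrix \<open>Q\<close>, and a
  system that is monotone in \<open>t\<close> moves its Lagrangian planes in such a way that \<open>Q(t)\<close> is nondecreasing as a
  quadratic form (\<open>monotone_chart\<close>). For a nondecreasing continuous \<open>Q\<close> the integers \<open>ind (Q t)\<close> and
  \<open>- ind (- Q t)\<close> are nonincreasing. Both indices are lower semicontinuous, hence \<open>ind (Q t)\<close> is constant to the
  right of \<open>t0\<close>, endpoint included, and on arrival at \<open>t0\<close> from the left it loses exactly as much as the rank
  does (\<open>monotone_matrix_index_jump\<close>).

  Consider one step \<open>Y1 = W Y\<close> of the transformed system near \<open>t0\<close>, with \<open>A, B\<close> the upper blocks of \<open>W\<close> and \<open>X, U\<close>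
  those of \<open>Y\<close>. For all but finitely many slopes \<open>\<tau>\<close> the reference plane of slope \<open>\<tau>\<close> is transversal both to \<open>Y\<close>
  and to the preimage under \<open>W\<close> of the vertical plane. The two planes then have the coordinates
  \<open>Q0 = X (U + \<tau> X)\<^sup>-\<^sup>1\<close> and, up to sign, \<open>QB = B\<^sup>T (A\<^sup>T - \<tau> B\<^sup>T)\<^sup>-\<^sup>1\<close>. The symmetric matrices \<open>Q0\<close>, \<open>QB\<close> and
  \<open>Q0 + QB\<close> are nondecreasing and have the ranks of \<open>X\<close>, \<open>B\<close> and \<open>X1 = A X + B U\<close>. The multiplicity of focal
  points measures the parallel sum of \<open>Q0\<close> and \<open>QB\<close>: it equals \<open>ind Q0 + ind QB - ind (Q0 + QB)\<close>
  (\<open>rank_plus_ind_parallel_sum\<close>, \<open>focal_mult_charts\<close>). The three indices jump as described, so the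
  multiplicity jumps at \<open>t0\<close> by the rank drop of \<open>X1\<close> minus the rank drops of \<open>X\<close> and of \<open>B\<close>
  (\<open>focal_mult_jump\<close>).

  Summation over the steps telescopes. The initial value does not depend on \<open>t\<close>, and the last value is
  untransformed because \<open>R (N + 1)\<close> is the identity. Hence \<open>l_d_transformed\<close> is a step function which jumps by
  \<open>theta - n_R\<close>; adding up the jumps in \<open>{a<..b}\<close> gives the formula (\<open>finite_eigenvalue_count\<close>).

  If no \<open>B\<close> of the original system loses rank on \<open>{..t0}\<close>, the formula with all \<open>R k\<close> equal to the identity
  bounds the number of eigenvalues in \<open>{a<..b}\<close> independently of \<open>a\<close>, because the multiplicities of focal points
  are nonnegative (\<open>eigenvalue_count_bounded\<close>). So there is a least eigenvalue. As the multiplicities of focal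
  points are also bounded above, the formula with the given \<open>R\<close> then bounds the sum of \<open>n_R\<close>.
\<close>

section \<open>The negative index of a quadratic form\<close>

definition negative_on :: "('a::real_vector \<Rightarrow> real) \<Rightarrow> 'a set \<Rightarrow> bool" where
  "negative_on q N \<longleftrightarrow> subspace N \<and> (\<forall>x\<in>N. x \<noteq> 0 \<longrightarrow> q x < 0)"

text \<open>
  The negative index is a dimension, not a sum over eigenvalues, so that it can be estimated by
  exhibiting subspaces and compared along linear maps between spaces of different dimension.
\<close>

definition morse_index :: "('a::euclidean_space \<Rightarrow> real) \<Rightarrow> nat" where
  "morse_index q = Max (dim ` {N. negative_on q N})"

lemma finite_dims: "finite (dim ` (X :: 'a::euclidean_space set set))"
  by (rule finite_subset[of _ "{..DIM('a)}"]) (auto simp: dim_subset_UNIV)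

lemma negative_on_trivial: "negative_on q {0}"
  by (simp add: negative_on_def)

lemma dim_le_morse_index: "negative_on q N \<Longrightarrow> dim N \<le> morse_index q"
  unfolding morse_index_def by (rule Max_ge[OF finite_dims]) auto

lemma morse_index_attained:
  obtains N where "negative_on q N" "dim N = morse_index q"
proof -
  have "Max (dim ` {N. negative_on q N}) \<in> dim ` {N. negative_on q N}"
    by (rule Max_in[OF finite_dims]) (use negative_on_trivial in auto)
  then show ?thesis using that unfolding morse_index_def by auto
qed

lemma morse_index_le_DIM: "morse_index (q :: 'a::euclidean_space \<Rightarrow> real) \<le> DIM('a)"
  by (metis morse_index_attained dim_subset_UNIV)

text \<open>
  A negative subspace meets a nonnegative one only in \<open>0\<close>. This is the way to bound the index from above.
\<close>

lemma morse_index_plus_dim_nonneg: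
  fixes q :: "'a::euclidean_space \<Rightarrow> real"
  assumes "subspace P" "\<And>x. x \<in> P \<Longrightarrow> 0 \<le> q x"
  shows "morse_index q + dim P \<le> DIM('a)"
proof -
  obtain N where N: "negative_on q N" "dim N = morse_index q" by (rule morse_index_attained)
  have sN: "subspace N" using N by (simp add: negative_on_def)
  have "N \<inter> P = {0}"
    using N assms subspace_0[OF sN] subspace_0[OF assms(1)]
    by (force simp: negative_on_def)
  then have "dim N + dim P = dim {x + y |x y. x \<in> N \<and> y \<in> P}"
    using dim_sums_Int[OF sN assms(1)] by simp
  also have "\<dots> \<le> DIM('a)" by (rule dim_subset_UNIV)
  finally show ?thesis using N(2) by simp
qed

lemma morse_index_mono:
  assumes "\<And>x. q x \<le> q' x"
  shows "morse_index q' \<le> morse_index q"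
proof -
  obtain N where N: "negative_on q' N" "dim N = morse_index q'" by (rule morse_index_attained)
  have "negative_on q N"
    using N(1) assms unfolding negative_on_def by (meson le_less_trans)
  then show ?thesis using N(2) dim_le_morse_index by metis
qed

text \<open>
  \<open>G\<close> need not be injective: it is so on every subspace where the pulled back form is negative. Hence a
  change of variables gives one inequality at once, even if it loses dimensions.
\<close>

lemma morse_index_compose_le:
  fixes G :: "'a::euclidean_space \<Rightarrow> 'b::euclidean_space"
  assumes "linear G" "q 0 = 0"
  shows "morse_index (\<lambda>x. q (G x)) \<le> morse_index q"
proof -
  obtain N where N: "negative_on (\<lambda>x. q (G x)) N" "dim N = morse_index (\<lambda>x. q (G x))"
    by (rule morse_index_attained)
  have sN: "subspace N" using N by (simp add: negative_on_def)
  have inj: "inj_on G N"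
  proof (rule inj_onI)
    fix x y assume "x \<in> N" "y \<in> N" "G x = G y"
    then have "x - y \<in> N" "G (x - y) = 0"
      using sN by (auto simp: subspace_diff linear_diff[OF assms(1)])
    then show "x = y"
      using N(1) assms(2) unfolding negative_on_def
      by (metis less_irrefl right_minus_eq)
  qed
  have "negative_on q (G ` N)"
    unfolding negative_on_def
  proof (intro conjI ballI impI)
    show "subspace (G ` N)" by (rule linear_subspace_image[OF assms(1) sN])
    fix y assume "y \<in> G ` N" "y \<noteq> 0"
    then obtain x where "x \<in> N" "y = G x" "x \<noteq> 0" using linear_0[OF assms(1)] by auto
    then show "q y < 0" using N(1) by (simp add: negative_on_def)
  qed
  moreover have "dim (G ` N) = dim N"
    by (rule dim_image_eq[OF assms(1)]) (use inj sN span_eq_iff in metis)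
  ultimately show ?thesis using N(2) dim_le_morse_index by metis
qed

text \<open>
  A negative subspace loses at most the codimension of \<open>Z\<close> when it is intersected with \<open>Z\<close>.
\<close>

lemma morse_index_restrict:
  fixes q :: "'a::euclidean_space \<Rightarrow> real"
  assumes "subspace Z" "\<And>x. x \<in> Z \<Longrightarrow> q x = q' x"
  shows "morse_index q + dim Z \<le> morse_index q' + DIM('a)"
proof -
  obtain N where N: "negative_on q N" "dim N = morse_index q" by (rule morse_index_attained)
  have sN: "subspace N" using N by (simp add: negative_on_def)
  have "negative_on q' (N \<inter> Z)"
    using N(1) assms by (auto simp: negative_on_def subspace_inter)
  then have 1: "dim (N \<inter> Z) \<le> morse_index q'" by (rule dim_le_morse_index)
  have "dim {x + y |x y. x \<in> N \<and> y \<in> Z} \<le> DIM('a)" by (rule dim_subset_UNIV)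
  then show ?thesis using 1 N(2) dim_sums_Int[OF sN assms(1)] by linarith
qed

lemma dim_orthogonal_complement:
  fixes V :: "'a::euclidean_space set"
  assumes "subspace V"
  shows "dim (V\<^sup>\<bottom>) + dim V = DIM('a)"
  using dim_subspace_orthogonal_to_vectors[OF assms subspace_UNIV]
  by (simp add: orthogonal_comp_def orthogonal_commute)

definition self_adjoint :: "('a::euclidean_space \<Rightarrow> 'a) \<Rightarrow> bool" where
  "self_adjoint f \<longleftrightarrow> linear f \<and> (\<forall>x y. x \<bullet> f y = f x \<bullet> y)"

text \<open>
  The equality case of the Cauchy-Schwarz inequality for the semidefinite form \<open>x \<bullet> f y\<close> on \<open>P\<close>.
\<close>

lemma nonneg_form_null_vector:
  assumes f: "self_adjoint f" and P: "subspace P" "\<And>x. x \<in> P \<Longrightarrow> 0 \<le> x \<bullet> f x"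
    and x: "x \<in> P" "x \<bullet> f x = 0" and y: "y \<in> P"
  shows "y \<bullet> f x = 0"
proof (rule ccontr)
  assume nz: "y \<bullet> f x \<noteq> 0"
  have lin: "linear f" and sym: "x \<bullet> f y = y \<bullet> f x"
    using f by (auto simp: self_adjoint_def inner_commute)
  \<comment> \<open>A small step from \<open>x\<close> against \<open>y\<close> makes the form negative; the summand \<open>1\<close> avoids division by \<open>0\<close>.\<close>
  define e where "e = (y \<bullet> f x) / (y \<bullet> f y + 1)"
  define a where "a = y \<bullet> f y"
  define b where "b = y \<bullet> f x"
  have a: "a \<ge> 0" using P(2)[OF y] by (simp add: a_def)
  have "x - e *\<^sub>R y \<in> P" using P(1) x(1) y by (intro subspace_diff subspace_scale)
  then have "0 \<le> (x - e *\<^sub>R y) \<bullet> f (x - e *\<^sub>R y)" by (rule P(2))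
  also have "\<dots> = e * e * a - 2 * e * b"
    using x(2) sym
    by (simp add: linear_diff[OF lin] linear_scale[OF lin] inner_diff a_def b_def algebra_simps)
  also have "\<dots> = e * (e * a - 2 * b)" by (simp add: algebra_simps)
  also have "e = b / (a + 1)" by (simp add: e_def a_def b_def)
  also have "b / (a + 1) * (b / (a + 1) * a - 2 * b) = - (b * b / (a + 1)) * (2 - a / (a + 1))"
    by (simp add: algebra_simps)
  also have "\<dots> < 0"
  proof -
    have "a / (a + 1) < 2" using a by (simp add: divide_less_eq)
    moreover have "b * b / (a + 1) > 0" using nz a by (intro divide_pos_pos) (auto simp: b_def zero_less_mult_iff)
    ultimately show ?thesis by (intro mult_neg_pos) auto
  qed
  finally show False by simp
qed

definition negative_eigenspace :: "('a::euclidean_space \<Rightarrow> 'a) \<Rightarrow> 'a set" where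
  "negative_eigenspace f = span {v. \<exists>\<mu><0. f v = \<mu> *\<^sub>R v}"

lemma subspace_negative_eigenspace: "subspace (negative_eigenspace f)"
  by (simp add: negative_eigenspace_def)

lemma image_negative_eigenspace:
  assumes "linear f" "x \<in> negative_eigenspace f"
  shows "f x \<in> negative_eigenspace f"
  using assms(2) unfolding negative_eigenspace_def
proof (induction rule: span_induct_alt)
  case base then show ?case by (simp add: linear_0[OF assms(1)] span_zero)
next
  case (step c v w)
  then obtain \<mu> where "f v = \<mu> *\<^sub>R v" by auto
  then show ?case using step
    by (simp add: linear_add[OF assms(1)] linear_scale[OF assms(1)] span_add span_scale span_base)
qed

lemma image_negative_eigenspace_comp:
  assumes "self_adjoint f" "x \<in> (negative_eigenspace f)\<^sup>\<bottom>"
  shows "f x \<in> (negative_eigenspace f)\<^sup>\<bottom>"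
  using assms image_negative_eigenspace[of f]
  unfolding orthogonal_comp_def self_adjoint_def orthogonal_def
  by simp

text \<open>
  The orthogonal complement is invariant. Were the form negative somewhere on it, its minimum over the
  unit sphere there would be attained at an eigenvector with a negative eigenvalue, which is orthogonal to itself.
\<close>

lemma nonneg_on_negative_eigenspace_comp:
  fixes f :: "'a::euclidean_space \<Rightarrow> 'a"
  assumes f: "self_adjoint f" and x: "x \<in> (negative_eigenspace f)\<^sup>\<bottom>"
  shows "0 \<le> x \<bullet> f x"
proof (rule ccontr)
  assume neg: "\<not> 0 \<le> x \<bullet> f x"
  define P where "P = (negative_eigenspace f)\<^sup>\<bottom>"
  have lin: "linear f" using f by (simp add: self_adjoint_def)
  have sP: "subspace P" unfolding P_def by (rule subspace_orthogonal_comp)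
  have x0: "x \<noteq> 0" using neg linear_0[OF lin] by auto
  define K where "K = sphere 0 1 \<inter> P"
  have K: "compact K" unfolding K_def by (intro compact_Int_closed compact_sphere closed_subspace sP)
  have xK: "(1 / norm x) *\<^sub>R x \<in> K"
    using x x0 sP by (simp add: K_def P_def subspace_scale)
  have "continuous_on K (\<lambda>x. x \<bullet> f x)"
    by (intro continuous_intros linear_continuous_on_compose[OF _ lin])
  then obtain z where z: "z \<in> K" "\<And>y. y \<in> K \<Longrightarrow> z \<bullet> f z \<le> y \<bullet> f y"
    using continuous_attains_inf[OF K, of "\<lambda>x. x \<bullet> f x"] xK by blast
  define m where "m = z \<bullet> f z"
  have zP: "z \<in> P" and nz: "norm z = 1" using z by (auto simp: K_def)
  have lower: "m * (y \<bullet> y) \<le> y \<bullet> f y" if "y \<in> P" for y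
  proof (cases "y = 0")
    case False
    have "(1 / norm y) *\<^sub>R y \<in> K" using that False sP by (simp add: K_def subspace_scale)
    from z(2)[OF this] have "m \<le> (y \<bullet> f y) / (norm y)\<^sup>2"
      by (simp add: m_def linear_scale[OF lin] power2_eq_square)
    then show ?thesis using False by (simp add: field_simps power2_norm_eq_inner)
  qed (simp add: linear_0[OF lin])
  have m: "m < 0"
  proof (rule ccontr)
    assume "\<not> m < 0"
    then have "0 \<le> m * (x \<bullet> x)" by simp
    with lower[of x] x neg show False by (simp add: P_def)
  qed
  define g where "g = (\<lambda>y. f y - m *\<^sub>R y)"
  have g: "self_adjoint g"
    using f unfolding g_def self_adjoint_def
    by (auto simp: inner_diff intro!: linear_compose_sub linear_scale_self module_hom_scale)
  have "y \<bullet> g z = 0" if "y \<in> P" for y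
  proof (rule nonneg_form_null_vector[OF g sP _ zP _ that])
    show "0 \<le> x \<bullet> g x" if "x \<in> P" for x using lower[OF that] by (simp add: g_def inner_diff)
    show "z \<bullet> g z = 0" using nz by (simp add: g_def inner_diff m_def power2_norm_eq_inner[symmetric])
  qed
  moreover have "g z \<in> P"
    using image_negative_eigenspace_comp[OF f, of z] zP sP by (simp add: g_def P_def subspace_diff subspace_scale)
  ultimately have "g z \<bullet> g z = 0" by blast
  then have "f z = m *\<^sub>R z" by (simp add: g_def)
  then have "z \<in> negative_eigenspace f" using m unfolding negative_eigenspace_def by (blast intro: span_base)
  with zP have "orthogonal z z" unfolding P_def orthogonal_comp_def by blast
  then show False using nz by (simp add: orthogonal_def power2_norm_eq_inner[symmetric])
qed

text \<open>
  Eigenspaces of a self-adjoint map are mutually orthogonal, so orthonormal bases of them can be put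
  together. The cardinality clause connects this basis with the eigenvalue sum that defines \<open>ind\<close>.
\<close>

lemma orthonormal_negative_eigenbasis:
  fixes f :: "'a::euclidean_space \<Rightarrow> 'a"
  assumes f: "self_adjoint f"
  shows "\<exists>B. pairwise orthogonal B \<and> (\<forall>b\<in>B. norm b = 1 \<and> (\<exists>\<mu><0. f b = \<mu> *\<^sub>R b)) \<and>
    span B = negative_eigenspace f \<and>
    card B = (\<Sum>\<mu> | \<mu> < 0 \<and> (\<exists>v. v \<noteq> 0 \<and> f v = \<mu> *\<^sub>R v). dim {v. f v = \<mu> *\<^sub>R v})"
proof -
  have lin: "linear f" and sym: "\<And>x y. x \<bullet> f y = f x \<bullet> y" using f by (auto simp: self_adjoint_def)
  define E where "E = {\<mu>. \<mu> < 0 \<and> (\<exists>v. v \<noteq> 0 \<and> f v = \<mu> *\<^sub>R v)}"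
  define V where "V \<mu> = {v. f v = \<mu> *\<^sub>R v}" for \<mu>
  have sV: "subspace (V \<mu>)" for \<mu>
    unfolding V_def subspace_def by (auto simp: linear_0[OF lin] linear_add[OF lin] linear_scale[OF lin] algebra_simps)
  have orth: "orthogonal v w" if "v \<in> V \<mu>" "w \<in> V \<nu>" "\<mu> \<noteq> \<nu>" for v w \<mu> \<nu>
  proof -
    have "\<nu> * (v \<bullet> w) = \<mu> * (v \<bullet> w)" using sym[of v w] that by (simp add: V_def)
    then show ?thesis using that(3) by (simp add: orthogonal_def)
  qed
  have "\<exists>C. C \<subseteq> V \<mu> \<and> pairwise orthogonal C \<and> (\<forall>b\<in>C. norm b = 1) \<and> independent C \<and> card C = dim (V \<mu>) \<and> span C = V \<mu>" for \<mu>
    using orthonormal_basis_subspace[OF sV[of \<mu>]] by metis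
  then obtain C where C: "\<And>\<mu>. C \<mu> \<subseteq> V \<mu>" "\<And>\<mu>. pairwise orthogonal (C \<mu>)" "\<And>\<mu> b. b \<in> C \<mu> \<Longrightarrow> norm b = 1"
     "\<And>\<mu>. independent (C \<mu>)" "\<And>\<mu>. card (C \<mu>) = dim (V \<mu>)" "\<And>\<mu>. span (C \<mu>) = V \<mu>" by metis
  define B where "B = (\<Union>\<mu>\<in>E. C \<mu>)"
  have po: "pairwise orthogonal B"
    unfolding pairwise_def
  proof (intro ballI impI)
    fix b c assume "b \<in> B" "c \<in> B" "b \<noteq> c"
    then obtain \<mu> \<nu> where h: "b \<in> C \<mu>" "c \<in> C \<nu>" by (auto simp: B_def)
    show "orthogonal b c"
    proof (cases "\<mu> = \<nu>")
      case True then show ?thesis using h C(2)[of \<mu>] \<open>b \<noteq> c\<close> by (auto simp: pairwise_def)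
    next
      case False then show ?thesis using orth h C(1) by blast
    qed
  qed
  have n1: "norm b = 1" if "b \<in> B" for b using that C(3) by (auto simp: B_def)
  have indep: "independent B"
    by (rule pairwise_orthogonal_independent[OF po]) (use n1 in force)
  have finB: "finite B" using indep independent_imp_finite by blast
  have disj: "C \<mu> \<inter> C \<nu> = {}" if "\<mu> \<noteq> \<nu>" for \<mu> \<nu>
  proof -
    have False if "b \<in> C \<mu>" "b \<in> C \<nu>" for b
    proof -
      have "orthogonal b b" using orth[of b \<mu> b \<nu>] C(1)[of \<mu>] C(1)[of \<nu>] that \<open>\<mu> \<noteq> \<nu>\<close> by blast
      then show False using C(3)[OF that(1)] by (simp add: orthogonal_self)
    qed
    then show ?thesis by blast
  qed
  have Cne: "C \<mu> \<noteq> {}" if "\<mu> \<in> E" for \<mu>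
    using that C(6)[of \<mu>] unfolding E_def V_def by auto
  have finE: "finite E"
  proof (rule inj_on_finite)
    define h where "h = (\<lambda>\<mu>. SOME b. b \<in> C \<mu>)"
    have h: "h \<mu> \<in> C \<mu>" if "\<mu> \<in> E" for \<mu> using Cne[OF that] by (simp add: h_def some_in_eq)
    show "inj_on h E" using h disj by (metis disjoint_iff inj_onI)
    show "h ` E \<subseteq> B" using h by (auto simp: B_def)
  qed (rule finB)
  have finC: "finite (C \<mu>)" for \<mu> using C(4) independent_imp_finite by blast
  have card: "card B = (\<Sum>\<mu>\<in>E. dim (V \<mu>))"
    unfolding B_def by (subst card_UN_disjoint) (use finE finC disj C(5) in auto)
  have spanB: "span B = negative_eigenspace f"
  proof
    show "span B \<subseteq> negative_eigenspace f"
      unfolding negative_eigenspace_def by (rule span_mono) (use C(1) in \<open>auto simp: B_def E_def V_def\<close>)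
    show "negative_eigenspace f \<subseteq> span B"
      unfolding negative_eigenspace_def
    proof (rule span_minimal)
      show "{v. \<exists>\<mu><0. f v = \<mu> *\<^sub>R v} \<subseteq> span B"
      proof
        fix v assume "v \<in> {v. \<exists>\<mu><0. f v = \<mu> *\<^sub>R v}"
        then obtain \<mu> where m: "\<mu> < 0" "v \<in> V \<mu>" by (auto simp: V_def)
        show "v \<in> span B"
        proof (cases "v = 0")
          case False
          then have "\<mu> \<in> E" using m by (auto simp: E_def V_def)
          then have "C \<mu> \<subseteq> B" by (auto simp: B_def)
          then show ?thesis using m C(6)[of \<mu>] span_mono by blast
        qed (simp add: span_zero)
      qed
    qed simp
  qed
  have "\<exists>\<mu><0. f b = \<mu> *\<^sub>R b" if "b \<in> B" for b
    using that C(1) by (auto simp: B_def E_def V_def)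
  then show ?thesis
    using po n1 spanB card unfolding E_def V_def by blast
qed

lemma negative_on_negative_eigenspace:
  assumes f: "self_adjoint f"
  shows "negative_on (\<lambda>x. x \<bullet> f x) (negative_eigenspace f)"
proof -
  have lin: "linear f" using f by (auto simp: self_adjoint_def)
  obtain B where B: "pairwise orthogonal B" "\<And>b. b \<in> B \<Longrightarrow> norm b = 1"
    "span B = negative_eigenspace f" "\<And>b. b \<in> B \<Longrightarrow> \<exists>\<mu><0. f b = \<mu> *\<^sub>R b"
    using orthonormal_negative_eigenbasis[OF f] by blast
  obtain m where m: "\<And>b. b \<in> B \<Longrightarrow> m b < 0" "\<And>b. b \<in> B \<Longrightarrow> f b = m b *\<^sub>R b"
    using B(4) by metis
  have "independent B"
    by (rule pairwise_orthogonal_independent[OF B(1)]) (use B(2) in force)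
  then have finB: "finite B" using independent_imp_finite by blast
  have "x \<bullet> f x < 0" if x: "x \<in> span B" "x \<noteq> 0" for x
  proof -
    obtain u where u: "x = (\<Sum>b\<in>B. u b *\<^sub>R b)" using x(1) span_finite[OF finB] by auto
    have xb: "x \<bullet> b = u b" if "b \<in> B" for b
    proof -
      have "x \<bullet> b = (\<Sum>c\<in>B. u c * (c \<bullet> b))" by (simp add: u inner_sum_left)
      also have "\<dots> = (\<Sum>c\<in>B. if c = b then u c else 0)"
        by (rule sum.cong) (use B(1,2) that in \<open>auto simp: pairwise_def orthogonal_def norm_eq_1\<close>)
      finally show ?thesis using that finB by simp
    qed
    have "f x = (\<Sum>b\<in>B. u b *\<^sub>R f b)" by (simp add: u linear_sum[OF lin] linear_scale[OF lin])
    then have "x \<bullet> f x = (\<Sum>b\<in>B. u b * (x \<bullet> f b))" by (simp add: inner_sum_right)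
    also have "\<dots> = (\<Sum>b\<in>B. m b * (u b)\<^sup>2)"
    proof (rule sum.cong[OF refl])
      fix b assume b: "b \<in> B"
      show "u b * (x \<bullet> f b) = m b * (u b)\<^sup>2"
        using m(2)[OF b] xb[OF b] by (simp add: power2_eq_square)
    qed
    also have "\<dots> < (\<Sum>b\<in>B. 0)"
    proof (rule sum_strict_mono_ex1[OF finB])
      show "\<forall>b\<in>B. m b * (u b)\<^sup>2 \<le> 0"
        using m(1) by (auto simp: mult_le_0_iff less_imp_le)
      obtain b where "b \<in> B" "u b \<noteq> 0"
        using x(2) sum.neutral[of B "\<lambda>b. u b *\<^sub>R b"] u by auto
      then show "\<exists>b\<in>B. m b * (u b)\<^sup>2 < 0"
        using m(1) by (auto intro!: bexI[of _ b] mult_neg_pos)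
    qed
    finally show ?thesis by simp
  qed
  then show ?thesis using B(3) by (auto simp: negative_on_def subspace_negative_eigenspace)
qed

lemma dim_negative_eigenspace:
  fixes f :: "'a::euclidean_space \<Rightarrow> 'a"
  assumes f: "self_adjoint f"
  shows "dim (negative_eigenspace f) = morse_index (\<lambda>x. x \<bullet> f x)"
proof (rule antisym)
  show "dim (negative_eigenspace f) \<le> morse_index (\<lambda>x. x \<bullet> f x)"
    by (rule dim_le_morse_index[OF negative_on_negative_eigenspace[OF f]])
  have "morse_index (\<lambda>x. x \<bullet> f x) + dim ((negative_eigenspace f)\<^sup>\<bottom>) \<le> DIM('a)"
  proof (rule morse_index_plus_dim_nonneg)
    show "subspace ((negative_eigenspace f)\<^sup>\<bottom>)" by (rule subspace_orthogonal_comp)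
    show "0 \<le> x \<bullet> f x" if "x \<in> (negative_eigenspace f)\<^sup>\<bottom>" for x
      by (rule nonneg_on_negative_eigenspace_comp[OF f that])
  qed
  then show "morse_index (\<lambda>x. x \<bullet> f x) \<le> dim (negative_eigenspace f)"
    using dim_orthogonal_complement[OF subspace_negative_eigenspace, of f] by linarith
qed

text \<open>
  For a self-adjoint map the bound of \<open>morse_index_plus_dim_nonneg\<close> is sharp.
\<close>

lemma nonneg_complement:
  fixes f :: "'a::euclidean_space \<Rightarrow> 'a"
  assumes f: "self_adjoint f"
  obtains P where "subspace P" "\<And>x. x \<in> P \<Longrightarrow> 0 \<le> x \<bullet> f x"
    "dim P + morse_index (\<lambda>x. x \<bullet> f x) = DIM('a)" "\<And>x. x \<in> P \<Longrightarrow> f x \<in> P"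
proof (rule that[of "(negative_eigenspace f)\<^sup>\<bottom>"])
  show "dim ((negative_eigenspace f)\<^sup>\<bottom>) + morse_index (\<lambda>x. x \<bullet> f x) = DIM('a)"
    using dim_orthogonal_complement[OF subspace_negative_eigenspace, of f] dim_negative_eigenspace[OF f]
    by simp
  show "subspace ((negative_eigenspace f)\<^sup>\<bottom>)" by (rule subspace_orthogonal_comp)
  show "0 \<le> x \<bullet> f x" if "x \<in> (negative_eigenspace f)\<^sup>\<bottom>" for x
    by (rule nonneg_on_negative_eigenspace_comp[OF f that])
  show "f x \<in> (negative_eigenspace f)\<^sup>\<bottom>" if "x \<in> (negative_eigenspace f)\<^sup>\<bottom>" for x
    by (rule image_negative_eigenspace_comp[OF f that])
qed

text \<open>
  Sylvester's law of inertia. The sum is at most the dimension because the kernel can be joined to a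
  positive subspace without the form becoming negative. It is at least the dimension because the
  invariant nonnegative and nonpositive subspaces of \<open>nonneg_complement\<close> meet inside the kernel.
\<close>

lemma morse_index_plus_morse_index_neg:
  fixes f :: "'a::euclidean_space \<Rightarrow> 'a"
  assumes f: "self_adjoint f"
  shows "morse_index (\<lambda>x. x \<bullet> f x) + morse_index (\<lambda>x. - (x \<bullet> f x)) + dim {x. f x = 0} = DIM('a)"
proof -
  have lin: "linear f" and sym: "\<And>x y. x \<bullet> f y = f x \<bullet> y" using f by (auto simp: self_adjoint_def)
  have f': "self_adjoint (\<lambda>x. - f x)" using f by (auto simp: self_adjoint_def linear_compose_neg)
  have sK: "subspace {x. f x = 0}" by (rule linear_subspace_kernel[OF lin])
  obtain N where N: "negative_on (\<lambda>x. - (x \<bullet> f x)) N" "dim N = morse_index (\<lambda>x. - (x \<bullet> f x))"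
    by (rule morse_index_attained)
  have sN: "subspace N" using N by (simp add: negative_on_def)
  define S where "S = {x + y |x y. x \<in> N \<and> y \<in> {x. f x = 0}}"
  have "N \<inter> {x. f x = 0} = {0}"
    using N(1) subspace_0[OF sN] subspace_0[OF sK] by (force simp: negative_on_def)
  then have dS: "dim S = dim N + dim {x. f x = 0}"
    using dim_sums_Int[OF sN sK] by (simp add: S_def)
  have "morse_index (\<lambda>x. x \<bullet> f x) + dim S \<le> DIM('a)"
  proof (rule morse_index_plus_dim_nonneg)
    show "subspace S" unfolding S_def by (rule subspace_sums[OF sN sK])
    fix z assume "z \<in> S"
    then obtain x y where "z = x + y" "x \<in> N" "f y = 0" by (auto simp: S_def)
    then have "z \<bullet> f z = x \<bullet> f x" using sym[of y x] by (simp add: linear_add[OF lin] inner_add)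
    moreover have "0 \<le> x \<bullet> f x"
      using N(1) \<open>x \<in> N\<close> by (cases "x = 0") (force simp: negative_on_def)+
    ultimately show "0 \<le> z \<bullet> f z" by simp
  qed
  then have le: "morse_index (\<lambda>x. x \<bullet> f x) + morse_index (\<lambda>x. - (x \<bullet> f x)) + dim {x. f x = 0} \<le> DIM('a)"
    using N(2) dS by linarith
  obtain P where P: "subspace P" "\<And>x. x \<in> P \<Longrightarrow> 0 \<le> x \<bullet> f x"
    "dim P + morse_index (\<lambda>x. x \<bullet> f x) = DIM('a)" "\<And>x. x \<in> P \<Longrightarrow> f x \<in> P"
    using nonneg_complement[OF f] by metis
  obtain P' where P': "subspace P'" "\<And>x. x \<in> P' \<Longrightarrow> 0 \<le> x \<bullet> - f x"
    "dim P' + morse_index (\<lambda>x. x \<bullet> - f x) = DIM('a)" "\<And>x. x \<in> P' \<Longrightarrow> - f x \<in> P'"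
    using nonneg_complement[OF f'] by metis
  have "P \<inter> P' \<subseteq> {x. f x = 0}"
  proof
    fix x assume x: "x \<in> P \<inter> P'"
    then have "x \<bullet> f x = 0" using P(2)[of x] P'(2)[of x] by simp
    then have "f x \<bullet> f x = 0"
      using nonneg_form_null_vector[OF f P(1,2), of x "f x"] x P(4) by simp
    then show "x \<in> {x. f x = 0}" by simp
  qed
  then have "dim (P \<inter> P') \<le> dim {x. f x = 0}" by (rule dim_subset)
  moreover have "dim {x + y |x y. x \<in> P \<and> y \<in> P'} \<le> DIM('a)" by (rule dim_subset_UNIV)
  ultimately show ?thesis
    using dim_sums_Int[OF P(1) P'(1)] P(3) P'(3)[unfolded inner_minus_right] le by linarith
qed

lemma morse_index_product:
  fixes f :: "'a::euclidean_space \<Rightarrow> 'a" and g :: "'b::euclidean_space \<Rightarrow> 'b"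
  assumes f: "self_adjoint f" and g: "self_adjoint g"
  shows "morse_index (\<lambda>(x, y). x \<bullet> f x + y \<bullet> g y) = morse_index (\<lambda>x. x \<bullet> f x) + morse_index (\<lambda>y. y \<bullet> g y)"
proof (rule antisym)
  obtain P where P: "subspace P" "\<And>x. x \<in> P \<Longrightarrow> 0 \<le> x \<bullet> f x"
    "dim P + morse_index (\<lambda>x. x \<bullet> f x) = DIM('a)" using nonneg_complement[OF f] by metis
  obtain P' where P': "subspace P'" "\<And>x. x \<in> P' \<Longrightarrow> 0 \<le> x \<bullet> g x"
    "dim P' + morse_index (\<lambda>x. x \<bullet> g x) = DIM('b)" using nonneg_complement[OF g] by metis
  have "morse_index (\<lambda>(x, y). x \<bullet> f x + y \<bullet> g y) + dim (P \<times> P') \<le> DIM('a \<times> 'b)"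
    by (rule morse_index_plus_dim_nonneg) (use P P' in \<open>auto intro: subspace_Times\<close>)
  then show "morse_index (\<lambda>(x, y). x \<bullet> f x + y \<bullet> g y) \<le> morse_index (\<lambda>x. x \<bullet> f x) + morse_index (\<lambda>y. y \<bullet> g y)"
    using P(3) P'(3) dim_Times[OF P(1) P'(1)] by simp
next
  obtain N where N: "negative_on (\<lambda>x. x \<bullet> f x) N" "dim N = morse_index (\<lambda>x. x \<bullet> f x)" by (rule morse_index_attained)
  obtain N' where N': "negative_on (\<lambda>x. x \<bullet> g x) N'" "dim N' = morse_index (\<lambda>x. x \<bullet> g x)" by (rule morse_index_attained)
  have s: "subspace N" "subspace N'" using N N' by (auto simp: negative_on_def)
  have z: "f 0 = 0" "g 0 = 0" using f g by (auto simp: self_adjoint_def linear_0)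
  have "negative_on (\<lambda>(x, y). x \<bullet> f x + y \<bullet> g y) (N \<times> N')"
    unfolding negative_on_def
  proof (intro conjI ballI impI)
    show "subspace (N \<times> N')" by (rule subspace_Times[OF s])
    fix z assume "z \<in> N \<times> N'" "z \<noteq> 0"
    then obtain x y where zz: "z = (x, y)" "x \<in> N" "y \<in> N'" "x \<noteq> 0 \<or> y \<noteq> 0" by (cases z) (auto simp: zero_prod_def)
    have "x = 0 \<or> x \<bullet> f x < 0" "y = 0 \<or> y \<bullet> g y < 0" using N(1) N'(1) zz by (auto simp: negative_on_def)
    then show "(case z of (x, y) \<Rightarrow> x \<bullet> f x + y \<bullet> g y) < 0" using zz z by auto
  qed
  from dim_le_morse_index[OF this]
  show "morse_index (\<lambda>x. x \<bullet> f x) + morse_index (\<lambda>y. y \<bullet> g y) \<le> morse_index (\<lambda>(x, y). x \<bullet> f x + y \<bullet> g y)"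
    using dim_Times[OF s] N(2) N'(2) by simp
qed

lemma inner_matrix_transpose: "x \<bullet> ((A :: real^'n^'m) *v y) = (transpose A *v x) \<bullet> y"
  using dot_lmul_matrix[of x A y] by (simp add: matrix_vector_mult_def vector_matrix_mult_def transpose_def mult.commute)

lemma self_adjoint_matrix:
  fixes A :: "real^'n^'n"
  assumes "transpose A = A"
  shows "self_adjoint ((*v) A)"
  unfolding self_adjoint_def using inner_matrix_transpose[of _ A] assms by simp

lemma ind_eq_morse_index:
  fixes A :: "real^'n^'n"
  assumes "transpose A = A"
  shows "ind A = morse_index (\<lambda>x. x \<bullet> (A *v x))"
proof -
  have f: "self_adjoint ((*v) A)" by (rule self_adjoint_matrix[OF assms])
  obtain B where B: "pairwise orthogonal B" "\<And>b. b \<in> B \<Longrightarrow> norm b = 1"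
    "span B = negative_eigenspace ((*v) A)" "card B = ind A"
    using orthonormal_negative_eigenbasis[OF f] unfolding ind_def by blast
  have "independent B"
    by (rule pairwise_orthogonal_independent[OF B(1)]) (use B(2) in force)
  then have "dim (span B) = card B" by (simp add: dim_eq_card_independent)
  then show ?thesis using B(3,4) dim_negative_eigenspace[OF f] by simp
qed

lemma dim_kernel_plus_rank:
  fixes A :: "real^'n^'m"
  shows "dim {x. A *v x = 0} + rank A = CARD('n)"
proof -
  have "{x. A *v x = 0} = (span (rows A))\<^sup>\<bottom>"
  proof
    show "{x. A *v x = 0} \<subseteq> (span (rows A))\<^sup>\<bottom>"
      using orthogonal_nullspace_rowspace[of A] by (auto simp: orthogonal_comp_def orthogonal_commute)
    show "(span (rows A))\<^sup>\<bottom> \<subseteq> {x. A *v x = 0}"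
    proof
      fix x assume x: "x \<in> (span (rows A))\<^sup>\<bottom>"
      have "(A *v x) $ i = 0" for i
      proof -
        have "row i A \<in> span (rows A)" by (rule span_base) (auto simp: rows_def)
        then have "orthogonal (row i A) x" using x by (simp add: orthogonal_comp_def)
        then show ?thesis by (simp add: matrix_vector_mul_component row_def orthogonal_def)
      qed
      then show "x \<in> {x. A *v x = 0}" by (simp add: vec_eq_iff)
    qed
  qed
  then show ?thesis
    using dim_orthogonal_complement[of "span (rows A)"] by (simp add: row_rank_def)
qed

lemma matrix_vector_mult_uminus: "(- A) *v x = - ((A :: real^'n^'m) *v x)"
  by (simp add: matrix_vector_mult_def vec_eq_iff sum_negf)

lemma rank_eq_ind_plus_ind_neg:
  fixes A :: "real^'n^'n"
  assumes "transpose A = A"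
  shows "rank A = ind A + ind (- A)"
proof -
  have t: "transpose (- A) = - A" using assms by (simp add: transpose_def vec_eq_iff)
  have "ind A + ind (- A) + dim {x. A *v x = 0} = CARD('n)"
    using morse_index_plus_morse_index_neg[OF self_adjoint_matrix[OF assms]]
      ind_eq_morse_index[OF assms] ind_eq_morse_index[OF t]
    by (simp add: matrix_vector_mult_uminus)
  with dim_kernel_plus_rank[of A] show ?thesis by linarith
qed

section \<open>The Moore-Penrose inverse\<close>

definition penrose :: "real^'n^'m \<Rightarrow> real^'m^'n \<Rightarrow> bool" where
  "penrose A X \<longleftrightarrow> A ** X ** A = A \<and> X ** A ** X = X \<and>
     transpose (A ** X) = A ** X \<and> transpose (X ** A) = X ** A"

lemma penrose_unique:
  assumes X: "penrose A X" and Y: "penrose A Y"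
  shows "X = Y"
proof -
  have x: "A ** X ** A = A" "X ** A ** X = X" "transpose (A ** X) = A ** X" "transpose (X ** A) = X ** A"
    using X by (auto simp: penrose_def)
  have y: "A ** Y ** A = A" "Y ** A ** Y = Y" "transpose (A ** Y) = A ** Y" "transpose (Y ** A) = Y ** A"
    using Y by (auto simp: penrose_def)
  have AX: "A ** X = A ** Y"
  proof -
    have "A ** X = (A ** Y) ** (A ** X)" by (simp add: y(1) matrix_mul_assoc)
    also have "\<dots> = transpose ((A ** X) ** (A ** Y))" by (simp only: matrix_transpose_mul[of "A ** X" "A ** Y"] x(3) y(3))
    also have "(A ** X) ** (A ** Y) = A ** Y" by (simp add: x(1) matrix_mul_assoc)
    finally show ?thesis by (simp add: y(3))
  qed
  have XA: "X ** A = Y ** A"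
  proof -
    have "X ** A = (X ** A) ** (Y ** A)" by (metis y(1) matrix_mul_assoc)
    also have "\<dots> = transpose ((Y ** A) ** (X ** A))" by (simp only: matrix_transpose_mul[of "Y ** A" "X ** A"] x(4) y(4))
    also have "(Y ** A) ** (X ** A) = Y ** A" by (metis x(1) matrix_mul_assoc)
    finally show ?thesis by (simp add: y(4))
  qed
  show ?thesis by (metis AX XA x(2) y(2) matrix_mul_assoc)
qed

text \<open>
  The value at \<open>y\<close> is the least-squares solution of \<open>A x = y\<close> that is orthogonal to the kernel. Uniqueness
  of that solution makes the map linear, and the Penrose equations are its orthogonality relations.
\<close>

lemma penrose_exists:
  fixes A :: "real^'n^'m"
  shows "\<exists>X. penrose A X"
proof -
  define K where "K = {x. A *v x = 0}"
  define R where "R = range ((*v) A)"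
  have sK: "subspace K" unfolding K_def by (simp add: linear_subspace_kernel)
  have sR: "subspace R" unfolding R_def by (simp add: linear_subspace_image)
  define is_sol where "is_sol = (\<lambda>y x. (\<forall>k\<in>K. x \<bullet> k = 0) \<and> (\<forall>r\<in>R. (y - A *v x) \<bullet> r = 0))"
  have ex: "\<exists>x. is_sol y x" for y
  proof -
    obtain p z where p: "p \<in> span R" "\<And>w. w \<in> span R \<Longrightarrow> orthogonal z w" "y = p + z"
      using orthogonal_subspace_decomp_exists by metis
    have "p \<in> R" using p(1) sR by (metis span_eq_iff)
    then obtain x0 where x0: "p = A *v x0" by (auto simp: R_def)
    obtain k x where k: "k \<in> span K" "\<And>w. w \<in> span K \<Longrightarrow> orthogonal x w" "x0 = k + x"
      using orthogonal_subspace_decomp_exists by metis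
    have "A *v k = 0" using k(1) sK by (metis span_eq_iff K_def mem_Collect_eq)
    then have "A *v x = p" using x0 k(3) by (simp add: matrix_vector_right_distrib)
    then have "is_sol y x" using k(2) p(2,3) by (auto simp: is_sol_def orthogonal_def span_base)
    then show ?thesis ..
  qed
  have uniq: "x = x'" if "is_sol y x" "is_sol y x'" for x x' y
  proof -
    have o: "(y - A *v x) \<bullet> (A *v (x' - x)) = 0" "(y - A *v x') \<bullet> (A *v (x' - x)) = 0"
      using that by (auto simp: is_sol_def R_def)
    then have "(A *v (x' - x)) \<bullet> (A *v (x' - x)) = 0"
      by (simp add: inner_diff matrix_vector_mult_diff_distrib)
    then have K: "x' - x \<in> K" by (simp add: K_def)
    then have "(x' - x) \<bullet> (x' - x) = 0" using that unfolding is_sol_def by (simp add: inner_diff_left)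
    then show ?thesis by simp
  qed
  define g where "g y = (SOME x. is_sol y x)" for y
  have g: "is_sol y (g y)" for y unfolding g_def by (rule someI_ex[OF ex])
  have lin: "linear g"
  proof (rule linearI)
    fix x y show "g (x + y) = g x + g y"
    proof (rule uniq[OF g])
      show "is_sol (x + y) (g x + g y)"
        using g[of x] g[of y] unfolding is_sol_def
        by (auto simp: matrix_vector_right_distrib inner_diff inner_add algebra_simps)
    qed
  next
    fix c x show "g (c *\<^sub>R x) = c *\<^sub>R g x"
    proof (rule uniq[OF g])
      show "is_sol (c *\<^sub>R x) (c *\<^sub>R g x)"
        using g[of x] unfolding is_sol_def
        by (auto simp: linear_scale[OF matrix_vector_mul_linear] scaleR_diff_right[symmetric])
    qed
  qed
  define X where "X = matrix g"
  have X: "X *v y = g y" for y unfolding X_def using lin by (simp add: matrix_works)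
  have gK: "g y \<bullet> k = 0" if "A *v k = 0" for y k using g[of y] that by (auto simp: is_sol_def K_def)
  have gR: "(y - A *v g y) \<bullet> (A *v x) = 0" for y x using g[of y] by (auto simp: is_sol_def R_def)
  have AXA: "A *v g (A *v x) = A *v x" for x
  proof -
    have "(A *v x - A *v g (A *v x)) \<bullet> (A *v (x - g (A *v x))) = 0" by (rule gR)
    then show ?thesis by (simp add: matrix_vector_mult_diff_distrib)
  qed
  have "g (A *v g y) = g y" for y
    by (rule uniq[OF g]) (use g[of y] in \<open>auto simp: is_sol_def\<close>)
  then have XAX: "X ** A ** X = X" by (simp add: matrix_eq matrix_vector_mul_assoc[symmetric] X)
  have 1: "A ** X ** A = A" by (simp add: matrix_eq matrix_vector_mul_assoc[symmetric] X AXA)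
  have sym: "transpose M = M" if "\<And>x y. x \<bullet> (M *v y) = (M *v x) \<bullet> y" for M :: "real^'k^'k"
  proof -
    have "(transpose M *v x) \<bullet> y = (M *v x) \<bullet> y" for x y
      using that[of x y] inner_matrix_transpose[of x M y] by simp
    then have "transpose M *v x = M *v x" for x using vector_eq_rdot by blast
    then show ?thesis by (simp add: matrix_eq)
  qed
  have 2: "transpose (A ** X) = A ** X"
  proof (rule sym)
    fix x y
    have "x \<bullet> (A *v g y) = (A *v g x) \<bullet> (A *v g y)" "(A *v g x) \<bullet> y = (A *v g x) \<bullet> (A *v g y)"
      using gR[of x "g y"] gR[of y "g x"] by (simp_all add: inner_diff inner_commute)
    then show "x \<bullet> (A ** X *v y) = (A ** X *v x) \<bullet> y" by (simp add: matrix_vector_mul_assoc[symmetric] X)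
  qed
  have 3: "transpose (X ** A) = X ** A"
  proof (rule sym)
    fix x y
    have z: "A *v (g (A *v x) - x) = 0" for x by (simp add: matrix_vector_mult_diff_distrib AXA)
    have "x \<bullet> g (A *v y) = g (A *v x) \<bullet> g (A *v y)" "g (A *v x) \<bullet> y = g (A *v x) \<bullet> g (A *v y)"
      using gK[OF z[of x], of "A *v y"] gK[OF z[of y], of "A *v x"] by (simp_all add: inner_diff inner_commute)
    then show "x \<bullet> (X ** A *v y) = (X ** A *v x) \<bullet> y" by (simp add: matrix_vector_mul_assoc[symmetric] X)
  qed
  show ?thesis using 1 2 3 XAX by (auto simp: penrose_def)
qed

lemma penrose_pinv: "penrose A (pinv A)"
proof -
  have "\<exists>!X. penrose A X" using penrose_exists penrose_unique by metis
  then have "penrose A (THE X. penrose A X)" by (rule theI')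
  then show ?thesis by (simp add: pinv_def penrose_def)
qed

lemmas pinv_penrose = penrose_pinv[unfolded penrose_def]

section \<open>The index of a parallel sum\<close>

lemma rank_inner_inverse_mult:
  fixes M :: "real^'n^'m"
  assumes "M ** H ** M = M"
  shows "rank (H ** M) = rank M"
  by (metis assms antisym rank_mul_le_right matrix_mul_assoc)

lemma transpose_eqI:
  fixes A :: "real^'n^'n"
  assumes "\<And>x y. x \<bullet> (A *v y) = y \<bullet> (A *v x)"
  shows "transpose A = A"
proof -
  have "(transpose A *v x) \<bullet> y = (A *v x) \<bullet> y" for x y
    using assms[of x y] inner_matrix_transpose[of x A y] by (simp add: inner_commute)
  then have "transpose A *v x = A *v x" for x using vector_eq_rdot by blast
  then show ?thesis by (simp add: matrix_eq)
qed

lemma inner_symmetric_matrix: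
  fixes A :: "real^'n^'n"
  shows "transpose A = A \<Longrightarrow> x \<bullet> (A *v y) = y \<bullet> (A *v x)"
  by (metis inner_matrix_transpose inner_commute)

text \<open>
  For invertible \<open>Q0\<close>, \<open>QB\<close> and \<open>Q0 + QB\<close> the matrix \<open>P\<close> is the parallel sum
  \<open>Q0 (Q0 + QB)\<^sup>-\<^sup>1 QB\<close>, and the identity is the additivity of the index under a Schur complement: the form
  \<open>diag(QB, Q0)\<close> is congruent to \<open>F\<close>, the block form with rows \<open>(QB, QB)\<close> and \<open>(QB, Q0 + QB)\<close>, and elimination
  of its second variable leaves \<open>P\<close>. In general that elimination is possible only on the kernel of \<open>M\<close>. Every
  direction orthogonal to this kernel pairs with the kernel of \<open>Q0 + QB\<close> into a hyperbolic plane, which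
  contributes one negative direction; altogether they contribute \<open>rank M\<close>.
\<close>

lemma rank_plus_ind_parallel_sum:
  fixes Q0 QB D0 Ds :: "real^'n^'n"
  assumes sym0: "transpose Q0 = Q0" and symB: "transpose QB = QB"
    and inv0: "invertible D0" and invs: "invertible Ds"
    and X: "X = Q0 ** D0" and B: "B = transpose Ds ** QB"
    and X1: "X1 = transpose Ds ** (Q0 + QB) ** D0"
    and M: "M = (mat 1 - X1 ** pinv X1) ** B"
    and T: "T = mat 1 - pinv M ** M"
    and P: "P = T ** X ** pinv X1 ** B ** T"
  shows "rank M + ind P + ind (Q0 + QB) = ind Q0 + ind QB"
proof -
  define Q where "Q = Q0 + QB"
  define G where "G = pinv X1"
  define H where "H = pinv M"
  define Pi where "Pi = mat 1 - X1 ** G"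
  define E where "E = D0 ** G ** B"
  have symQ: "transpose Q = Q" using sym0 symB by (simp add: Q_def transpose_def vec_eq_iff)
  have g: "X1 ** G ** X1 = X1" "transpose (X1 ** G) = X1 ** G" using pinv_penrose[of X1] by (auto simp: G_def)
  have h: "M ** H ** M = M" "transpose (H ** M) = H ** M" using pinv_penrose[of M] by (auto simp: H_def)
  have Q0v: "Q0 *v x = Q *v x - QB *v x" for x by (simp add: Q_def matrix_vector_mult_add_rdistrib)
  have Qc: "x \<bullet> (Q *v y) = y \<bullet> (Q *v x)" for x y by (rule inner_symmetric_matrix[OF symQ])
  have QBc: "x \<bullet> (QB *v y) = y \<bullet> (QB *v x)" for x y by (rule inner_symmetric_matrix[OF symB])
  have Tv: "T *v c = c - H *v (M *v c)" for c
    by (simp add: T H_def matrix_vector_mult_diff_rdistrib matrix_vector_mul_assoc)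
  have symT: "transpose T = T" using h(2) by (simp add: T H_def transpose_def vec_eq_iff mat_def)
  have MT: "M *v (T *v c) = 0" for c
    using h(1) by (simp add: Tv matrix_vector_mult_diff_distrib matrix_vector_mul_assoc matrix_mul_assoc)
  have Tid: "M *v c = 0 \<Longrightarrow> T *v c = c" for c by (simp add: Tv)
  have TT: "T *v (T *v c) = T *v c" for c by (rule Tid[OF MT])
  have Mv: "M *v c = Pi *v (B *v c)" for c
    by (simp add: M Pi_def G_def matrix_vector_mul_assoc)
  have Piv: "Pi *v x = x - X1 *v (G *v x)" for x
    by (simp add: Pi_def matrix_vector_mult_diff_rdistrib matrix_vector_mul_assoc)
  have X1v: "X1 *v x = transpose Ds *v (Q *v (D0 *v x))" for x
    by (simp add: X1 Q_def matrix_vector_mul_assoc[symmetric] matrix_mul_assoc)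
  have Bv: "B *v x = transpose Ds *v (QB *v x)" for x
    by (simp add: B matrix_vector_mul_assoc[symmetric])
  have cancel: "x = y" if "transpose Ds *v x = transpose Ds *v y" for x y
  proof -
    have "invertible (transpose Ds)" using invs by (simp add: invertible_det_nz)
    then show ?thesis using that by (metis inj_matrix_vector_mult injD)
  qed
  \<comment> \<open>\<open>E\<close> solves for the variable that is eliminated, wherever this is possible.\<close>
  have QE: "Q *v (E *v c) = QB *v c" if "M *v c = 0" for c
  proof (rule cancel)
    have "X1 *v (G *v (B *v c)) = B *v c" using that by (simp add: Mv Piv)
    then show "transpose Ds *v (Q *v (E *v c)) = transpose Ds *v (QB *v c)"
      by (simp add: E_def X1v Bv matrix_vector_mul_assoc[symmetric])
  qed
  have Pv: "P *v c = T *v (Q0 *v (E *v (T *v c)))" for c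
    by (simp add: P X E_def G_def matrix_vector_mul_assoc[symmetric])
  have Pform: "c \<bullet> (P *v d) = (T *v c) \<bullet> (QB *v (T *v d)) - (E *v (T *v c)) \<bullet> (Q *v (E *v (T *v d)))" for c d
  proof -
    have "c \<bullet> (P *v d) = (T *v c) \<bullet> (Q0 *v (E *v (T *v d)))"
      unfolding Pv by (simp add: inner_matrix_transpose[of c T] symT)
    also have "\<dots> = (T *v c) \<bullet> (Q *v (E *v (T *v d))) - (E *v (T *v d)) \<bullet> (QB *v (T *v c))"
      by (simp add: Q0v inner_diff QBc[of "T *v c"])
    also have "QB *v (T *v c) = Q *v (E *v (T *v c))" by (rule QE[OF MT, symmetric])
    also have "Q *v (E *v (T *v d)) = QB *v (T *v d)" by (rule QE[OF MT])
    also have "(E *v (T *v d)) \<bullet> (Q *v (E *v (T *v c))) = (E *v (T *v c)) \<bullet> (Q *v (E *v (T *v d)))" by (rule Qc)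
    finally show ?thesis .
  qed
  have symP: "transpose P = P"
  proof (rule transpose_eqI)
    fix x y
    show "x \<bullet> (P *v y) = y \<bullet> (P *v x)"
      using Pform[of x y] Pform[of y x] QBc[of "T *v x" "T *v y"]
        Qc[of "E *v (T *v x)" "E *v (T *v y)"] by linarith
  qed
  \<comment> \<open>The vectors \<open>Ds Pi z\<close> lie in the kernel of \<open>Q\<close>; they are the partners in the hyperbolic planes.\<close>
  have Pker: "Q *v (Ds *v (Pi *v z)) = 0" for z
  proof -
    have symPi: "transpose Pi = Pi" using g(2) by (simp add: Pi_def transpose_def vec_eq_iff mat_def)
    have "(Q *v (Ds *v (Pi *v z))) \<bullet> y = 0" for y
    proof -
      obtain D0' where D0': "D0 ** D0' = mat 1" using inv0 by (auto simp: invertible_def)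
      define w where "w = D0' *v y"
      have y: "y = D0 *v w" by (simp add: w_def matrix_vector_mul_assoc D0')
      have "(Q *v (Ds *v (Pi *v z))) \<bullet> y = (Ds *v (Pi *v z)) \<bullet> (Q *v y)"
        by (metis Qc inner_commute)
      also have "\<dots> = (Pi *v z) \<bullet> (X1 *v w)"
        using inner_matrix_transpose[of "Pi *v z" "transpose Ds" "Q *v y"] by (simp add: y X1v)
      also have "\<dots> = z \<bullet> (Pi *v (X1 *v w))"
        using inner_matrix_transpose[of z Pi] by (simp add: symPi)
      also have "Pi *v (X1 *v w) = X1 *v w - (X1 ** G ** X1) *v w"
        unfolding Piv by (simp add: matrix_vector_mul_assoc matrix_mul_assoc)
      also have "\<dots> = 0" by (simp add: g(1))
      finally show ?thesis by simp
    qed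
    then show ?thesis by (metis inner_eq_zero_iff)
  qed
  have pairing: "(Ds *v (Pi *v (transpose H *v \<phi>))) \<bullet> (QB *v c) = \<phi> \<bullet> (c - T *v c)" for \<phi> c
  proof -
    have symPi: "transpose Pi = Pi" using g(2) by (simp add: Pi_def transpose_def vec_eq_iff mat_def)
    have "(Ds *v (Pi *v (transpose H *v \<phi>))) \<bullet> (QB *v c) = (Pi *v (transpose H *v \<phi>)) \<bullet> (B *v c)"
      using inner_matrix_transpose[of "Pi *v (transpose H *v \<phi>)" "transpose Ds" "QB *v c"] by (simp add: Bv)
    also have "\<dots> = (transpose H *v \<phi>) \<bullet> (M *v c)"
      using inner_matrix_transpose[of "transpose H *v \<phi>" Pi "B *v c"] by (simp add: symPi Mv)
    also have "\<dots> = \<phi> \<bullet> (c - T *v c)"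
      using inner_matrix_transpose[of \<phi> H "M *v c"] by (simp add: Tv)
    finally show ?thesis .
  qed
  define F where "F = (\<lambda>(c, v). v \<bullet> (Q *v v) + 2 * (v \<bullet> (QB *v c)) + c \<bullet> (QB *v c))"
  define W where "W = (\<lambda>(a, b). a \<bullet> (QB *v a) + b \<bullet> (Q0 *v b))"
  have W: "morse_index W = ind QB + ind Q0"
    unfolding W_def using morse_index_product[OF self_adjoint_matrix[OF symB] self_adjoint_matrix[OF sym0]]
    by (simp add: ind_eq_morse_index[OF symB] ind_eq_morse_index[OF sym0])
  have FW: "F (c, v) = W (v + c, v)" for c v
    by (simp add: F_def W_def Q0v matrix_vector_right_distrib inner_add inner_diff QBc[of c v])
  have "morse_index F = morse_index W"
  proof (rule antisym)
    have l1: "linear (\<lambda>(c, v). (v + c, v) :: (real^'n) \<times> (real^'n))"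
      by (rule linearI) (auto simp: algebra_simps)
    have l2: "linear (\<lambda>(a, b). (a - b, b) :: (real^'n) \<times> (real^'n))"
      by (rule linearI) (auto simp: algebra_simps)
    \<comment> \<open>The two substitutions are inverse to each other, so \<open>F\<close> and \<open>W\<close> have the same index.\<close>
    have e1: "F = (\<lambda>x. W (case x of (c, v) \<Rightarrow> (v + c, v)))" by (auto simp: FW)
    have e2: "W = (\<lambda>x. F (case x of (a, b) \<Rightarrow> (a - b, b)))" by (auto simp: FW)
    show "morse_index F \<le> morse_index W"
      by (subst e1, rule morse_index_compose_le[OF l1]) (simp add: W_def zero_prod_def)
    show "morse_index W \<le> morse_index F"
      by (subst e2, rule morse_index_compose_le[OF l2]) (simp add: F_def zero_prod_def)
  qed
  with W have mF: "morse_index F = ind QB + ind Q0" by simp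
  \<comment> \<open>On the kernel of \<open>M\<close>, of codimension \<open>rank M\<close>, completing the square turns \<open>F\<close> into \<open>diag(P, Q)\<close>.\<close>
  have upper: "morse_index F \<le> rank M + ind P + ind Q"
  proof -
    define V where "V = (\<lambda>(c, v). c \<bullet> (P *v c) + v \<bullet> (Q *v v))"
    have V: "morse_index V = ind P + ind Q"
      unfolding V_def using morse_index_product[OF self_adjoint_matrix[OF symP] self_adjoint_matrix[OF symQ]]
      by (simp add: ind_eq_morse_index[OF symP] ind_eq_morse_index[OF symQ])
    define Z where "Z = {c. M *v c = 0} \<times> (UNIV :: (real^'n) set)"
    have sK: "subspace {c. M *v c = 0}" by (simp add: linear_subspace_kernel)
    have dZ: "dim Z + rank M = CARD('n) + CARD('n)"
      using dim_kernel_plus_rank[of M] dim_Times[OF sK subspace_UNIV, where ?'b = "real^'n"] by (simp add: Z_def)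
    have l: "linear (\<lambda>(c, v). (c, v + E *v c) :: (real^'n) \<times> (real^'n))"
      by (rule linearI) (auto simp: algebra_simps matrix_vector_right_distrib linear_scale[OF matrix_vector_mul_linear])
    have "morse_index F + dim Z \<le> morse_index (\<lambda>x. V (case x of (c, v) \<Rightarrow> (c, v + E *v c))) + DIM((real^'n) \<times> (real^'n))"
    proof (rule morse_index_restrict)
      show "subspace Z" unfolding Z_def by (rule subspace_Times[OF sK subspace_UNIV])
      fix x assume "x \<in> Z"
      then obtain c v where x: "x = (c, v)" "M *v c = 0" by (auto simp: Z_def)
      show "F x = V (case x of (c, v) \<Rightarrow> (c, v + E *v c))"
        using QE[OF x(2)]
        by (simp add: x F_def V_def Pform Tid[OF x(2)] matrix_vector_right_distrib inner_add Qc[of "E *v c" v])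
    qed
    also have "morse_index (\<lambda>x. V (case x of (c, v) \<Rightarrow> (c, v + E *v c))) \<le> morse_index V"
      by (rule morse_index_compose_le[OF l]) (simp add: V_def zero_prod_def)
    finally show ?thesis using dZ V by simp
  qed
  \<comment> \<open>A substitution into \<open>F\<close> yields \<open>diag(S, Q)\<close>, where \<open>S\<close> is \<open>P\<close> on the kernel of \<open>M\<close> and minus the
    squared norm on its orthogonal complement.\<close>
  have lower: "rank M + ind P + ind Q \<le> morse_index F"
  proof -
    define S where "S = P + T - mat 1"
    define C where "C = T - mat 1"
    have symS: "transpose S = S" and symC: "transpose C = C"
      using symP symT by (auto simp: S_def C_def transpose_def vec_eq_iff mat_def)
    have Sv: "S *v c = P *v c + T *v c - c" for c
      by (simp add: S_def matrix_vector_mult_diff_rdistrib matrix_vector_mult_add_rdistrib)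
    have Cv: "C *v c = T *v c - c" for c
      by (simp add: C_def matrix_vector_mult_diff_rdistrib)
    have Tc: "x \<bullet> (T *v y) = (T *v x) \<bullet> y" for x y using inner_matrix_transpose[of x T y] symT by simp
    have Cform: "c \<bullet> (C *v c) = - ((c - T *v c) \<bullet> (c - T *v c))" for c
    proof -
      have "(T *v c) \<bullet> (T *v c) = c \<bullet> (T *v c)" using Tc[of c "T *v c"] TT[of c] by simp
      then show ?thesis by (simp add: Cv inner_diff inner_commute[of "T *v c" c])
    qed
    have "rank M \<le> ind C"
    proof -
      have "negative_on (\<lambda>c. c \<bullet> (C *v c)) (range ((*v) (H ** M)))"
        unfolding negative_on_def
      proof (intro conjI ballI impI)
        show "subspace (range ((*v) (H ** M)))" by (simp add: linear_subspace_image)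
        fix x assume "x \<in> range ((*v) (H ** M))" "x \<noteq> 0"
        then obtain y where "x = H *v (M *v y)" by (auto simp: matrix_vector_mul_assoc)
        then have "x = y - T *v y" by (simp add: Tv)
        then have "T *v x = 0" using TT[of y] by (simp add: matrix_vector_mult_diff_distrib)
        then show "x \<bullet> (C *v x) < 0" using \<open>x \<noteq> 0\<close> by (simp add: Cform)
      qed
      from dim_le_morse_index[OF this] show ?thesis
        using rank_inner_inverse_mult[OF h(1)] by (simp add: rank_dim_range[symmetric] ind_eq_morse_index[OF symC])
    qed
    have Sge: "ind P + ind C \<le> ind S"
    proof -
      define V where "V = (\<lambda>(a, b). a \<bullet> (P *v a) + b \<bullet> (C *v b))"
      have V: "morse_index V = ind P + ind C"
        unfolding V_def using morse_index_product[OF self_adjoint_matrix[OF symP] self_adjoint_matrix[OF symC]]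
        by (simp add: ind_eq_morse_index[OF symP] ind_eq_morse_index[OF symC])
      have l: "linear (\<lambda>(a, b). T *v a + (b - T *v b))"
        by (rule linearI) (auto simp: algebra_simps matrix_vector_right_distrib linear_scale[OF matrix_vector_mul_linear])
      have "V = (\<lambda>x. (\<lambda>c. c \<bullet> (S *v c)) (case x of (a, b) \<Rightarrow> T *v a + (b - T *v b)))"
      proof (rule ext, clarify)
        fix a b
        define c where "c = T *v a + (b - T *v b)"
        have Tcc: "T *v c = T *v a" by (simp add: c_def matrix_vector_right_distrib matrix_vector_mult_diff_distrib TT)
        have "c \<bullet> (S *v c) = c \<bullet> (P *v c) + c \<bullet> (C *v c)" by (simp add: Sv Cv inner_add inner_diff)
        also have "c \<bullet> (P *v c) = a \<bullet> (P *v a)" by (simp add: Pform Tcc)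
        also have "c \<bullet> (C *v c) = b \<bullet> (C *v b)" unfolding Cform Tcc by (simp add: c_def)
        finally show "V (a, b) = (T *v a + (b - T *v b)) \<bullet> (S *v (T *v a + (b - T *v b)))"
          by (simp add: V_def c_def)
      qed
      then have "morse_index V \<le> morse_index (\<lambda>c. c \<bullet> (S *v c))"
        using morse_index_compose_le[OF l, of "\<lambda>c. c \<bullet> (S *v c)"] by simp
      then show ?thesis using V by (simp add: ind_eq_morse_index[OF symS])
    qed
    define V where "V = (\<lambda>(c, v). c \<bullet> (S *v c) + v \<bullet> (Q *v v))"
    have V: "morse_index V = ind S + ind Q"
      unfolding V_def using morse_index_product[OF self_adjoint_matrix[OF symS] self_adjoint_matrix[OF symQ]]
      by (simp add: ind_eq_morse_index[OF symS] ind_eq_morse_index[OF symQ])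
    define y where "y = (\<lambda>c v. v - E *v (T *v c))"
    \<comment> \<open>The pairing with the kernel of \<open>Q\<close> is used to remove all mixed terms with \<open>c - T c\<close> and to
      replace the quadratic one by minus the squared norm.\<close>
    define \<phi> where "\<phi> = (\<lambda>c v. - (QB *v y c v) - QB *v (T *v c) - (1/2) *\<^sub>R (QB *v (c - T *v c)) - (1/2) *\<^sub>R (c - T *v c))"
    define Ht where "Ht = transpose H"
    define w where "w = (\<lambda>c v. Ds *v (Pi *v (Ht *v \<phi> c v)))"
    have l: "linear (\<lambda>(c, v). (c, y c v + w c v))"
      by (rule linearI)
        (auto simp: algebra_simps matrix_vector_right_distrib matrix_vector_mult_diff_distrib w_def \<phi>_def y_def
          linear_scale[OF matrix_vector_mul_linear] linear_neg[OF matrix_vector_mul_linear])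
    have "V = (\<lambda>x. F (case x of (c, v) \<Rightarrow> (c, y c v + w c v)))"
    proof (rule ext, clarify)
      fix c v
      define c1 where "c1 = T *v c"
      define c2 where "c2 = c - T *v c"
      have c: "c = c1 + c2" by (simp add: c1_def c2_def)
      have yv: "y c v = v - E *v c1" by (simp add: y_def c1_def)
      have QBsum: "QB *v c = QB *v c1 + QB *v c2" by (metis c matrix_vector_right_distrib)
      have QBl: "(QB *v x) \<bullet> c2 = x \<bullet> (QB *v c2)" for x by (metis QBc inner_commute)
      have phi: "\<phi> c v = - (QB *v y c v) - QB *v c1 - (1/2) *\<^sub>R (QB *v c2) - (1/2) *\<^sub>R c2"
        by (simp only: \<phi>_def c1_def c2_def)
      have Qw: "Q *v w c v = 0" by (simp add: w_def Pker)
      have wB: "w c v \<bullet> (QB *v c) = \<phi> c v \<bullet> c2" unfolding w_def Ht_def by (simp only: pairing c2_def)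
      have QEc: "Q *v (E *v c1) = QB *v c1" unfolding c1_def by (rule QE[OF MT])
      have P1: "c \<bullet> (P *v c) = c1 \<bullet> (QB *v c1) - (E *v c1) \<bullet> (QB *v c1)"
        using Pform[of c c] QEc by (simp add: c1_def)
      have "F (c, y c v + w c v) = y c v \<bullet> (Q *v y c v) + 2 * (y c v \<bullet> (QB *v c)) + 2 * (\<phi> c v \<bullet> c2) + c \<bullet> (QB *v c)"
        using Qw wB by (simp add: F_def matrix_vector_right_distrib inner_add Qc[of "w c v" "y c v"])
      also have "y c v \<bullet> (Q *v y c v) = v \<bullet> (Q *v v) - 2 * (v \<bullet> (QB *v c1)) + (E *v c1) \<bullet> (QB *v c1)"
        using QEc by (simp add: yv matrix_vector_mult_diff_distrib inner_diff Qc[of "E *v c1" v])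
      also have "y c v \<bullet> (QB *v c) = v \<bullet> (QB *v c1) - (E *v c1) \<bullet> (QB *v c1) + y c v \<bullet> (QB *v c2)"
        by (simp add: QBsum yv inner_add inner_diff)
      also have "\<phi> c v \<bullet> c2 = - (y c v \<bullet> (QB *v c2)) - c1 \<bullet> (QB *v c2) - (1/2) * (c2 \<bullet> (QB *v c2)) - (1/2) * (c2 \<bullet> c2)"
        unfolding phi
        by (simp add: inner_diff_left QBl)
      also have "c \<bullet> (QB *v c) = c1 \<bullet> (QB *v c1) + 2 * (c1 \<bullet> (QB *v c2)) + c2 \<bullet> (QB *v c2)"
        unfolding QBsum by (subst c) (simp add: inner_add QBc[of c2 c1])
      also have "v \<bullet> (Q *v v) - 2 * (v \<bullet> (QB *v c1)) + (E *v c1) \<bullet> (QB *v c1)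
          + 2 * (v \<bullet> (QB *v c1) - (E *v c1) \<bullet> (QB *v c1) + y c v \<bullet> (QB *v c2))
          + 2 * (- (y c v \<bullet> (QB *v c2)) - c1 \<bullet> (QB *v c2) - (1/2) * (c2 \<bullet> (QB *v c2)) - (1/2) * (c2 \<bullet> c2))
          + (c1 \<bullet> (QB *v c1) + 2 * (c1 \<bullet> (QB *v c2)) + c2 \<bullet> (QB *v c2))
        = v \<bullet> (Q *v v) + c \<bullet> (P *v c) - c2 \<bullet> c2"
        by (simp add: P1)
      also have "\<dots> = V (c, v)"
      proof -
        have "c \<bullet> (S *v c) = c \<bullet> (P *v c) + c \<bullet> (C *v c)" by (simp add: Sv Cv inner_add inner_diff)
        then show ?thesis unfolding V_def by (simp add: Cform c2_def)
      qed
      finally show "V (c, v) = F (c, y c v + w c v)" by simp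
    qed
    then have "morse_index V \<le> morse_index F"
      using morse_index_compose_le[OF l, of F] by (simp add: F_def zero_prod_def)
    then show ?thesis using V Sge \<open>rank M \<le> ind C\<close> by linarith
  qed
  show ?thesis using mF upper lower by (simp add: Q_def)
qed

section \<open>Symplectic linear algebra\<close>

declare transpose_matrix_vector [simp del]

definition up :: "real^('n::finite + 'n) \<Rightarrow> real^'n" where "up x = (\<chi> p. x $ Inl p)"
definition lo :: "real^('n::finite + 'n) \<Rightarrow> real^'n" where "lo x = (\<chi> p. x $ Inr p)"

text \<open>
  The symplectic form \<open>x \<bullet> J\<^sup>T y\<close>. With this sign, a nonnegative \<open>Psi S\<close> means that \<open>omega (S x) (S' x)\<close> is
  nonnegative.
\<close>

definition omega :: "real^('n::finite + 'n) \<Rightarrow> real^('n + 'n) \<Rightarrow> real" where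
  "omega x y = lo x \<bullet> up y - up x \<bullet> lo y"

lemma sum_UNIV_sum: "(\<Sum>i\<in>(UNIV :: ('a::finite + 'b::finite) set). f i) = (\<Sum>p\<in>UNIV. f (Inl p)) + (\<Sum>p\<in>UNIV. f (Inr p))"
  using sum.Plus[of "UNIV :: 'a set" "UNIV :: 'b set" f] by (simp add: o_def)

lemma up_add: "up (x + y) = up x + up y" and up_diff: "up (x - y) = up x - up y"
  and up_scale: "up (c *\<^sub>R x) = c *\<^sub>R up x" and up_0: "up 0 = 0"
  and lo_add: "lo (x + y) = lo x + lo y" and lo_diff: "lo (x - y) = lo x - lo y"
  and lo_scale: "lo (c *\<^sub>R x) = c *\<^sub>R lo x" and lo_0: "lo 0 = 0"
  by (simp_all add: up_def lo_def vec_eq_iff)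

lemma up_lo_eqI: "up x = up y \<Longrightarrow> lo x = lo y \<Longrightarrow> x = y"
  unfolding up_def lo_def vec_eq_iff by (metis vec_lambda_beta sum.exhaust_sel)

lemma inner_up_lo: "x \<bullet> y = up x \<bullet> up y + lo x \<bullet> lo (y :: real^('n::finite + 'n))"
  by (simp add: inner_vec_def sum_UNIV_sum up_def lo_def)

lemma omega_diff_right: "omega x (y - z) = omega x y - omega x z"
  and omega_add_right: "omega x (y + z) = omega x y + omega x z"
  and omega_scale_right: "omega x (c *\<^sub>R y) = c * omega x y"
  by (simp_all add: omega_def up_add lo_add up_diff lo_diff up_scale lo_scale inner_diff inner_add inner_commute algebra_simps)

lemma up_J: "up (symp_J *v x) = lo x"
  by (simp add: up_def lo_def symp_J_def four_blocks_def matrix_vector_mult_def vec_eq_iff sum_UNIV_sum mat_def if_distrib if_distribR cong: if_cong)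

lemma lo_J: "lo (symp_J *v x) = - up x"
  by (simp add: up_def lo_def symp_J_def four_blocks_def matrix_vector_mult_def vec_eq_iff sum_UNIV_sum mat_def if_distrib if_distribR sum_negf cong: if_cong)

lemma omega_eq_inner_left: "omega x y = (symp_J *v x) \<bullet> y"
  by (simp add: inner_up_lo up_J lo_J omega_def)

lemma omega_eq_inner: "omega x y = x \<bullet> (transpose symp_J *v y)"
  using inner_matrix_transpose[of x "transpose symp_J" y] by (simp add: omega_eq_inner_left)

lemma J_J: "transpose symp_J *v (symp_J *v (x :: real^('n::finite + 'n))) = x" and J_J': "symp_J *v (transpose symp_J *v (x :: real^('n::finite + 'n))) = x"
proof -
  have 1: "transpose symp_J *v (symp_J *v x) = x" for x :: "real^('n + 'n)"
  proof -
    have "(transpose symp_J *v (symp_J *v x)) \<bullet> y = x \<bullet> y" for y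
      using omega_eq_inner[of y "symp_J *v x"] by (simp add: inner_commute omega_def up_J lo_J inner_up_lo)
    then show ?thesis using vector_eq_rdot by blast
  qed
  show "transpose symp_J *v (symp_J *v x) = x" by (rule 1)
  have "transpose symp_J ** symp_J = (mat 1 :: 'n mat2)"
    using 1 by (simp add: matrix_eq matrix_vector_mul_assoc[symmetric])
  then have "symp_J ** transpose symp_J = (mat 1 :: 'n mat2)" by (simp add: matrix_left_right_inverse)
  then show "symp_J *v (transpose symp_J *v x) = x" by (simp add: matrix_vector_mul_assoc)
qed

lemma symplectic_iff_omega: "symplectic S \<longleftrightarrow> (\<forall>x y. omega (S *v x) (S *v y) = omega x y)"
proof -
  have e: "omega (S *v x) (S *v y) = (transpose S ** symp_J ** S *v x) \<bullet> y" for x y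
    using inner_matrix_transpose[of "symp_J *v (S *v x)" S y]
    by (simp add: omega_eq_inner_left matrix_vector_mul_assoc[symmetric])
  show ?thesis
    unfolding symplectic_def e unfolding omega_eq_inner_left
    by (metis matrix_eq vector_eq_rdot)
qed

lemma matrix_inv_right: "invertible A \<Longrightarrow> A ** matrix_inv A = mat 1"
  and matrix_inv_left: "invertible A \<Longrightarrow> matrix_inv A ** A = mat 1"
  for A :: "real^'n^'n"
  unfolding invertible_def matrix_inv_def by (metis (mono_tags, lifting) someI_ex)+

lemma matrix_inv_right_vec: "invertible A \<Longrightarrow> A *v (matrix_inv A *v x) = x"
  and matrix_inv_left_vec: "invertible A \<Longrightarrow> matrix_inv A *v (A *v x) = x"
  for A :: "real^'n^'n"
  by (simp_all add: matrix_vector_mul_assoc matrix_inv_right matrix_inv_left)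

lemma symplectic_left_inverse:
  assumes "symplectic S"
  shows "transpose symp_J *v (transpose S *v (symp_J *v (S *v x))) = x"
proof -
  have "transpose S *v (symp_J *v (S *v x)) = symp_J *v x"
    using assms by (simp add: symplectic_def matrix_vector_mul_assoc matrix_mul_assoc)
  then show ?thesis by (simp add: J_J)
qed

lemma symplectic_left_inverse_matrix:
  "symplectic S \<Longrightarrow> (transpose symp_J ** transpose S ** symp_J) ** S = mat 1"
  using symplectic_left_inverse[of S]
  by (simp add: matrix_eq matrix_vector_mul_assoc[symmetric])

lemma symplectic_invertible: "symplectic S \<Longrightarrow> invertible S"
  using symplectic_left_inverse_matrix[of S] matrix_left_right_inverse unfolding invertible_def by blast

lemma symplectic_right_inverse:
  assumes "symplectic S"
  shows "S *v (transpose symp_J *v (transpose S *v (symp_J *v x))) = x"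
proof -
  have "S ** (transpose symp_J ** transpose S ** symp_J) = mat 1"
    using symplectic_left_inverse_matrix[OF assms] by (simp add: matrix_left_right_inverse)
  then have "(S ** (transpose symp_J ** transpose S ** symp_J)) *v x = x" by simp
  then show ?thesis by (simp only: matrix_vector_mul_assoc matrix_mul_assoc)
qed

lemma symplectic_right_inverse':
  assumes "symplectic S"
  shows "S *v (transpose symp_J *v (transpose S *v x)) = transpose symp_J *v x"
  using symplectic_right_inverse[OF assms, of "transpose symp_J *v x"]
  by (simp add: J_J')

lemma symplectic_matrix_inv:
  assumes "symplectic S" shows "symplectic (matrix_inv S)"
  unfolding symplectic_iff_omega
proof (intro allI)
  fix x y
  have "omega (matrix_inv S *v x) (matrix_inv S *v y) = omega (S *v (matrix_inv S *v x)) (S *v (matrix_inv S *v y))"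
    using assms by (simp add: symplectic_iff_omega)
  then show "omega (matrix_inv S *v x) (matrix_inv S *v y) = omega x y"
    using symplectic_invertible[OF assms] by (simp add: matrix_inv_right_vec)
qed

text \<open>
  A symplectic \<open>S\<close> has the inverse \<open>J\<^sup>T S\<^sup>T J\<close>; that it is also a right inverse says that \<open>S\<^sup>T\<close> is symplectic.
\<close>

lemma symplectic_transpose:
  assumes "symplectic S" shows "symplectic (transpose S)"
  unfolding symplectic_iff_omega
proof (intro allI)
  fix x y
  have "omega (transpose S *v x) (transpose S *v y) = x \<bullet> (S *v (transpose symp_J *v (transpose S *v y)))"
    unfolding omega_eq_inner by (simp add: inner_matrix_transpose[of x S])
  then show "omega (transpose S *v x) (transpose S *v y) = omega x y"
    by (simp only: symplectic_right_inverse'[OF assms] omega_eq_inner)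
qed

lemma symplectic_mult: "symplectic S \<Longrightarrow> symplectic T \<Longrightarrow> symplectic (S ** T)"
  by (simp add: symplectic_iff_omega matrix_vector_mul_assoc[symmetric])

lemma symplectic_mat_1: "symplectic (mat 1)"
  by (simp add: symplectic_iff_omega)

lemma upper_mult_vec: "upper Y *v c = up (Y *v c)" and lower_mult_vec: "lower Y *v c = lo (Y *v c)"
  by (simp_all add: upper_def lower_def up_def lo_def matrix_vector_mult_def vec_eq_iff)

lemma up_stack: "up (stack X U *v c) = X *v c" and lo_stack: "lo (stack X U *v c) = U *v c"
  by (simp_all add: stack_def up_def lo_def matrix_vector_mult_def vec_eq_iff)

lemma upper_stack: "upper (stack X U) = X" and lower_stack: "lower (stack X U) = U"
  by (simp_all add: upper_def lower_def stack_def vec_eq_iff)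

definition lagrangian :: "('n::finite) col2 \<Rightarrow> bool" where
  "lagrangian Y \<longleftrightarrow> (\<forall>c d. omega (Y *v c) (Y *v d) = 0) \<and> (\<forall>c. Y *v c = 0 \<longrightarrow> c = 0)"

lemma lagrangian_symplectic_mult:
  assumes "symplectic S" "lagrangian Y" shows "lagrangian (S ** Y)"
  unfolding lagrangian_def
proof (intro conjI allI impI)
  fix c d show "omega (S ** Y *v c) (S ** Y *v d) = 0"
    using assms by (simp add: symplectic_iff_omega lagrangian_def matrix_vector_mul_assoc[symmetric])
next
  fix c assume "S ** Y *v c = 0"
  then have "Y *v c = 0"
    using matrix_inv_left_vec[OF symplectic_invertible[OF assms(1)], of "Y *v c"]
    by (simp add: matrix_vector_mul_assoc[symmetric])
  then show "c = 0" using assms(2) by (simp add: lagrangian_def)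
qed

lemma lagrangian_vertical: "lagrangian (stack 0 (mat 1))"
  unfolding lagrangian_def
proof (intro conjI allI impI)
  fix c d :: "real^'a"
  show "omega (stack 0 (mat 1) *v c) (stack 0 (mat 1) *v d) = 0" by (simp add: omega_def up_stack lo_stack)
next
  fix c :: "real^'a" assume "stack 0 (mat 1) *v c = 0"
  then have "lo (stack 0 (mat 1) *v c) = 0" by (simp add: lo_0)
  then show "c = 0" by (simp add: lo_stack)
qed

lemma lagrangian_conjoined:
  fixes Y :: "('n::finite) col2"
  assumes "lagrangian Y"
  shows "rank Y = CARD('n)" "transpose (upper Y) ** lower Y = transpose (lower Y) ** upper Y"
proof -
  have "inj ((*v) Y)"
    using assms by (simp add: linear_injective_0 lagrangian_def)
  then show "rank Y = CARD('n)" by (simp add: full_rank_injective)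
  have "(transpose (upper Y) *v (lower Y *v d)) \<bullet> c = (transpose (lower Y) *v (upper Y *v d)) \<bullet> c" for c d
    using assms inner_matrix_transpose[of c "transpose (upper Y)"] inner_matrix_transpose[of c "transpose (lower Y)"]
    by (simp add: lagrangian_def omega_def upper_mult_vec lower_mult_vec inner_commute)
  then have "transpose (upper Y) *v (lower Y *v d) = transpose (lower Y) *v (upper Y *v d)" for d
    using vector_eq_rdot by blast
  then show "transpose (upper Y) ** lower Y = transpose (lower Y) ** upper Y"
    by (simp add: matrix_eq matrix_vector_mul_assoc[symmetric])
qed

lemma not_invertible_kernel:
  fixes A :: "real^'n^'n"
  assumes "\<not> invertible A" obtains c where "c \<noteq> 0" "A *v c = 0"
proof -
  have "\<not> (\<forall>x. A *v x = 0 \<longrightarrow> x = 0)"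
    using assms by (simp add: invertible_left_inverse matrix_left_invertible_ker)
  then show ?thesis using that by blast
qed

text \<open>
  For a bad slope there is \<open>c \<noteq> 0\<close> with \<open>U c = - \<tau> X c\<close>. As \<open>X\<^sup>T U\<close> is symmetric, the nonzero vectors \<open>X c\<close> that
  belong to different slopes are orthogonal, like eigenvectors, so there are at most \<open>n\<close> of them.
\<close>

lemma finite_bad_slopes:
  fixes Y :: "('n::finite) col2"
  assumes "lagrangian Y"
  shows "finite {\<tau>. \<not> invertible (lower Y + \<tau> *\<^sub>R upper Y)}"
proof -
  define T where "T = {\<tau>. \<not> invertible (lower Y + \<tau> *\<^sub>R upper Y)}"
  have "\<exists>c. c \<noteq> 0 \<and> lo (Y *v c) = - \<tau> *\<^sub>R up (Y *v c)" if "\<tau> \<in> T" for \<tau>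
  proof -
    have ni: "\<not> invertible (lower Y + \<tau> *\<^sub>R upper Y)" using that by (simp add: T_def)
    obtain c where c: "c \<noteq> 0" "(lower Y + \<tau> *\<^sub>R upper Y) *v c = 0"
      by (rule not_invertible_kernel[OF ni])
    then have "lo (Y *v c) + \<tau> *\<^sub>R up (Y *v c) = 0"
      by (simp add: matrix_vector_mult_add_rdistrib scaleR_matrix_vector_assoc[symmetric] upper_mult_vec lower_mult_vec)
    then have "lo (Y *v c) = - \<tau> *\<^sub>R up (Y *v c)" by (simp add: eq_neg_iff_add_eq_0)
    then show ?thesis using c(1) by blast
  qed
  then obtain c where c: "\<And>\<tau>. \<tau> \<in> T \<Longrightarrow> c \<tau> \<noteq> 0" "\<And>\<tau>. \<tau> \<in> T \<Longrightarrow> lo (Y *v c \<tau>) = - \<tau> *\<^sub>R up (Y *v c \<tau>)"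
    by metis
  define x where "x \<tau> = up (Y *v c \<tau>)" for \<tau>
  have nz: "x \<tau> \<noteq> 0" if "\<tau> \<in> T" for \<tau>
  proof
    assume "x \<tau> = 0"
    then have "Y *v c \<tau> = 0" using c(2)[OF that] by (intro up_lo_eqI) (auto simp: x_def up_0 lo_0)
    then show False using assms c(1)[OF that] by (simp add: lagrangian_def)
  qed
  have orth: "orthogonal (x \<tau>) (x \<sigma>)" if "\<tau> \<in> T" "\<sigma> \<in> T" "\<tau> \<noteq> \<sigma>" for \<tau> \<sigma>
  proof -
    have "omega (Y *v c \<tau>) (Y *v c \<sigma>) = 0" using assms by (simp add: lagrangian_def)
    then have "(\<sigma> - \<tau>) * (x \<tau> \<bullet> x \<sigma>) = 0"
      using c(2)[OF that(1)] c(2)[OF that(2)] by (simp add: omega_def x_def algebra_simps)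
    then show ?thesis using that(3) by (simp add: orthogonal_def)
  qed
  have inj: "inj_on x T"
    by (rule inj_onI) (use orth nz in \<open>metis orthogonal_self\<close>)
  have po: "pairwise orthogonal (x ` T)"
    using orth by (auto simp: pairwise_def)
  have "independent (x ` T)"
    by (rule pairwise_orthogonal_independent[OF po]) (use nz in force)
  then have "finite (x ` T)" by (rule independent_imp_finite)
  then show ?thesis using inj finite_imageD unfolding T_def by blast
qed

section \<open>Monotone families of symmetric matrices\<close>

lemma bounded_bilinear_matrix_vector_mult: "bounded_bilinear ((*v) :: real^'n^'m \<Rightarrow> real^'n \<Rightarrow> real^'m)"
proof (rule bilinear_conv_bounded_bilinear[THEN iffD1])
  show "bilinear ((*v) :: real^'n^'m \<Rightarrow> real^'n \<Rightarrow> real^'m)"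
    unfolding bilinear_def
    by (auto intro!: linearI simp: matrix_vector_right_distrib matrix_vector_mult_add_rdistrib
        scaleR_matrix_vector_assoc[symmetric] linear_scale[OF matrix_vector_mul_linear])
qed

lemma bounded_bilinear_matrix_mult: "bounded_bilinear ((**) :: real^'n^'m \<Rightarrow> real^'p^'n \<Rightarrow> real^'p^'m)"
proof (rule bilinear_conv_bounded_bilinear[THEN iffD1])
  show "bilinear ((**) :: real^'n^'m \<Rightarrow> real^'p^'n \<Rightarrow> real^'p^'m)"
    unfolding bilinear_def
    by (auto intro!: linearI simp: matrix_matrix_mult_def vec_eq_iff sum.distrib sum_distrib_left algebra_simps)
qed

lemma tendsto_det:
  assumes "(D \<longlongrightarrow> D0) F"
  shows "((\<lambda>s. det (D s :: real^'n^'n)) \<longlongrightarrow> det D0) F"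
  unfolding det_def by (intro tendsto_intros assms)

lemma eventually_invertible:
  assumes "(D \<longlongrightarrow> D0) F" "invertible (D0 :: real^'n^'n)"
  shows "\<forall>\<^sub>F s in F. invertible (D s)"
  using tendsto_imp_eventually_ne[OF tendsto_det[OF assms(1)], of 0] assms(2)
  by (simp add: invertible_det_nz)

lemma matrix_inv_vec_cramer:
  fixes A :: "real^'n^'n"
  assumes "invertible A"
  shows "matrix_inv A *v b = (\<chi> k. det (\<chi> i j. if j = k then b $ i else A $ i $ j) / det A)"
  using cramer[of A "matrix_inv A *v b" b] assms matrix_inv_right_vec[OF assms]
  by (simp add: invertible_det_nz)

text \<open>
  By Cramer's rule the solution of a linear system is a quotient of determinants.
\<close>

lemma tendsto_matrix_inv_vec:
  assumes D: "(D \<longlongrightarrow> D0) F" and inv: "invertible (D0 :: real^'n^'n)"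
  shows "((\<lambda>s. matrix_inv (D s) *v b) \<longlongrightarrow> matrix_inv D0 *v b) F"
proof -
  have "((\<lambda>s. (\<chi> k. det (\<chi> i j. if j = k then b $ i else D s $ i $ j) / det (D s)))
      \<longlongrightarrow> (\<chi> k. det (\<chi> i j. if j = k then b $ i else D0 $ i $ j) / det D0)) F"
  proof (intro tendsto_intros tendsto_det D)
    fix k i j
    show "((\<lambda>s. if j = k then b $ i else D s $ i $ j) \<longlongrightarrow> (if j = k then b $ i else D0 $ i $ j)) F"
      using D by (auto intro: tendsto_intros)
    show "det D0 \<noteq> 0" using inv by (simp add: invertible_det_nz)
  qed
  then have "((\<lambda>s. matrix_inv (D s) *v b) \<longlongrightarrow> (\<chi> k. det (\<chi> i j. if j = k then b $ i else D0 $ i $ j) / det D0)) F"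
    by (rule Lim_transform_eventually)
      (use eventually_invertible[OF D inv] in \<open>auto elim!: eventually_mono simp: matrix_inv_vec_cramer\<close>)
  then show ?thesis by (simp add: matrix_inv_vec_cramer[OF inv])
qed

lemma tendsto_matrix_columns:
  fixes A :: "'a \<Rightarrow> real^'n^'m"
  assumes "\<And>b. ((\<lambda>s. A s *v b) \<longlongrightarrow> A0 *v b) F"
  shows "(A \<longlongrightarrow> A0) F"
proof -
  have "((\<lambda>s. A s $ i $ j) \<longlongrightarrow> A0 $ i $ j) F" for i j
    using tendsto_vec_nth[OF assms[of "axis j 1"], of i]
    by (simp add: matrix_vector_mult_basis column_def)
  then have "((\<lambda>s. \<chi> i j. A s $ i $ j) \<longlongrightarrow> (\<chi> i j. A0 $ i $ j)) F"
    by (intro tendsto_vec_lambda)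
  then show ?thesis by simp
qed

lemma tendsto_matrix_inv:
  assumes "(D \<longlongrightarrow> D0) F" "invertible (D0 :: real^'n^'n)"
  shows "((\<lambda>s. matrix_inv (D s)) \<longlongrightarrow> matrix_inv D0) F"
  by (rule tendsto_matrix_columns) (rule tendsto_matrix_inv_vec[OF assms])

text \<open>
  On a negative subspace of the limit, compactness of the unit sphere bounds the form away from \<open>0\<close>, so
  the subspace remains negative for nearby forms.
\<close>

lemma morse_index_lower_semicontinuous:
  fixes Q :: "'a \<Rightarrow> real^'n^'n"
  assumes Q: "(Q \<longlongrightarrow> Q0) F"
  shows "\<forall>\<^sub>F s in F. morse_index (\<lambda>x. x \<bullet> (Q0 *v x)) \<le> morse_index (\<lambda>x. x \<bullet> (Q s *v x))"
proof -
  obtain N where N: "negative_on (\<lambda>x. x \<bullet> (Q0 *v x)) N" "dim N = morse_index (\<lambda>x. x \<bullet> (Q0 *v x))"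
    by (rule morse_index_attained)
  have sN: "subspace N" using N by (simp add: negative_on_def)
  define K where "K = sphere 0 1 \<inter> N"
  have K: "compact K" unfolding K_def by (intro compact_Int_closed compact_sphere closed_subspace sN)
  obtain m where m: "m > 0" "\<And>x. x \<in> K \<Longrightarrow> x \<bullet> (Q0 *v x) \<le> - m"
  proof (cases "K = {}")
    case True then show ?thesis using that[of 1] by auto
  next
    case False
    have "continuous_on K (\<lambda>x. x \<bullet> (Q0 *v x))"
      by (intro continuous_intros linear_continuous_on_compose[OF _ matrix_vector_mul_linear])
    then obtain z where z: "z \<in> K" "\<And>y. y \<in> K \<Longrightarrow> y \<bullet> (Q0 *v y) \<le> z \<bullet> (Q0 *v z)"
      using continuous_attains_sup[OF K False] by blast
    have "z \<bullet> (Q0 *v z) < 0" using z(1) N(1) by (auto simp: K_def negative_on_def)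
    then show ?thesis using that[of "- (z \<bullet> (Q0 *v z))"] z(2) by simp
  qed
  obtain B where B: "B > 0" "\<And>(A :: real^'n^'n) x. norm (A *v x) \<le> norm A * norm x * B"
    using bounded_bilinear.pos_bounded[OF bounded_bilinear_matrix_vector_mult] by blast
  have "\<forall>\<^sub>F s in F. dist (Q s) Q0 < m / B"
    using tendstoD[OF Q, of "m / B"] m(1) B(1) by simp
  then show ?thesis
  proof (rule eventually_mono)
    fix s assume s: "dist (Q s) Q0 < m / B"
    have neg: "x \<bullet> (Q s *v x) < 0" if x: "x \<in> N" "x \<noteq> 0" for x
    proof -
      define u where "u = (1 / norm x) *\<^sub>R x"
      have u: "u \<in> K" "norm u = 1" using x sN by (auto simp: K_def u_def subspace_scale)
      have "u \<bullet> (Q s *v u) = u \<bullet> (Q0 *v u) + u \<bullet> ((Q s - Q0) *v u)"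
        by (simp add: matrix_vector_mult_diff_rdistrib inner_diff)
      also have "u \<bullet> ((Q s - Q0) *v u) \<le> norm u * norm ((Q s - Q0) *v u)" by (rule norm_cauchy_schwarz)
      also have "\<dots> \<le> norm (Q s - Q0) * B" using B(2)[of "Q s - Q0" u] u(2) by simp
      also have "\<dots> < m" using s B(1) by (simp add: dist_norm field_simps)
      also have "u \<bullet> (Q0 *v u) + m \<le> 0" using m(2)[OF u(1)] by simp
      finally have "u \<bullet> (Q s *v u) < 0" by simp
      moreover have "u \<bullet> (Q s *v u) = (x \<bullet> (Q s *v x)) / (norm x)\<^sup>2"
        by (simp add: u_def linear_scale[OF matrix_vector_mul_linear] power2_eq_square)
      ultimately show ?thesis using x(2) by (simp add: divide_less_0_iff)
    qed
    have "negative_on (\<lambda>x. x \<bullet> (Q s *v x)) N" using sN neg by (auto simp: negative_on_def)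
    then show "morse_index (\<lambda>x. x \<bullet> (Q0 *v x)) \<le> morse_index (\<lambda>x. x \<bullet> (Q s *v x))"
      using dim_le_morse_index N(2) by metis
  qed
qed

lemma transpose_uminus: "transpose A = A \<Longrightarrow> transpose (- A) = - (A :: real^'n^'n)"
  by (simp add: transpose_def vec_eq_iff)

lemma ind_mono:
  fixes A B :: "real^'n^'n"
  assumes "transpose A = A" "transpose B = B" "\<And>x. x \<bullet> (A *v x) \<le> x \<bullet> (B *v x)"
  shows "ind B \<le> ind A" "ind (- A) \<le> ind (- B)"
  using assms by (auto simp: ind_eq_morse_index transpose_uminus matrix_vector_mult_uminus intro!: morse_index_mono)

lemma ind_lower_semicontinuous:
  fixes Q :: "'a \<Rightarrow> real^'n^'n"
  assumes Q: "(Q \<longlongrightarrow> Q0) F" and sym: "\<forall>\<^sub>F s in F. transpose (Q s) = Q s" "transpose Q0 = Q0"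
  shows "\<forall>\<^sub>F s in F. ind Q0 \<le> ind (Q s)"
  using morse_index_lower_semicontinuous[OF Q] sym(1)
  by eventually_elim (simp add: ind_eq_morse_index sym(2))

text \<open>
  A monotone integer function that is bounded on the side it moves to becomes constant. Natural
  numbers supply the bound.
\<close>

lemma eventually_const_at_left:
  fixes f :: "real \<Rightarrow> nat"
  assumes "a < t0" "\<And>s t. a < s \<Longrightarrow> s \<le> t \<Longrightarrow> t < t0 \<Longrightarrow> f t \<le> f s"
  shows "\<exists>c. \<forall>\<^sub>F t in at_left t0. f t = c"
proof -
  obtain s where s: "a < s" "s < t0" "\<And>t. a < t \<Longrightarrow> t < t0 \<Longrightarrow> f s \<le> f t"
    using ex_has_least_nat[of "\<lambda>t. a < t \<and> t < t0" "(a + t0) / 2" f] assms(1) by auto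
  have "\<forall>\<^sub>F t in at_left t0. f t = f s"
    using s assms by (auto simp: eventually_at_left[OF s(2)] intro!: exI[of _ s] antisym)
  then show ?thesis ..
qed

lemma eventually_const_at_right:
  fixes f :: "real \<Rightarrow> nat"
  assumes "t0 < b" "\<And>s t. t0 < s \<Longrightarrow> s \<le> t \<Longrightarrow> t < b \<Longrightarrow> f s \<le> f t"
  shows "\<exists>c. \<forall>\<^sub>F t in at_right t0. f t = c"
proof -
  obtain s where s: "t0 < s" "s < b" "\<And>t. t0 < t \<Longrightarrow> t < b \<Longrightarrow> f s \<le> f t"
    using ex_has_least_nat[of "\<lambda>t. t0 < t \<and> t < b" "(t0 + b) / 2" f] assms(1) by auto
  have "\<forall>\<^sub>F t in at_right t0. f t = f s"
    using s assms by (auto simp: eventually_at_right[OF s(1)] intro!: exI[of _ s] antisym)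
  then show ?thesis ..
qed

text \<open>
  To the right of \<open>t0\<close>, \<open>ind (Q t)\<close> is at most \<open>ind (Q t0)\<close> by monotonicity and at least that by
  semicontinuity. To the left the same holds for \<open>ind (- Q t)\<close>. Since the rank is the sum of both indices, the
  whole loss of rank in the limit from the left is a loss of \<open>ind\<close>.
\<close>

lemma monotone_matrix_index_jump:
  fixes Q :: "real \<Rightarrow> real^'n^'n"
  assumes \<delta>: "\<delta> > 0"
    and sym: "\<And>t. \<bar>t - t0\<bar> < \<delta> \<Longrightarrow> transpose (Q t) = Q t"
    and mono: "\<And>s t x. t0 - \<delta> < s \<Longrightarrow> s \<le> t \<Longrightarrow> t < t0 + \<delta> \<Longrightarrow> x \<bullet> (Q s *v x) \<le> x \<bullet> (Q t *v x)"
    and cont: "isCont Q t0"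
  obtains l r where
    "\<forall>\<^sub>F t in at_left t0. rank (Q t) = l \<and> ind (Q t) + rank (Q t0) = ind (Q t0) + l"
    "rank (Q t0) \<le> l"
    "\<forall>\<^sub>F t in at_right t0. rank (Q t) = r \<and> ind (Q t) = ind (Q t0)"
proof -
  have symn: "transpose (Q t) = Q t" if "t0 - \<delta> < t" "t < t0 + \<delta>" for t
    using sym[of t] that by (simp add: abs_less_iff)
  have im: "ind (Q t) \<le> ind (Q s)" "ind (- Q s) \<le> ind (- Q t)" if "t0 - \<delta> < s" "s \<le> t" "t < t0 + \<delta>" for s t
    using ind_mono[of "Q s" "Q t"] symn[of s] symn[of t] mono that by auto
  have near: "\<forall>\<^sub>F t in at t0. t0 - \<delta> < t \<and> t < t0 + \<delta>"
    using \<delta> by (auto simp: eventually_at dist_real_def abs_less_iff intro!: exI[of _ \<delta>])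
  have Qlim: "(Q \<longlongrightarrow> Q t0) (at t0)" using cont by (simp add: isCont_def)
  have lsc: "\<forall>\<^sub>F t in at t0. ind (Q t0) \<le> ind (Q t)"
    by (rule ind_lower_semicontinuous[OF Qlim]) (use near \<delta> symn in \<open>auto elim!: eventually_mono\<close>)
  have lsc': "\<forall>\<^sub>F t in at t0. ind (- Q t0) \<le> ind (- Q t)"
    by (rule ind_lower_semicontinuous[OF tendsto_minus[OF Qlim]])
      (use near \<delta> symn in \<open>auto elim!: eventually_mono intro!: transpose_uminus\<close>)
  have lt: "\<forall>\<^sub>F t in at_left t0. t < t0" by (simp add: eventually_at_filter)
  have l: "\<forall>\<^sub>F t in at_left t0. ind (- Q t) = ind (- Q t0)"
    using lsc'[THEN filter_leD[OF at_le[OF subset_UNIV]]] near[THEN filter_leD[OF at_le[OF subset_UNIV]]]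
      lt
    by eventually_elim (use im(2) \<delta> in \<open>force intro: antisym\<close>)
  have ge: "\<forall>\<^sub>F t in at_left t0. ind (Q t0) \<le> ind (Q t)"
    using lsc by (rule filter_leD[OF at_le[OF subset_UNIV]])
  have r: "\<forall>\<^sub>F t in at_right t0. ind (Q t) = ind (Q t0)"
    using lsc[THEN filter_leD[OF at_le[OF subset_UNIV]]] near[THEN filter_leD[OF at_le[OF subset_UNIV]]]
      eventually_at_right_less
    by eventually_elim (use im(1) \<delta> in \<open>force intro: antisym\<close>)
  obtain cl where cl: "\<forall>\<^sub>F t in at_left t0. ind (Q t) = cl"
    using eventually_const_at_left[of "t0 - \<delta>" t0 "\<lambda>t. ind (Q t)"] im(1) \<delta> by force
  obtain cr where cr: "\<forall>\<^sub>F t in at_right t0. ind (- Q t) = cr"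
    using eventually_const_at_right[of t0 "t0 + \<delta>" "\<lambda>t. ind (- Q t)"] im(2) \<delta> by force
  have rk0: "rank (Q t0) = ind (Q t0) + ind (- Q t0)" by (rule rank_eq_ind_plus_ind_neg) (use symn \<delta> in auto)
  show ?thesis
  proof (rule that[of "cl + ind (- Q t0)" "ind (Q t0) + cr"])
    show "\<forall>\<^sub>F t in at_left t0. rank (Q t) = cl + ind (- Q t0) \<and>
        ind (Q t) + rank (Q t0) = ind (Q t0) + (cl + ind (- Q t0))"
      using l cl near[THEN filter_leD[OF at_le[OF subset_UNIV]]]
      by eventually_elim (use rk0 rank_eq_ind_plus_ind_neg[OF symn] in auto)
    have "\<forall>\<^sub>F t in at_left t0. ind (Q t0) \<le> cl"
      using ge cl by eventually_elim simp
    then show "rank (Q t0) \<le> cl + ind (- Q t0)" using rk0 by simp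
    show "\<forall>\<^sub>F t in at_right t0. rank (Q t) = ind (Q t0) + cr \<and> ind (Q t) = ind (Q t0)"
      using r cr near[THEN filter_leD[OF at_le[OF subset_UNIV]]]
      by eventually_elim (use rank_eq_ind_plus_ind_neg[OF symn] in auto)
  qed
qed

lemma nondecreasing_if_deriv_nonneg_off_finite:
  fixes h :: "real \<Rightarrow> real"
  assumes "a \<le> b" "finite F" "continuous_on {a..b} h"
    and "\<And>t. a < t \<Longrightarrow> t < b \<Longrightarrow> t \<notin> F \<Longrightarrow> \<exists>d\<ge>0. (h has_vector_derivative d) (at t)"
  shows "h a \<le> h b"
proof -
  define g where "g = (\<lambda>t. if a < t \<and> t < b \<and> t \<notin> F then SOME d. d \<ge> 0 \<and> (h has_vector_derivative d) (at t) else 0)"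
  have g: "g t \<ge> 0 \<and> (h has_vector_derivative g t) (at t)" if "a < t" "t < b" "t \<notin> F" for t
    unfolding g_def using someI_ex[of "\<lambda>d. d \<ge> 0 \<and> (h has_vector_derivative d) (at t)"] assms(4)[OF that] that by simp
  have "(g has_integral (h b - h a)) {a..b}"
    by (rule fundamental_theorem_of_calculus_interior_strong[OF assms(2,1)]) (use g assms(3) in auto)
  moreover have "g t \<ge> 0" for t using g[of t] by (cases "a < t \<and> t < b \<and> t \<notin> F") (auto simp: g_def)
  ultimately have "0 \<le> h b - h a" by (rule has_integral_nonneg)
  then show ?thesis by simp
qed

section \<open>Monotone Lagrangian curves\<close>

definition monotone_curve :: "(real \<Rightarrow> ('n::finite) col2) \<Rightarrow> bool" where
  "monotone_curve Y \<longleftrightarrow> continuous_on UNIV Y \<and> (\<forall>t. lagrangian (Y t)) \<and>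
     (\<exists>F. (\<forall>a b. finite (F \<inter> {a..b})) \<and>
       (\<forall>t. t \<notin> F \<longrightarrow> (\<exists>Y'. (Y has_vector_derivative Y') (at t) \<and> (\<forall>c. 0 \<le> omega (Y t *v c) (Y' *v c)))))"

definition monotone_system :: "(real \<Rightarrow> ('n::finite) mat2) \<Rightarrow> bool" where
  "monotone_system W \<longleftrightarrow> continuous_on UNIV W \<and> (\<forall>t. symplectic (W t)) \<and>
     (\<exists>F. (\<forall>a b. finite (F \<inter> {a..b})) \<and>
       (\<forall>t. t \<notin> F \<longrightarrow> (\<exists>W'. (W has_vector_derivative W') (at t) \<and> (\<forall>x. 0 \<le> omega (W t *v x) (W' *v x)))))"

lemma monotone_system_Cp1:
  assumes "Cp1 S" "\<And>t. symplectic (S t)" "Psi_nonneg S"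
  shows "monotone_system S"
proof -
  obtain F where F: "\<And>a b. finite (F \<inter> {a..b})" "S C1_differentiable_on (- F)"
    using assms(1) unfolding Cp1_def by blast
  have "\<exists>W'. (S has_vector_derivative W') (at t) \<and> (\<forall>x. 0 \<le> omega (S t *v x) (W' *v x))" if t: "t \<notin> F" for t
  proof -
    obtain W' where W': "(S has_vector_derivative W') (at t)"
      using F(2) t unfolding C1_differentiable_on_def by blast
    then have "S differentiable (at t)" by (rule differentiableI_vector)
    then have "nonneg_definite (Psi S t)" using assms(3) by (simp add: Psi_nonneg_def)
    then have nn: "0 \<le> v \<bullet> (Psi S t *v v)" for v by (simp add: nonneg_definite_def)
    have "omega (S t *v x) (W' *v x) = (S t *v x) \<bullet> (Psi S t *v (S t *v x))" for x
      using symplectic_invertible[OF assms(2), of t] vector_derivative_at[OF W']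
      by (simp add: Psi_def omega_eq_inner matrix_vector_mul_assoc[symmetric] matrix_inv_left_vec)
    then show ?thesis using W' nn by auto
  qed
  then show ?thesis using assms(1,2) F(1) unfolding monotone_system_def Cp1_def by blast
qed

text \<open>
  Constant symplectic factors on both sides preserve \<open>omega (W x) (W' x)\<close> up to a substitution in \<open>x\<close>. This
  is what allows an arbitrary transformation \<open>R\<close>.
\<close>

lemma monotone_system_transform:
  assumes W: "monotone_system W" and P: "symplectic P" and R: "symplectic R"
  shows "monotone_system (\<lambda>t. P ** W t ** R)"
proof -
  obtain F where F: "\<And>a b. finite (F \<inter> {a..b})"
    "\<And>t. t \<notin> F \<Longrightarrow> \<exists>W'. (W has_vector_derivative W') (at t) \<and> (\<forall>x. 0 \<le> omega (W t *v x) (W' *v x))"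
    using W unfolding monotone_system_def by blast
  have bl: "bounded_linear (\<lambda>A. P ** A ** R)"
    by (rule bounded_linear_compose[OF bounded_bilinear.bounded_linear_left[OF bounded_bilinear_matrix_mult]
        bounded_bilinear.bounded_linear_right[OF bounded_bilinear_matrix_mult]])
  have "\<exists>V'. ((\<lambda>t. P ** W t ** R) has_vector_derivative V') (at t) \<and> (\<forall>x. 0 \<le> omega (P ** W t ** R *v x) (V' *v x))"
    if t: "t \<notin> F" for t
  proof -
    obtain W' where W': "(W has_vector_derivative W') (at t)" "\<And>x. 0 \<le> omega (W t *v x) (W' *v x)"
      using F(2)[OF t] by blast
    have "omega (P ** W t ** R *v x) (P ** W' ** R *v x) = omega (W t *v (R *v x)) (W' *v (R *v x))" for x
      using P by (simp add: symplectic_iff_omega matrix_vector_mul_assoc[symmetric])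
    then show ?thesis
      using bounded_linear.has_vector_derivative[OF bl W'(1)] W'(2) by auto
  qed
  moreover have "continuous_on UNIV (\<lambda>t. P ** W t ** R)"
    using W by (intro bounded_linear.continuous_on[OF bl]) (simp add: monotone_system_def)
  moreover have "symplectic (P ** W t ** R)" for t
    using W P R by (simp add: monotone_system_def symplectic_mult)
  ultimately show ?thesis using F(1) unfolding monotone_system_def by blast
qed

lemma monotone_curve_const: "lagrangian Y \<Longrightarrow> monotone_curve (\<lambda>t. Y)"
  unfolding monotone_curve_def
  by (auto intro!: exI[of _ "{}"] exI[of _ 0] simp: omega_def up_0 lo_0)

lemma monotone_curve_mult:
  assumes W: "monotone_system W" and Y: "monotone_curve Y"
  shows "monotone_curve (\<lambda>t. W t ** Y t)"
proof -
  obtain F where F: "\<And>a b. finite (F \<inter> {a..b})"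
    "\<And>t. t \<notin> F \<Longrightarrow> \<exists>W'. (W has_vector_derivative W') (at t) \<and> (\<forall>x. 0 \<le> omega (W t *v x) (W' *v x))"
    using W unfolding monotone_system_def by blast
  obtain G where G: "\<And>a b. finite (G \<inter> {a..b})"
    "\<And>t. t \<notin> G \<Longrightarrow> \<exists>Y'. (Y has_vector_derivative Y') (at t) \<and> (\<forall>c. 0 \<le> omega (Y t *v c) (Y' *v c))"
    using Y unfolding monotone_curve_def by blast
  have fin: "finite ((F \<union> G) \<inter> {a..b})" for a b using F(1) G(1) by (simp add: Int_Un_distrib2)
  have "\<exists>V'. ((\<lambda>t. W t ** Y t) has_vector_derivative V') (at t) \<and> (\<forall>c. 0 \<le> omega (W t ** Y t *v c) (V' *v c))"
    if t: "t \<notin> F \<union> G" for t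
  proof -
    obtain W' where W': "(W has_vector_derivative W') (at t)" "\<And>x. 0 \<le> omega (W t *v x) (W' *v x)"
      using F(2) t by blast
    obtain Y' where Y': "(Y has_vector_derivative Y') (at t)" "\<And>c. 0 \<le> omega (Y t *v c) (Y' *v c)"
      using G(2) t by blast
    have "omega (W t ** Y t *v c) ((W t ** Y' + W' ** Y t) *v c)
        = omega (Y t *v c) (Y' *v c) + omega (W t *v (Y t *v c)) (W' *v (Y t *v c))" for c
      using W by (simp add: monotone_system_def symplectic_iff_omega matrix_vector_mul_assoc[symmetric]
          matrix_vector_mult_add_rdistrib omega_add_right)
    then have "0 \<le> omega (W t ** Y t *v c) ((W t ** Y' + W' ** Y t) *v c)" for c
      using W'(2) Y'(2) by simp
    then show ?thesis
      using bounded_bilinear.has_vector_derivative[OF bounded_bilinear_matrix_mult W'(1) Y'(1)] by blast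
  qed
  moreover have "continuous_on UNIV (\<lambda>t. W t ** Y t)"
    using W Y by (intro bounded_bilinear.continuous_on[OF bounded_bilinear_matrix_mult])
      (auto simp: monotone_system_def monotone_curve_def)
  moreover have "lagrangian (W t ** Y t)" for t
    using W Y by (simp add: monotone_system_def monotone_curve_def lagrangian_symplectic_mult)
  ultimately show ?thesis using fin unfolding monotone_curve_def by blast
qed

definition upper_left :: "('n::finite) mat2 \<Rightarrow> real^'n^'n" where
  "upper_left W = (\<chi> p q. W $ Inl p $ Inl q)"

lemma up_mult_vec: "up (W *v x) = upper_left W *v up x + upper_right W *v lo x"
  by (simp add: up_def lo_def upper_left_def upper_right_def matrix_vector_mult_def vec_eq_iff sum_UNIV_sum)

lemma upper_mult: "upper (W ** Y) = upper_left W ** upper Y + upper_right W ** lower Y"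
  by (simp add: matrix_eq upper_mult_vec lower_mult_vec matrix_vector_mul_assoc[symmetric] up_mult_vec matrix_vector_mult_add_rdistrib)

text \<open>
  The columns \<open>(B\<^sup>T, A\<^sup>T)\<close> span the preimage under \<open>W\<close> of the vertical plane, up to the sign of the first
  component. The sign is dropped to make the plane move in the same direction as the solutions do.
\<close>

definition dual_col :: "('n::finite) mat2 \<Rightarrow> 'n col2" where
  "dual_col W = stack (transpose (upper_right W)) (transpose (upper_left W))"

text \<open>
  Embedding of the first block of coordinates; its image under \<open>W\<^sup>T\<close> has the components \<open>A\<^sup>T c\<close> and \<open>B\<^sup>T c\<close>.
\<close>

definition hor :: "real^'n \<Rightarrow> real^('n::finite + 'n)" where
  "hor c = (\<chi> i. case i of Inl p \<Rightarrow> c $ p | Inr p \<Rightarrow> 0)"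

lemma up_dual_col: "up (dual_col W *v c) = lo (transpose W *v hor c)"
  and lo_dual_col: "lo (dual_col W *v c) = up (transpose W *v hor c)"
  unfolding dual_col_def up_stack lo_stack
  by (simp_all add: up_def lo_def hor_def upper_right_def upper_left_def transpose_def matrix_vector_mult_def vec_eq_iff sum_UNIV_sum)

lemma omega_dual_col: "omega (dual_col W *v c) (dual_col V *v d) = omega (transpose V *v hor d) (transpose W *v hor c)"
  by (simp add: omega_def up_dual_col lo_dual_col inner_commute)

text \<open>
  Monotonicity passes to the transpose, with the arguments of \<open>omega\<close> exchanged: evaluate the hypothesis at
  \<open>J\<^sup>T W\<^sup>T y\<close>, which \<open>W\<close> maps to \<open>J\<^sup>T y\<close>.
\<close>

lemma omega_transpose_nonneg:
  assumes "symplectic W" "\<And>x. 0 \<le> omega (W *v x) (W' *v x)"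
  shows "0 \<le> omega (transpose W' *v y) (transpose W *v y)"
proof -
  define x where "x = transpose symp_J *v (transpose W *v y)"
  have "omega (transpose W' *v y) (transpose W *v y) = y \<bullet> (W' *v x)"
    by (simp add: omega_eq_inner x_def inner_matrix_transpose[of y W'])
  also have "\<dots> = (symp_J *v (W *v x)) \<bullet> (W' *v x)"
    by (simp add: x_def symplectic_right_inverse'[OF assms(1)] J_J')
  also have "\<dots> = omega (W *v x) (W' *v x)" by (simp add: omega_eq_inner_left)
  finally show ?thesis using assms(2) by simp
qed

lemma lagrangian_dual_col:
  assumes "symplectic W" shows "lagrangian (dual_col W)"
  unfolding lagrangian_def
proof (intro conjI allI impI)
  fix c d
  show "omega (dual_col W *v c) (dual_col W *v d) = 0"
    using symplectic_transpose[OF assms] unfolding omega_dual_col symplectic_iff_omega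
    by (simp add: omega_def up_def lo_def hor_def inner_vec_def)
next
  fix c :: "real^'a" assume "dual_col W *v c = 0"
  then have "transpose W *v hor c = 0"
    using up_dual_col[of W c] lo_dual_col[of W c] by (intro up_lo_eqI) (auto simp: up_0 lo_0)
  then have "hor c = 0"
    using matrix_inv_left_vec[OF symplectic_invertible[OF symplectic_transpose[OF assms]], of "hor c"] by simp
  then have "up (hor c) = 0" by (simp add: up_0)
  then show "c = 0" by (simp add: up_def hor_def vec_eq_iff)
qed

lemma linear_dual_col: "linear dual_col"
  by (rule linearI)
    (auto simp: dual_col_def stack_def upper_right_def upper_left_def transpose_def vec_eq_iff split: sum.splits)

lemma monotone_curve_dual_col:
  assumes W: "monotone_system W"
  shows "monotone_curve (\<lambda>t. dual_col (W t))"
proof -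
  obtain F where F: "\<And>a b. finite (F \<inter> {a..b})"
    "\<And>t. t \<notin> F \<Longrightarrow> \<exists>W'. (W has_vector_derivative W') (at t) \<and> (\<forall>x. 0 \<le> omega (W t *v x) (W' *v x))"
    using W unfolding monotone_system_def by blast
  have bl: "bounded_linear dual_col" using linear_dual_col by (simp add: linear_conv_bounded_linear)
  have "\<exists>V'. ((\<lambda>t. dual_col (W t)) has_vector_derivative V') (at t) \<and> (\<forall>c. 0 \<le> omega (dual_col (W t) *v c) (V' *v c))"
    if t: "t \<notin> F" for t
  proof -
    obtain W' where W': "(W has_vector_derivative W') (at t)" "\<And>x. 0 \<le> omega (W t *v x) (W' *v x)"
      using F(2)[OF t] by blast
    have "0 \<le> omega (dual_col (W t) *v c) (dual_col W' *v c)" for c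
      unfolding omega_dual_col using W W'(2) by (intro omega_transpose_nonneg) (auto simp: monotone_system_def)
    then show ?thesis using bounded_linear.has_vector_derivative[OF bl W'(1)] by blast
  qed
  moreover have "continuous_on UNIV (\<lambda>t. dual_col (W t))"
    using W by (intro bounded_linear.continuous_on[OF bl]) (simp add: monotone_system_def)
  ultimately show ?thesis
    using F(1) W lagrangian_dual_col unfolding monotone_curve_def monotone_system_def by blast
qed

definition chart_den :: "real \<Rightarrow> ('n::finite) col2 \<Rightarrow> real^'n^'n" where
  "chart_den \<tau> Y = lower Y + \<tau> *\<^sub>R upper Y"

text \<open>
  For slope \<open>0\<close> this is \<open>X U\<^sup>-\<^sup>1\<close>, the matrix whose graph over the second block of coordinates is the plane
  spanned by \<open>Y\<close>; a general slope first applies the shear that replaces \<open>U\<close> by \<open>U + \<tau> X\<close>.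
\<close>

definition chart :: "real \<Rightarrow> ('n::finite) col2 \<Rightarrow> real^'n^'n" where
  "chart \<tau> Y = upper Y ** matrix_inv (chart_den \<tau> Y)"

lemma chart_den_vec: "chart_den \<tau> Y *v c = lo (Y *v c) + \<tau> *\<^sub>R up (Y *v c)"
  by (simp add: chart_den_def matrix_vector_mult_add_rdistrib scaleR_matrix_vector_assoc[symmetric] upper_mult_vec lower_mult_vec)

lemma chart_vec: "chart \<tau> Y *v v = up (Y *v (matrix_inv (chart_den \<tau> Y) *v v))"
  by (simp add: chart_def matrix_vector_mul_assoc[symmetric] upper_mult_vec)

lemma chart_mult_den: "invertible (chart_den \<tau> Y) \<Longrightarrow> chart \<tau> Y ** chart_den \<tau> Y = upper Y"
  by (simp add: chart_def matrix_mul_assoc[symmetric] matrix_inv_left)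

lemma chart_symmetric:
  assumes "lagrangian Y" "invertible (chart_den \<tau> Y)"
  shows "transpose (chart \<tau> Y) = chart \<tau> Y"
proof (rule transpose_eqI)
  fix x y
  define c d where "c = matrix_inv (chart_den \<tau> Y) *v x" and "d = matrix_inv (chart_den \<tau> Y) *v y"
  have x: "x = lo (Y *v c) + \<tau> *\<^sub>R up (Y *v c)" and y: "y = lo (Y *v d) + \<tau> *\<^sub>R up (Y *v d)"
    using matrix_inv_right_vec[OF assms(2), of x] matrix_inv_right_vec[OF assms(2), of y]
    by (simp_all add: chart_den_vec c_def d_def)
  have "omega (Y *v c) (Y *v d) = 0" using assms(1) by (simp add: lagrangian_def)
  then have "x \<bullet> up (Y *v d) = y \<bullet> up (Y *v c)"
    by (simp add: x y omega_def inner_add inner_commute)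
  then show "x \<bullet> (chart \<tau> Y *v y) = y \<bullet> (chart \<tau> Y *v x)" by (simp add: chart_vec c_def d_def)
qed

lemma linear_upper: "linear upper"
  by (auto intro!: linearI simp: upper_def vec_eq_iff)

lemma linear_chart_den: "linear (chart_den \<tau>)"
  by (rule linearI) (auto simp: chart_den_def upper_def lower_def vec_eq_iff algebra_simps)

lemma tendsto_upper: "(Y \<longlongrightarrow> Y0) F \<Longrightarrow> ((\<lambda>s. upper (Y s)) \<longlongrightarrow> upper Y0) F"
  using bounded_linear.tendsto[OF linear_upper[unfolded linear_conv_bounded_linear]] .

lemma tendsto_chart_den: "(Y \<longlongrightarrow> Y0) F \<Longrightarrow> ((\<lambda>s. chart_den \<tau> (Y s)) \<longlongrightarrow> chart_den \<tau> Y0) F"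
  using bounded_linear.tendsto[OF linear_chart_den[unfolded linear_conv_bounded_linear]] .

lemma tendsto_chart:
  assumes "(Y \<longlongrightarrow> Y0) F" "invertible (chart_den \<tau> Y0)"
  shows "((\<lambda>s. chart \<tau> (Y s)) \<longlongrightarrow> chart \<tau> Y0) F"
  unfolding chart_def
  by (intro bounded_bilinear.tendsto[OF bounded_bilinear_matrix_mult] tendsto_matrix_inv
      tendsto_upper tendsto_chart_den assms)

lemma rank_mult_invertible:
  fixes A D :: "real^'n^'n"
  assumes "invertible D"
  shows "rank (A ** D) = rank A" "rank (D ** A) = rank A"
proof -
  have "A = (A ** D) ** matrix_inv D" "A = matrix_inv D ** (D ** A)"
    using assms by (metis matrix_mul_assoc matrix_mul_rid matrix_inv_right, metis matrix_mul_assoc matrix_mul_lid matrix_inv_left)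
  then show "rank (A ** D) = rank A" "rank (D ** A) = rank A"
    by (metis antisym rank_mul_le_left rank_mul_le_right)+
qed

lemma has_vector_derivative_quotient:
  fixes f :: "real \<Rightarrow> 'a::real_normed_vector"
  assumes "(f has_vector_derivative f') (at t)"
  shows "((\<lambda>s. (1 / (s - t)) *\<^sub>R (f s - f t)) \<longlongrightarrow> f') (at t)"
proof -
  have "((\<lambda>s. (1 / norm (s - t)) *\<^sub>R (f s - (f t + (s - t) *\<^sub>R f'))) \<longlongrightarrow> 0) (at t)"
    using assms unfolding has_vector_derivative_def has_derivative_within by simp
  then have "((\<lambda>s. norm ((1 / norm (s - t)) *\<^sub>R (f s - (f t + (s - t) *\<^sub>R f')))) \<longlongrightarrow> 0) (at t)"
    by (rule tendsto_norm_zero)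
  moreover have "\<forall>\<^sub>F s in at t. norm ((1 / norm (s - t)) *\<^sub>R (f s - (f t + (s - t) *\<^sub>R f')))
      = norm ((1 / (s - t)) *\<^sub>R (f s - f t) - f')"
  proof (rule eventually_mono)
    show "\<forall>\<^sub>F s in at t. s \<noteq> t" by (simp add: eventually_at_filter)
    fix s :: real assume s: "s \<noteq> t"
    have "(1 / (s - t)) *\<^sub>R (f s - f t) - f' = (1 / (s - t)) *\<^sub>R (f s - (f t + (s - t) *\<^sub>R f'))"
      using s by (simp add: scaleR_diff_right scaleR_add_right)
    then show "norm ((1 / norm (s - t)) *\<^sub>R (f s - (f t + (s - t) *\<^sub>R f'))) = norm ((1 / (s - t)) *\<^sub>R (f s - f t) - f')"
      by simp
  qed
  ultimately have "((\<lambda>s. norm ((1 / (s - t)) *\<^sub>R (f s - f t) - f')) \<longlongrightarrow> 0) (at t)"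
    by (rule Lim_transform_eventually)
  then have "((\<lambda>s. (1 / (s - t)) *\<^sub>R (f s - f t) - f') \<longlongrightarrow> 0) (at t)"
    by (rule tendsto_norm_zero_cancel)
  then show ?thesis by (rule LIM_zero_cancel)
qed

text \<open>
  With \<open>C s\<close> the coefficients of the point of \<open>Y s\<close> over \<open>v\<close>, the increment of the form from \<open>t\<close> to \<open>s\<close> is exactly
  \<open>omega (Y t c) (Y s C s)\<close>. The Lagrangian property permits subtracting \<open>omega (Y t c) (Y t C s) = 0\<close>, so only
  continuity of the inverse matrix, not its derivative, enters the difference quotient.
\<close>

lemma chart_form_derivative:
  fixes Y :: "real \<Rightarrow> ('n::finite) col2" and v :: "real^'n"
  assumes Y: "(Y has_vector_derivative Y') (at t)" and lag: "lagrangian (Y t)" and inv: "invertible (chart_den \<tau> (Y t))"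
  defines "c \<equiv> matrix_inv (chart_den \<tau> (Y t)) *v v"
  shows "((\<lambda>s. v \<bullet> (chart \<tau> (Y s) *v v)) has_vector_derivative omega (Y t *v c) (Y' *v c)) (at t)"
proof -
  define C where "C = (\<lambda>s. matrix_inv (chart_den \<tau> (Y s)) *v v)"
  have Ylim: "(Y \<longlongrightarrow> Y t) (at t)"
    using has_vector_derivative_continuous[OF Y] by (simp add: continuous_within)
  have Dlim: "((\<lambda>s. chart_den \<tau> (Y s)) \<longlongrightarrow> chart_den \<tau> (Y t)) (at t)"
    by (rule tendsto_chart_den[OF Ylim])
  have Clim: "(C \<longlongrightarrow> c) (at t)" unfolding C_def c_def by (rule tendsto_matrix_inv_vec[OF Dlim inv])
  have quot: "(v \<bullet> (chart \<tau> (Y s) *v v) - v \<bullet> (chart \<tau> (Y t) *v v)) / (s - t)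
      = omega (Y t *v c) (((1 / (s - t)) *\<^sub>R (Y s - Y t)) *v C s)" if "invertible (chart_den \<tau> (Y s))" for s
  proof -
    have vs: "v = lo (Y s *v C s) + \<tau> *\<^sub>R up (Y s *v C s)"
      using matrix_inv_right_vec[OF that, of v] by (simp add: C_def chart_den_vec)
    have vt: "v = lo (Y t *v c) + \<tau> *\<^sub>R up (Y t *v c)"
      using matrix_inv_right_vec[OF inv, of v] by (simp add: c_def chart_den_vec)
    have "v \<bullet> (chart \<tau> (Y s) *v v) - v \<bullet> (chart \<tau> (Y t) *v v) = v \<bullet> up (Y s *v C s) - v \<bullet> up (Y t *v c)"
      by (simp add: chart_vec C_def c_def)
    also have "v \<bullet> up (Y s *v C s) = (lo (Y t *v c) + \<tau> *\<^sub>R up (Y t *v c)) \<bullet> up (Y s *v C s)" using vt by simp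
    also have "v \<bullet> up (Y t *v c) = (lo (Y s *v C s) + \<tau> *\<^sub>R up (Y s *v C s)) \<bullet> up (Y t *v c)" using vs by simp
    also have "(lo (Y t *v c) + \<tau> *\<^sub>R up (Y t *v c)) \<bullet> up (Y s *v C s) - (lo (Y s *v C s) + \<tau> *\<^sub>R up (Y s *v C s)) \<bullet> up (Y t *v c)
       = omega (Y t *v c) (Y s *v C s)"
      by (simp add: omega_def inner_add inner_commute)
    also have "\<dots> = omega (Y t *v c) (Y s *v C s) - omega (Y t *v c) (Y t *v C s)"
      using lag by (simp add: lagrangian_def)
    also have "\<dots> = omega (Y t *v c) ((Y s - Y t) *v C s)"
      by (simp add: matrix_vector_mult_diff_rdistrib omega_diff_right)
    finally show ?thesis
      by (simp add: scaleR_matrix_vector_assoc[symmetric] omega_scale_right)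
  qed
  have "((\<lambda>s. omega (Y t *v c) (((1 / (s - t)) *\<^sub>R (Y s - Y t)) *v C s)) \<longlongrightarrow> omega (Y t *v c) (Y' *v c)) (at t)"
    unfolding omega_eq_inner
    by (intro tendsto_intros bounded_bilinear.tendsto[OF bounded_bilinear_matrix_vector_mult]
        has_vector_derivative_quotient[OF Y] Clim)
  moreover have "\<forall>\<^sub>F s in at t. omega (Y t *v c) (((1 / (s - t)) *\<^sub>R (Y s - Y t)) *v C s)
      = (v \<bullet> (chart \<tau> (Y s) *v v) - v \<bullet> (chart \<tau> (Y t) *v v)) / (s - t)"
    using eventually_invertible[OF Dlim inv] by (rule eventually_mono) (simp add: quot)
  ultimately have "((\<lambda>s. (v \<bullet> (chart \<tau> (Y s) *v v) - v \<bullet> (chart \<tau> (Y t) *v v)) / (s - t)) \<longlongrightarrow> omega (Y t *v c) (Y' *v c)) (at t)"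
    by (rule Lim_transform_eventually)
  then show ?thesis
    by (simp add: has_real_derivative_iff_has_vector_derivative[symmetric] has_field_derivative_iff)
qed

lemma monotone_chart:
  assumes Y: "monotone_curve Y" and inv: "\<And>t. t0 - \<delta> < t \<Longrightarrow> t < t0 + \<delta> \<Longrightarrow> invertible (chart_den \<tau> (Y t))"
    and st: "t0 - \<delta> < s" "s \<le> t" "t < t0 + \<delta>"
  shows "x \<bullet> (chart \<tau> (Y s) *v x) \<le> x \<bullet> (chart \<tau> (Y t) *v x)"
proof -
  obtain F where F: "\<And>a b. finite (F \<inter> {a..b})"
    "\<And>t. t \<notin> F \<Longrightarrow> \<exists>Y'. (Y has_vector_derivative Y') (at t) \<and> (\<forall>c. 0 \<le> omega (Y t *v c) (Y' *v c))"
    using Y unfolding monotone_curve_def by blast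
  have lag: "lagrangian (Y r)" for r using Y by (simp add: monotone_curve_def)
  show ?thesis
  proof (rule nondecreasing_if_deriv_nonneg_off_finite[OF st(2) F(1)[of s t]])
    show "continuous_on {s..t} (\<lambda>r. x \<bullet> (chart \<tau> (Y r) *v x))"
      unfolding continuous_on_def
    proof
      fix r assume r: "r \<in> {s..t}"
      have "(Y \<longlongrightarrow> Y r) (at r within {s..t})"
        using Y unfolding monotone_curve_def continuous_on_def by (meson UNIV_I subset_UNIV tendsto_within_subset)
      then show "((\<lambda>r. x \<bullet> (chart \<tau> (Y r) *v x)) \<longlongrightarrow> x \<bullet> (chart \<tau> (Y r) *v x)) (at r within {s..t})"
        using r st by (intro tendsto_intros bounded_bilinear.tendsto[OF bounded_bilinear_matrix_vector_mult] tendsto_chart inv) auto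
    qed
    fix r assume r: "s < r" "r < t" "r \<notin> F \<inter> {s..t}"
    then have "r \<notin> F" by simp
    then obtain Y' where Y': "(Y has_vector_derivative Y') (at r)" "\<And>c. 0 \<le> omega (Y r *v c) (Y' *v c)"
      using F(2) by blast
    have "invertible (chart_den \<tau> (Y r))" using r st by (intro inv) auto
    from chart_form_derivative[OF Y'(1) lag this] Y'(2)
    show "\<exists>d\<ge>0. ((\<lambda>r. x \<bullet> (chart \<tau> (Y r) *v x)) has_vector_derivative d) (at r)" by blast
  qed
qed

lemma chart_neighbourhood:
  assumes Y: "monotone_curve Y" and inv: "invertible (chart_den \<tau> (Y t0))"
  obtains \<delta> where "\<delta> > 0" "\<And>t. t0 - \<delta> < t \<Longrightarrow> t < t0 + \<delta> \<Longrightarrow> invertible (chart_den \<tau> (Y t))"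
proof -
  have "(Y \<longlongrightarrow> Y t0) (at t0)"
    using Y by (simp add: monotone_curve_def continuous_on_def)
  then have "((\<lambda>s. chart_den \<tau> (Y s)) \<longlongrightarrow> chart_den \<tau> (Y t0)) (at t0)"
    by (rule tendsto_chart_den)
  from eventually_invertible[OF this inv]
  obtain d where d: "d > 0" "\<And>t. t \<noteq> t0 \<Longrightarrow> dist t t0 < d \<Longrightarrow> invertible (chart_den \<tau> (Y t))"
    unfolding eventually_at by auto
  show ?thesis
  proof (rule that[OF d(1)])
    fix t assume "t0 - d < t" "t < t0 + d"
    then show "invertible (chart_den \<tau> (Y t))"
      using d(2)[of t] inv by (cases "t = t0") (auto simp: dist_real_def abs_less_iff)
  qed
qed

section \<open>Jumps of the multiplicity of focal points\<close>

text \<open>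
  With \<open>D0 = U + \<tau> X\<close> and \<open>Ds = A\<^sup>T - \<tau> B\<^sup>T\<close> one has \<open>X = Q0 D0\<close> and \<open>B = Ds\<^sup>T QB\<close>, therefore
  \<open>A X + B U = (A - \<tau> B) X + B (U + \<tau> X) = Ds\<^sup>T (Q0 + QB) D0\<close>.
  The opposite slopes of the two charts are what makes both \<open>\<tau>\<close> terms cancel.
\<close>

lemma focal_mult_charts:
  fixes W :: "nat \<Rightarrow> ('n::finite) mat2" and Y :: "nat \<Rightarrow> 'n col2"
  assumes W: "symplectic (W k)" and Y: "lagrangian (Y k)" and Y1: "Y (k + 1) = W k ** Y k"
    and inv0: "invertible (chart_den \<tau> (Y k))" and invs: "invertible (chart_den (- \<tau>) (dual_col (W k)))"
  defines "Q0 \<equiv> chart \<tau> (Y k)" and "QB \<equiv> chart (- \<tau>) (dual_col (W k))"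
  shows "focal_mult W Y k + ind (Q0 + QB) = ind Q0 + ind QB"
    and "rank (upper (Y k)) = rank Q0" and "rank (upper_right (W k)) = rank QB"
    and "rank (upper (Y (k + 1))) = rank (Q0 + QB)"
proof -
  define D0 where "D0 = chart_den \<tau> (Y k)"
  define Ds where "Ds = chart_den (- \<tau>) (dual_col (W k))"
  have sym0: "transpose Q0 = Q0" and symB: "transpose QB = QB"
    unfolding Q0_def QB_def by (rule chart_symmetric[OF Y inv0], rule chart_symmetric[OF lagrangian_dual_col[OF W] invs])
  have X: "upper (Y k) = Q0 ** D0"
    using chart_mult_den[OF inv0] by (simp add: Q0_def D0_def)
  have "QB ** Ds = transpose (upper_right (W k))"
    using chart_mult_den[OF invs] by (simp add: QB_def Ds_def dual_col_def upper_stack)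
  then have "transpose (QB ** Ds) = upper_right (W k)" by simp
  then have B: "upper_right (W k) = transpose Ds ** QB"
    by (simp only: matrix_transpose_mul symB)
  have Dst: "transpose Ds = upper_left (W k) - \<tau> *\<^sub>R upper_right (W k)"
    by (simp add: Ds_def chart_den_def dual_col_def upper_stack lower_stack transpose_def vec_eq_iff)
  have lowerY: "lower (Y k) = D0 - \<tau> *\<^sub>R upper (Y k)" by (simp add: D0_def chart_den_def)
  have X1: "upper (Y (k + 1)) = transpose Ds ** (Q0 + QB) ** D0"
  proof -
    have "upper (Y (k + 1)) *v c = transpose Ds ** (Q0 + QB) ** D0 *v c" for c
    proof -
      have "transpose Ds ** (Q0 + QB) ** D0 *v c = transpose Ds *v (Q0 ** D0 *v c) + (transpose Ds ** QB) *v (D0 *v c)"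
        by (simp add: matrix_vector_mul_assoc[symmetric] matrix_vector_mult_add_rdistrib matrix_vector_right_distrib)
      also have "\<dots> = transpose Ds *v (upper (Y k) *v c) + upper_right (W k) *v (D0 *v c)"
        by (simp only: X[symmetric] B[symmetric])
      also have "\<dots> = upper_left (W k) *v (upper (Y k) *v c) + upper_right (W k) *v (lower (Y k) *v c)"
        unfolding Dst lowerY
        by (simp add: matrix_vector_mult_diff_rdistrib matrix_vector_mult_diff_distrib
            scaleR_matrix_vector_assoc[symmetric] linear_scale[OF matrix_vector_mul_linear])
      also have "\<dots> = upper (Y (k + 1)) *v c"
        unfolding Y1 upper_mult by (simp add: matrix_vector_mult_add_rdistrib matrix_vector_mul_assoc)
      finally show ?thesis by simp
    qed
    then show ?thesis by (simp add: matrix_eq)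
  qed
  have i0: "invertible D0" and iDs: "invertible Ds" using inv0 invs by (auto simp: D0_def Ds_def)
  then have ist: "invertible (transpose Ds)" by (simp add: invertible_det_nz)
  show "focal_mult W Y k + ind (Q0 + QB) = ind Q0 + ind QB"
    unfolding focal_mult_def Let_def
    by (rule rank_plus_ind_parallel_sum[OF sym0 symB i0 iDs X B X1 refl refl refl])
  show "rank (upper (Y k)) = rank Q0" unfolding X by (rule rank_mult_invertible(1)[OF i0])
  show "rank (upper_right (W k)) = rank QB" unfolding B by (rule rank_mult_invertible(2)[OF ist])
  show "rank (upper (Y (k + 1))) = rank (Q0 + QB)"
    unfolding X1 using rank_mult_invertible(1)[OF i0] rank_mult_invertible(2)[OF ist] by simp
qed

lemma common_chart:
  assumes "lagrangian Y" "symplectic W"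
  obtains \<tau> where "invertible (chart_den \<tau> Y)" "invertible (chart_den (- \<tau>) (dual_col W))"
proof -
  define T1 where "T1 = {\<tau>. \<not> invertible (chart_den \<tau> Y)}"
  define T2 where "T2 = {\<tau>. \<not> invertible (chart_den \<tau> (dual_col W))}"
  have "finite T1" "finite T2"
    using finite_bad_slopes[OF assms(1)] finite_bad_slopes[OF lagrangian_dual_col[OF assms(2)]]
    by (simp_all add: T1_def T2_def chart_den_def)
  then have "finite (T1 \<union> uminus ` T2)" by simp
  then obtain \<tau> where t: "\<tau> \<notin> T1 \<union> uminus ` T2" using ex_new_if_finite[OF infinite_UNIV_char_0] by blast
  then have "- \<tau> \<notin> T2" by (metis UnCI imageI minus_minus)
  then have "invertible (chart_den (- \<tau>) (dual_col W))" by (simp add: T2_def)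
  moreover have "invertible (chart_den \<tau> Y)" using t by (simp add: T1_def)
  ultimately show ?thesis using that by blast
qed

lemma focal_mult_le:
  fixes W :: "nat \<Rightarrow> ('n::finite) mat2" and Y :: "nat \<Rightarrow> 'n col2"
  assumes "symplectic (W k)" "lagrangian (Y k)" "Y (k + 1) = W k ** Y k"
  shows "focal_mult W Y k \<le> 2 * CARD('n)"
proof -
  obtain \<tau> where t: "invertible (chart_den \<tau> (Y k))" "invertible (chart_den (- \<tau>) (dual_col (W k)))"
    using common_chart[OF assms(2,1)] by metis
  have "ind (chart \<tau> (Y k)) \<le> CARD('n)" "ind (chart (- \<tau>) (dual_col (W k))) \<le> CARD('n)"
    using morse_index_le_DIM[where ?'a = "real^'n"]
    by (simp_all add: ind_eq_morse_index chart_symmetric[OF assms(2) t(1)] chart_symmetric[OF lagrangian_dual_col[OF assms(1)] t(2)])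
  then show ?thesis using focal_mult_charts(1)[where W=W and Y=Y and k=k, OF assms t] by simp
qed

text \<open>
  One-sided limits of the rank exist everywhere, and the rank can only fall on arrival from the left.
\<close>

definition rank_regular :: "(real \<Rightarrow> real^'n^'m) \<Rightarrow> bool" where
  "rank_regular A \<longleftrightarrow> (\<forall>t. \<exists>l r. rank (A t) \<le> l \<and>
     (\<forall>\<^sub>F s in at_left t. rank (A s) = l) \<and> (\<forall>\<^sub>F s in at_right t. rank (A s) = r))"

lemma left_rank_eq:
  assumes "\<forall>\<^sub>F s in at_left t. rank (A s) = l"
  shows "left_rank A t = l"
  unfolding left_rank_def
  by (rule tendsto_Lim[OF trivial_limit_at_left_real tendsto_eventually[OF assms]])

lemma rank_drop_nonneg: "rank_regular A \<Longrightarrow> 0 \<le> rank_drop A t"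
  unfolding rank_regular_def rank_drop_def using left_rank_eq[where A = A and t = t] by fastforce

lemma rank_drop_left:
  assumes "rank_regular A"
  shows "\<forall>\<^sub>F s in at_left t. rank_drop A t = int (rank (A s)) - int (rank (A t))"
proof -
  obtain l where l: "\<forall>\<^sub>F s in at_left t. rank (A s) = l" using assms unfolding rank_regular_def by blast
  show ?thesis using l by (rule eventually_mono) (simp add: rank_drop_def left_rank_eq[OF l])
qed

lemma rank_drop_eventually_0:
  assumes "rank_regular A"
  shows "\<forall>\<^sub>F s in at t. rank_drop A s = 0"
proof -
  obtain l r where l: "\<forall>\<^sub>F s in at_left t. rank (A s) = l" and r: "\<forall>\<^sub>F s in at_right t. rank (A s) = r"
    using assms unfolding rank_regular_def by blast
  have drop0: "rank_drop A s = 0" if "a < s" "s < b" "\<And>u. a < u \<Longrightarrow> u < b \<Longrightarrow> rank (A u) = c" for a b c s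
  proof -
    have "\<forall>\<^sub>F u in at_left s. rank (A u) = c"
      unfolding eventually_at_left[OF that(1)] using that by (intro exI[of _ a]) auto
    from left_rank_eq[OF this] show ?thesis using that by (simp add: rank_drop_def)
  qed
  obtain a where a: "a < t" "\<And>u. a < u \<Longrightarrow> u < t \<Longrightarrow> rank (A u) = l"
    using l eventually_at_left[of "t - 1" t] by auto
  obtain b where b: "t < b" "\<And>u. t < u \<Longrightarrow> u < b \<Longrightarrow> rank (A u) = r"
    using r eventually_at_right[of t "t + 1"] by auto
  have "\<forall>\<^sub>F s in at_left t. rank_drop A s = 0"
    unfolding eventually_at_left[OF a(1)] using a drop0[of a _ t l] by (intro exI[of _ a]) auto
  moreover have "\<forall>\<^sub>F s in at_right t. rank_drop A s = 0"
    unfolding eventually_at_right[OF b(1)] using b drop0[of t _ b r] by (intro exI[of _ b]) auto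
  ultimately show ?thesis by (simp add: eventually_at_split)
qed

text \<open>
  The slope is chosen for \<open>t0\<close>; it stays admissible nearby, where \<open>monotone_matrix_index_jump\<close> applies to all
  three terms of \<open>focal_mult_charts\<close>.
\<close>

lemma focal_mult_local:
  fixes W :: "nat \<Rightarrow> real \<Rightarrow> ('n::finite) mat2" and Y :: "nat \<Rightarrow> real \<Rightarrow> 'n col2"
  assumes W: "monotone_system (W k)" and Y: "monotone_curve (Y k)"
    and Y1: "\<And>t. Y (k + 1) t = W k t ** Y k t"
  defines "f \<equiv> \<lambda>t. focal_mult (\<lambda>k. W k t) (\<lambda>k. Y k t) k"
  obtains lX lB lZ rX rB rZ where
    "rank (upper (Y k t0)) \<le> lX" "rank (upper_right (W k t0)) \<le> lB" "rank (upper (Y (k + 1) t0)) \<le> lZ"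
    "\<forall>\<^sub>F t in at_left t0. rank (upper (Y k t)) = lX \<and> rank (upper_right (W k t)) = lB \<and> rank (upper (Y (k + 1) t)) = lZ
      \<and> f t + rank (upper (Y k t0)) + rank (upper_right (W k t0)) + lZ = f t0 + lX + lB + rank (upper (Y (k + 1) t0))"
    "\<forall>\<^sub>F t in at_right t0. rank (upper (Y k t)) = rX \<and> rank (upper_right (W k t)) = rB \<and> rank (upper (Y (k + 1) t)) = rZ
      \<and> f t = f t0"
proof -
  define V where "V = (\<lambda>t. dual_col (W k t))"
  have V: "monotone_curve V" unfolding V_def by (rule monotone_curve_dual_col[OF W])
  have symp: "symplectic (W k t)" and lagY: "lagrangian (Y k t)" and lagV: "lagrangian (V t)" for t
    using W Y V by (auto simp: monotone_system_def monotone_curve_def)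
  obtain \<tau> where tau: "invertible (chart_den \<tau> (Y k t0))" "invertible (chart_den (- \<tau>) (V t0))"
    using common_chart[OF lagY symp] unfolding V_def by metis
  obtain d1 where d1: "d1 > 0" "\<And>t. t0 - d1 < t \<Longrightarrow> t < t0 + d1 \<Longrightarrow> invertible (chart_den \<tau> (Y k t))"
    using chart_neighbourhood[OF Y tau(1)] by metis
  obtain d2 where d2: "d2 > 0" "\<And>t. t0 - d2 < t \<Longrightarrow> t < t0 + d2 \<Longrightarrow> invertible (chart_den (- \<tau>) (V t))"
    using chart_neighbourhood[OF V tau(2)] by metis
  define d where "d = min d1 d2"
  have d: "d > 0" using d1 d2 by (simp add: d_def)
  have inv1: "invertible (chart_den \<tau> (Y k t))" and inv2: "invertible (chart_den (- \<tau>) (V t))"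
    if "t0 - d < t" "t < t0 + d" for t using d1(2) d2(2) that by (auto simp: d_def)
  define Q0 where "Q0 = (\<lambda>t. chart \<tau> (Y k t))"
  define QB where "QB = (\<lambda>t. chart (- \<tau>) (V t))"
  have sym0: "transpose (Q0 t) = Q0 t" and symB: "transpose (QB t) = QB t" if "\<bar>t - t0\<bar> < d" for t
    using that inv1[of t] inv2[of t] chart_symmetric[OF lagY] chart_symmetric[OF lagV]
    by (auto simp: Q0_def QB_def abs_less_iff)
  have mono0: "x \<bullet> (Q0 s *v x) \<le> x \<bullet> (Q0 t *v x)" and monoB: "x \<bullet> (QB s *v x) \<le> x \<bullet> (QB t *v x)"
    if "t0 - d < s" "s \<le> t" "t < t0 + d" for s t x
    unfolding Q0_def QB_def
    by (rule monotone_chart[OF Y inv1 that], assumption+, rule monotone_chart[OF V inv2 that], assumption+)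
  have Ylim: "(Y k \<longlongrightarrow> Y k t0) (at t0)" "(V \<longlongrightarrow> V t0) (at t0)"
    using Y V by (auto simp: monotone_curve_def continuous_on_def)
  have cont0: "isCont Q0 t0" and contB: "isCont QB t0"
    unfolding isCont_def Q0_def QB_def by (rule tendsto_chart[OF Ylim(1) tau(1)], rule tendsto_chart[OF Ylim(2) tau(2)])
  have ff: "f t + ind (Q0 t + QB t) = ind (Q0 t) + ind (QB t)"
    and rX: "rank (upper (Y k t)) = rank (Q0 t)" and rB: "rank (upper_right (W k t)) = rank (QB t)"
    and rZ: "rank (upper (Y (k + 1) t)) = rank (Q0 t + QB t)" if "t0 - d < t" "t < t0 + d" for t
    using focal_mult_charts[where W = "\<lambda>k. W k t" and Y = "\<lambda>k. Y k t" and k = k and \<tau> = \<tau>,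
        OF symp lagY Y1 inv1[OF that] inv2[OF that, unfolded V_def]]
    by (simp_all add: f_def Q0_def QB_def V_def)
  obtain l0 r0 where J0: "\<forall>\<^sub>F t in at_left t0. rank (Q0 t) = l0 \<and> ind (Q0 t) + rank (Q0 t0) = ind (Q0 t0) + l0"
    "rank (Q0 t0) \<le> l0" "\<forall>\<^sub>F t in at_right t0. rank (Q0 t) = r0 \<and> ind (Q0 t) = ind (Q0 t0)"
    by (rule monotone_matrix_index_jump[of d t0 Q0, OF d sym0 mono0 cont0])
  obtain lB rB' where JB: "\<forall>\<^sub>F t in at_left t0. rank (QB t) = lB \<and> ind (QB t) + rank (QB t0) = ind (QB t0) + lB"
    "rank (QB t0) \<le> lB" "\<forall>\<^sub>F t in at_right t0. rank (QB t) = rB' \<and> ind (QB t) = ind (QB t0)"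
    by (rule monotone_matrix_index_jump[of d t0 QB, OF d symB monoB contB])
  have symZ: "transpose (Q0 t + QB t) = Q0 t + QB t" if "\<bar>t - t0\<bar> < d" for t
    using sym0[OF that] symB[OF that] by (simp add: transpose_def vec_eq_iff)
  have monoZ: "x \<bullet> ((Q0 s + QB s) *v x) \<le> x \<bullet> ((Q0 t + QB t) *v x)" if "t0 - d < s" "s \<le> t" "t < t0 + d" for s t x
    using mono0[OF that, of x] monoB[OF that, of x] by (simp add: matrix_vector_mult_add_rdistrib inner_add)
  obtain lZ rZ' where JZ: "\<forall>\<^sub>F t in at_left t0. rank (Q0 t + QB t) = lZ \<and> ind (Q0 t + QB t) + rank (Q0 t0 + QB t0) = ind (Q0 t0 + QB t0) + lZ"
    "rank (Q0 t0 + QB t0) \<le> lZ" "\<forall>\<^sub>F t in at_right t0. rank (Q0 t + QB t) = rZ' \<and> ind (Q0 t + QB t) = ind (Q0 t0 + QB t0)"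
    by (rule monotone_matrix_index_jump[of d t0 "\<lambda>t. Q0 t + QB t", OF d symZ monoZ isCont_add[OF cont0 contB]])
  have near: "\<forall>\<^sub>F t in at t0. t0 - d < t \<and> t < t0 + d"
    using d by (auto simp: eventually_at dist_real_def abs_less_iff intro!: exI[of _ d])
  have nearl: "\<forall>\<^sub>F t in at_left t0. t0 - d < t \<and> t < t0 + d" and nearr: "\<forall>\<^sub>F t in at_right t0. t0 - d < t \<and> t < t0 + d"
    using near by (auto simp: eventually_at_split)
  have t0: "t0 - d < t0" "t0 < t0 + d" using d by auto
  show ?thesis
  proof (rule that)
    show "rank (upper (Y k t0)) \<le> l0" "rank (upper_right (W k t0)) \<le> lB" "rank (upper (Y (k + 1) t0)) \<le> lZ"
      using rX[OF t0] rB[OF t0] rZ[OF t0] J0(2) JB(2) JZ(2) by simp_all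
    show "\<forall>\<^sub>F t in at_left t0. rank (upper (Y k t)) = l0 \<and> rank (upper_right (W k t)) = lB \<and> rank (upper (Y (k + 1) t)) = lZ
      \<and> f t + rank (upper (Y k t0)) + rank (upper_right (W k t0)) + lZ = f t0 + l0 + lB + rank (upper (Y (k + 1) t0))"
      using J0(1) JB(1) JZ(1) nearl
    proof eventually_elim
      case (elim t)
      then show ?case
        using rX[of t] rB[of t] rZ[of t] ff[of t] rX[OF t0] rB[OF t0] rZ[OF t0] ff[OF t0] by simp
    qed
    show "\<forall>\<^sub>F t in at_right t0. rank (upper (Y k t)) = r0 \<and> rank (upper_right (W k t)) = rB' \<and> rank (upper (Y (k + 1) t)) = rZ'
      \<and> f t = f t0"
      using J0(3) JB(3) JZ(3) nearr
    proof eventually_elim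
      case (elim t)
      then show ?case
        using rX[of t] rB[of t] rZ[of t] ff[of t] ff[OF t0] by simp
    qed
  qed
qed

lemma rank_regular_step:
  fixes W :: "nat \<Rightarrow> real \<Rightarrow> ('n::finite) mat2" and Y :: "nat \<Rightarrow> real \<Rightarrow> 'n col2"
  assumes "monotone_system (W k)" "monotone_curve (Y k)" "\<And>t. Y (k + 1) t = W k t ** Y k t"
  shows "rank_regular (\<lambda>t. upper (Y k t))" "rank_regular (\<lambda>t. upper_right (W k t))" "rank_regular (\<lambda>t. upper (Y (k + 1) t))"
proof -
  have "\<exists>lX lB lZ rX rB rZ. rank (upper (Y k t)) \<le> lX \<and> rank (upper_right (W k t)) \<le> lB \<and> rank (upper (Y (k + 1) t)) \<le> lZ \<and>
     (\<forall>\<^sub>F s in at_left t. rank (upper (Y k s)) = lX) \<and> (\<forall>\<^sub>F s in at_left t. rank (upper_right (W k s)) = lB) \<and>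
     (\<forall>\<^sub>F s in at_left t. rank (upper (Y (k + 1) s)) = lZ) \<and>
     (\<forall>\<^sub>F s in at_right t. rank (upper (Y k s)) = rX) \<and> (\<forall>\<^sub>F s in at_right t. rank (upper_right (W k s)) = rB) \<and>
     (\<forall>\<^sub>F s in at_right t. rank (upper (Y (k + 1) s)) = rZ)" for t
    by (rule focal_mult_local[of W k Y t, OF assms], intro exI conjI, assumption+) (auto elim: eventually_mono)
  then show "rank_regular (\<lambda>t. upper (Y k t))" "rank_regular (\<lambda>t. upper_right (W k t))" "rank_regular (\<lambda>t. upper (Y (k + 1) t))"
    unfolding rank_regular_def by blast+
qed

lemma focal_mult_jump:
  fixes W :: "nat \<Rightarrow> real \<Rightarrow> ('n::finite) mat2" and Y :: "nat \<Rightarrow> real \<Rightarrow> 'n col2"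
  assumes "monotone_system (W k)" "monotone_curve (Y k)" "\<And>t. Y (k + 1) t = W k t ** Y k t"
  defines "f \<equiv> \<lambda>t. int (focal_mult (\<lambda>k. W k t) (\<lambda>k. Y k t) k)"
  shows "\<forall>\<^sub>F s in at_left t. f t = f s + rank_drop (\<lambda>t. upper (Y (k + 1) t)) t
      - rank_drop (\<lambda>t. upper (Y k t)) t - rank_drop (\<lambda>t. upper_right (W k t)) t"
    and "\<forall>\<^sub>F s in at_right t. f s = f t"
proof -
  obtain lX lB lZ rX rB rZ where
    "rank (upper (Y k t)) \<le> lX" "rank (upper_right (W k t)) \<le> lB" "rank (upper (Y (k + 1) t)) \<le> lZ"
    and l: "\<forall>\<^sub>F s in at_left t. rank (upper (Y k s)) = lX \<and> rank (upper_right (W k s)) = lB \<and> rank (upper (Y (k + 1) s)) = lZ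
      \<and> focal_mult (\<lambda>k. W k s) (\<lambda>k. Y k s) k + rank (upper (Y k t)) + rank (upper_right (W k t)) + lZ
        = focal_mult (\<lambda>k. W k t) (\<lambda>k. Y k t) k + lX + lB + rank (upper (Y (k + 1) t))"
    and r: "\<forall>\<^sub>F s in at_right t. rank (upper (Y k s)) = rX \<and> rank (upper_right (W k s)) = rB \<and> rank (upper (Y (k + 1) s)) = rZ
      \<and> focal_mult (\<lambda>k. W k s) (\<lambda>k. Y k s) k = focal_mult (\<lambda>k. W k t) (\<lambda>k. Y k t) k"
    by (rule focal_mult_local[of W k Y t, OF assms(1-3)])
  show "\<forall>\<^sub>F s in at_right t. f s = f t" using r by (rule eventually_mono) (simp add: f_def)
  show "\<forall>\<^sub>F s in at_left t. f t = f s + rank_drop (\<lambda>t. upper (Y (k + 1) t)) t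
      - rank_drop (\<lambda>t. upper (Y k t)) t - rank_drop (\<lambda>t. upper_right (W k t)) t"
    using l rank_drop_left[OF rank_regular_step(1)[where W = W and Y = Y and k = k, OF assms(1-3)], of t]
      rank_drop_left[OF rank_regular_step(2)[where W = W and Y = Y and k = k, OF assms(1-3)], of t]
      rank_drop_left[OF rank_regular_step(3)[where W = W and Y = Y and k = k, OF assms(1-3)], of t]
    by eventually_elim (simp add: f_def)
qed

text \<open>
  The claim is additive in the interval and, by the one-sided hypotheses, true on short intervals around
  every point, so compactness of \<open>{a..b}\<close> gives it in general. \<open>T\<close> may contain points where \<open>g\<close> vanishes; this
  lets it collect the supports of two functions whose difference is \<open>g\<close>.
\<close>

lemma sum_of_jumps:
  fixes L g :: "real \<Rightarrow> int"
  assumes left: "\<And>t. \<forall>\<^sub>F s in at_left t. L t = L s + g t"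
    and right: "\<And>t. \<forall>\<^sub>F s in at_right t. L s = L t"
    and zero: "\<And>t. \<forall>\<^sub>F s in at t. s \<notin> T" and g: "\<And>t. t \<notin> T \<Longrightarrow> g t = 0"
    and ab: "a \<le> b"
  shows "finite (T \<inter> {a<..b}) \<and> L b - L a = sum g (T \<inter> {a<..b})"
  using ab
proof (induction rule: Bolzano)
  case (trans a b c)
  have e: "T \<inter> {a<..c} = T \<inter> {a<..b} \<union> T \<inter> {b<..c}" using trans by auto
  show ?case using trans unfolding e by (subst sum.union_disjoint) auto
next
  case (local x)
  obtain d1 where d1: "d1 < x" "\<And>s. d1 < s \<Longrightarrow> s < x \<Longrightarrow> L x = L s + g x"
    using left[of x] eventually_at_left[of "x - 1" x] by auto
  obtain d2 where d2: "x < d2" "\<And>s. x < s \<Longrightarrow> s < d2 \<Longrightarrow> L s = L x"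
    using right[of x] eventually_at_right[of x "x + 1"] by auto
  obtain d3 where d3: "d3 > 0" "\<And>s. s \<noteq> x \<Longrightarrow> dist s x < d3 \<Longrightarrow> s \<notin> T"
    using zero[of x] unfolding eventually_at by auto
  define d where "d = min d3 (min (x - d1) (d2 - x))"
  have d: "d > 0" using d1 d2 d3 by (simp add: d_def)
  have "finite (T \<inter> {a<..b}) \<and> L b - L a = sum g (T \<inter> {a<..b})"
    if ab: "a \<le> x" "x \<le> b" "b - a < d" for a b
  proof -
    have T: "s = x" if "s \<in> T \<inter> {a<..b}" for s
    proof -
      have "\<bar>s - x\<bar> < d3" using that ab by (auto simp: d_def abs_less_iff)
      then show ?thesis using that d3(2)[of s] by (auto simp: dist_real_def)
    qed
    have Lb: "L b = L x" using d2(2)[of b] ab by (cases "b = x") (auto simp: d_def)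
    show ?thesis
    proof (cases "a = x")
      case True
      then have "T \<inter> {a<..b} = {}" using T by force
      then show ?thesis using Lb True by simp
    next
      case False
      then have La: "L x = L a + g x" using d1(2)[of a] ab by (auto simp: d_def)
      have sub: "T \<inter> {a<..b} \<subseteq> {x}" using T by blast
      have "sum g (T \<inter> {a<..b}) = sum g {x}"
        by (rule sum.mono_neutral_left) (use sub g ab False in auto)
      then show ?thesis using Lb La finite_subset[OF sub] by simp
    qed
  qed
  then show ?case using d by blast
qed

section \<open>Counting finite eigenvalues\<close>

lemma transformed_sol_step:
  assumes "symplectic (R k)"
  shows "transformed_sol S R (k + 1) t = transformed S R k t ** transformed_sol S R k t"
proof -
  have "R k ** (matrix_inv (R k) ** principal_sol S k t) = principal_sol S k t"
    using matrix_inv_right[OF symplectic_invertible[OF assms]] by (simp add: matrix_mul_assoc)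
  then show ?thesis
    by (simp add: transformed_sol_def transformed_def matrix_mul_assoc[symmetric])
qed

lemma monotone_system_transformed:
  assumes "Cp1 (S k)" "\<And>t. symplectic (S k t)" "Psi_nonneg (S k)" "symplectic (R k)" "symplectic (R (k + 1))"
  shows "monotone_system (transformed S R k)"
proof -
  have "monotone_system (\<lambda>t. matrix_inv (R (k + 1)) ** S k t ** R k)"
    by (rule monotone_system_transform[OF monotone_system_Cp1[OF assms(1-3)] symplectic_matrix_inv[OF assms(5)] assms(4)])
  moreover have "transformed S R k = (\<lambda>t. matrix_inv (R (k + 1)) ** S k t ** R k)"
    by (simp add: transformed_def fun_eq_iff)
  ultimately show ?thesis by simp
qed

lemma sum_telescope_int:
  fixes x :: "nat \<Rightarrow> int"
  shows "(\<Sum>k = 0..N. x (k + 1) - x k) = x (N + 1) - x 0"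
  by (induction N) auto

lemma matrix_inv_mat_1: "matrix_inv (mat 1 :: real^'n^'n) = mat 1"
proof -
  have "invertible (mat 1 :: real^'n^'n)" by (simp add: invertible_def)
  from matrix_inv_left[OF this] show ?thesis by simp
qed

lemma rank_drop_const: "rank_drop (\<lambda>t. A) t = 0"
  by (simp add: rank_drop_def left_rank_eq[where l = "rank A"])

lemma transformed_problem:
  fixes S :: "nat \<Rightarrow> real \<Rightarrow> ('n::finite) mat2"
    and R :: "nat \<Rightarrow> 'n mat2"
    and N :: nat
  assumes S_Cp1: "\<And>k. k \<le> N \<Longrightarrow> Cp1 (S k)"
    and S_symplectic: "\<And>k t. k \<le> N \<Longrightarrow> symplectic (S k t)"
    and S_monotone: "\<And>k. k \<le> N \<Longrightarrow> Psi_nonneg (S k)"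
    and R_symplectic: "\<And>k. k \<le> N + 1 \<Longrightarrow> symplectic (R k)"
  shows "k \<le> N \<Longrightarrow> monotone_system (transformed S R k)"
    and "k \<le> N \<Longrightarrow> transformed_sol S R (k + 1) t = transformed S R k t ** transformed_sol S R k t"
    and "k \<le> N + 1 \<Longrightarrow> monotone_curve (transformed_sol S R k)"
proof -
  have W: "monotone_system (transformed S R k)" if "k \<le> N" for k
    using that by (intro monotone_system_transformed assms) auto
  have Y1: "transformed_sol S R (k + 1) t = transformed S R k t ** transformed_sol S R k t" if "k \<le> N" for k t
    using that by (intro transformed_sol_step assms) auto
  have Y: "monotone_curve (transformed_sol S R k)" if "k \<le> N + 1" for k
    using that
  proof (induction k)
    case 0
    have "transformed_sol S R 0 = (\<lambda>t. matrix_inv (R 0) ** stack 0 (mat 1))"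
      by (simp add: transformed_sol_def fun_eq_iff)
    then show ?case
      using monotone_curve_const[OF lagrangian_symplectic_mult[OF symplectic_matrix_inv[OF R_symplectic[of 0]] lagrangian_vertical]]
      by simp
  next
    case (Suc k)
    have "transformed_sol S R (Suc k) = (\<lambda>t. transformed S R k t ** transformed_sol S R k t)"
      using Y1[of k] Suc.prems by (simp add: fun_eq_iff)
    then show ?case using monotone_curve_mult[OF W[of k] Suc.IH] Suc.prems by simp
  qed
  show "k \<le> N \<Longrightarrow> monotone_system (transformed S R k)" by (rule W)
  show "k \<le> N \<Longrightarrow> transformed_sol S R (k + 1) t = transformed S R k t ** transformed_sol S R k t" by (rule Y1)
  show "k \<le> N + 1 \<Longrightarrow> monotone_curve (transformed_sol S R k)" by (rule Y)
qed

lemma finite_eigenvalue_count: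
  fixes S :: "nat \<Rightarrow> real \<Rightarrow> ('n::finite) mat2"
    and R :: "nat \<Rightarrow> 'n mat2"
    and N :: nat
  assumes S_Cp1: "\<And>k. k \<le> N \<Longrightarrow> Cp1 (S k)"
    and S_symplectic: "\<And>k t. k \<le> N \<Longrightarrow> symplectic (S k t)"
    and S_monotone: "\<And>k. k \<le> N \<Longrightarrow> Psi_nonneg (S k)"
    and R_symplectic: "\<And>k. k \<le> N + 1 \<Longrightarrow> symplectic (R k)"
    and R_last: "R (N + 1) = mat 1"
  shows "0 \<le> theta S N t" and "0 \<le> n_R S R N t"
    and "0 \<le> l_d_transformed S R N t" and "l_d_transformed S R N t \<le> int (2 * CARD('n) * (N + 1))"
    and "a \<le> b \<Longrightarrow> finite {\<nu>. a < \<nu> \<and> \<nu> \<le> b \<and> n_R S R N \<nu> \<noteq> 0}"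
    and "a \<le> b \<Longrightarrow> finite {\<nu> \<in> finite_eigenvalues S N. a < \<nu> \<and> \<nu> \<le> b}"
    and "a \<le> b \<Longrightarrow> l_d_transformed S R N b - l_d_transformed S R N a
        + (\<Sum>\<nu> | a < \<nu> \<and> \<nu> \<le> b \<and> n_R S R N \<nu> \<noteq> 0. n_R S R N \<nu>)
      = (\<Sum>\<nu> \<in> {\<nu> \<in> finite_eigenvalues S N. a < \<nu> \<and> \<nu> \<le> b}. theta S N \<nu>)"
proof -
  define W where "W = transformed S R"
  define Y where "Y = transformed_sol S R"
  have W: "monotone_system (W k)" if "k \<le> N" for k
    unfolding W_def by (rule transformed_problem(1)[OF assms(1-4) that])
  have Y1: "Y (k + 1) t = W k t ** Y k t" if "k \<le> N" for k t
    unfolding W_def Y_def by (rule transformed_problem(2)[OF assms(1-4) that])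
  have Y: "monotone_curve (Y k)" if "k \<le> N + 1" for k
    unfolding Y_def by (rule transformed_problem(3)[OF assms(1-4) that])
  define f where "f = (\<lambda>k t. int (focal_mult (\<lambda>k. W k t) (\<lambda>k. Y k t) k))"
  define dX where "dX = (\<lambda>k t. rank_drop (\<lambda>t. upper (Y k t)) t)"
  define dB where "dB = (\<lambda>k t. rank_drop (\<lambda>t. upper_right (W k t)) t)"
  have L: "l_d_transformed S R N t = (\<Sum>k = 0..N. f k t)" for t
    by (simp add: l_d_transformed_def l_d_def f_def W_def Y_def atLeastLessThanSuc_atLeastAtMost)
  have n: "n_R S R N t = (\<Sum>k = 0..N. dB k t)" for t
    by (simp add: n_R_def dB_def W_def)
  have th: "theta S N t = dX (N + 1) t" for t
    by (simp add: theta_def dX_def Y_def transformed_sol_def R_last[simplified] matrix_inv_mat_1)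
  have dX0: "dX 0 t = 0" for t
    by (simp add: dX_def Y_def transformed_sol_def rank_drop_const)
  have regB: "rank_regular (\<lambda>t. upper_right (W k t))" and regX: "rank_regular (\<lambda>t. upper (Y (k + 1) t))" if "k \<le> N" for k
    using rank_regular_step(2,3)[where W = W and Y = Y and k = k, OF W[OF that] Y Y1[OF that]] that by auto
  show "0 \<le> theta S N t" for t
    unfolding th dX_def by (rule rank_drop_nonneg[OF regX]) simp
  then have theta_nonneg: "0 \<le> theta S N t" for t .
  show "0 \<le> n_R S R N t"
    unfolding n dB_def by (rule sum_nonneg) (use regB in \<open>auto intro: rank_drop_nonneg\<close>)
  show "0 \<le> l_d_transformed S R N t" unfolding L by (rule sum_nonneg) (simp add: f_def)
  have "f k t \<le> int (2 * CARD('n))" if "k \<le> N" for k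
    unfolding f_def using focal_mult_le[where W = "\<lambda>k. W k t" and Y = "\<lambda>k. Y k t" and k = k]
      W[OF that] Y[of k] Y1[OF that, of t] that by (simp add: monotone_system_def monotone_curve_def)
  then have "(\<Sum>k = 0..N. f k t) \<le> (\<Sum>k = 0..N. int (2 * CARD('n)))" by (intro sum_mono) auto
  then show "l_d_transformed S R N t \<le> int (2 * CARD('n) * (N + 1))" unfolding L by (simp add: algebra_simps)
  define g where "g = (\<lambda>t. theta S N t - n_R S R N t)"
  define T where "T = {t. theta S N t \<noteq> 0 \<or> n_R S R N t \<noteq> 0}"
  have left: "\<forall>\<^sub>F s in at_left t. l_d_transformed S R N t = l_d_transformed S R N s + g t" for t
  proof -
    have "\<forall>\<^sub>F s in at_left t. \<forall>k\<in>{0..N}. f k t = f k s + dX (k + 1) t - dX k t - dB k t"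
    proof (rule eventually_ball_finite, simp, rule ballI)
      fix k assume "k \<in> {0..N}"
      then have k: "k \<le> N" by simp
      show "\<forall>\<^sub>F s in at_left t. f k t = f k s + dX (k + 1) t - dX k t - dB k t"
        unfolding f_def dX_def dB_def
        using focal_mult_jump(1)[where W = W and Y = Y and k = k, OF W[OF k] Y Y1[OF k]] k by simp
    qed
    then show ?thesis
    proof (rule eventually_mono)
      fix s assume "\<forall>k\<in>{0..N}. f k t = f k s + dX (k + 1) t - dX k t - dB k t"
      then have "(\<Sum>k = 0..N. f k t) = (\<Sum>k = 0..N. f k s + (dX (k + 1) t - dX k t) - dB k t)"
        by (intro sum.cong) auto
      also have "\<dots> = (\<Sum>k = 0..N. f k s) + (\<Sum>k = 0..N. dX (k + 1) t - dX k t) - (\<Sum>k = 0..N. dB k t)"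
        by (simp only: sum.distrib sum_subtractf)
      also have "(\<Sum>k = 0..N. dX (k + 1) t - dX k t) = theta S N t"
        by (simp only: sum_telescope_int[of "\<lambda>k. dX k t"] th dX0)
      finally show "l_d_transformed S R N t = l_d_transformed S R N s + g t"
        by (simp only: L n g_def)
    qed
  qed
  have right: "\<forall>\<^sub>F s in at_right t. l_d_transformed S R N s = l_d_transformed S R N t" for t
  proof -
    have "\<forall>\<^sub>F s in at_right t. \<forall>k\<in>{0..N}. f k s = f k t"
    proof (rule eventually_ball_finite, simp, rule ballI)
      fix k assume "k \<in> {0..N}"
      then have k: "k \<le> N" by simp
      show "\<forall>\<^sub>F s in at_right t. f k s = f k t"
        unfolding f_def
        using focal_mult_jump(2)[where W = W and Y = Y and k = k, OF W[OF k] Y Y1[OF k]] k by simp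
    qed
    then show ?thesis by (rule eventually_mono) (simp add: L)
  qed
  have zero: "\<forall>\<^sub>F s in at t. s \<notin> T" for t
  proof -
    have "\<forall>\<^sub>F s in at t. \<forall>k\<in>{0..N}. dB k s = 0"
      unfolding dB_def
      by (rule eventually_ball_finite) (use regB in \<open>auto intro: rank_drop_eventually_0\<close>)
    moreover have "\<forall>\<^sub>F s in at t. dX (N + 1) s = 0"
      unfolding dX_def by (rule rank_drop_eventually_0[OF regX]) simp
    ultimately show ?thesis
      by eventually_elim (simp add: T_def th n)
  qed
  have eig: "{\<nu> \<in> finite_eigenvalues S N. a < \<nu> \<and> \<nu> \<le> b} = {\<nu> \<in> T \<inter> {a<..b}. theta S N \<nu> \<noteq> 0}" for a b
    using theta_nonneg by (auto simp: finite_eigenvalues_def T_def) (smt (verit))+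
  have nn: "{\<nu>. a < \<nu> \<and> \<nu> \<le> b \<and> n_R S R N \<nu> \<noteq> 0} = {\<nu> \<in> T \<inter> {a<..b}. n_R S R N \<nu> \<noteq> 0}" for a b
    by (auto simp: T_def)
  assume ab: "a \<le> b"
  have J: "finite (T \<inter> {a<..b}) \<and> l_d_transformed S R N b - l_d_transformed S R N a = sum g (T \<inter> {a<..b})"
    by (rule sum_of_jumps[OF left right zero _ ab]) (simp add: g_def T_def)
  show "finite {\<nu>. a < \<nu> \<and> \<nu> \<le> b \<and> n_R S R N \<nu> \<noteq> 0}"
    unfolding nn by (rule finite_subset[OF _ conjunct1[OF J]]) auto
  show "finite {\<nu> \<in> finite_eigenvalues S N. a < \<nu> \<and> \<nu> \<le> b}"
    unfolding eig by (rule finite_subset[OF _ conjunct1[OF J]]) auto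
  have "(\<Sum>\<nu>\<in>{\<nu> \<in> T \<inter> {a<..b}. n_R S R N \<nu> \<noteq> 0}. n_R S R N \<nu>) = (\<Sum>\<nu>\<in>T \<inter> {a<..b}. n_R S R N \<nu>)"
    by (rule sum.mono_neutral_left) (use J in auto)
  moreover have "(\<Sum>\<nu>\<in>{\<nu> \<in> T \<inter> {a<..b}. theta S N \<nu> \<noteq> 0}. theta S N \<nu>) = (\<Sum>\<nu>\<in>T \<inter> {a<..b}. theta S N \<nu>)"
    by (rule sum.mono_neutral_left) (use J in auto)
  moreover have "sum g (T \<inter> {a<..b}) = (\<Sum>\<nu>\<in>T \<inter> {a<..b}. theta S N \<nu>) - (\<Sum>\<nu>\<in>T \<inter> {a<..b}. n_R S R N \<nu>)"
    by (simp add: g_def sum_subtractf)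
  ultimately show "l_d_transformed S R N b - l_d_transformed S R N a
        + (\<Sum>\<nu> | a < \<nu> \<and> \<nu> \<le> b \<and> n_R S R N \<nu> \<noteq> 0. n_R S R N \<nu>)
      = (\<Sum>\<nu> \<in> {\<nu> \<in> finite_eigenvalues S N. a < \<nu> \<and> \<nu> \<le> b}. theta S N \<nu>)"
    unfolding eig nn using J by simp
qed

text \<open>
  For the trivial transformation the correction \<open>n_R\<close> is the rank drop of the original \<open>B\<close> blocks, which is zero
  on \<open>{..t0}\<close>. The focal points counted at \<open>a\<close> enter the formula with a minus sign.
\<close>

lemma eigenvalue_count_bounded:
  fixes S :: "nat \<Rightarrow> real \<Rightarrow> ('n::finite) mat2"
  assumes S_Cp1: "\<And>k. k \<le> N \<Longrightarrow> Cp1 (S k)"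
    and S_symplectic: "\<And>k t. k \<le> N \<Longrightarrow> symplectic (S k t)"
    and S_monotone: "\<And>k. k \<le> N \<Longrightarrow> Psi_nonneg (S k)"
    and const: "\<forall>t\<le>t0. \<forall>k\<le>N. rank (upper_right (S k t)) = left_rank (\<lambda>s. upper_right (S k s)) t"
  shows "\<exists>C. \<forall>a<b. (\<Sum>\<nu> \<in> {\<nu> \<in> finite_eigenvalues S N. a < \<nu> \<and> \<nu> \<le> b}. theta S N \<nu>) \<le> C"
proof -
  define I where "I = (\<lambda>k::nat. mat 1 :: 'n mat2)"
  have I: "symplectic (I k)" "I (N + 1) = mat 1" for k by (simp_all add: I_def symplectic_mat_1)
  note count = finite_eigenvalue_count[where S = S and N = N and R = I, OF S_Cp1 S_symplectic S_monotone I]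
  have n0: "n_R S I N t = 0" if "t \<le> t0" for t
    using const that unfolding n_R_def
    by (intro sum.neutral) (simp add: rank_drop_def transformed_def I_def matrix_inv_mat_1)
  \<comment> \<open>The minimum covers \<open>b < t0\<close>, where the sum is empty.\<close>
  define t1 where "t1 = min t0 b"
  define C where "C = l_d_transformed S I N b + (\<Sum>\<nu> | t1 < \<nu> \<and> \<nu> \<le> b \<and> n_R S I N \<nu> \<noteq> 0. n_R S I N \<nu>)"
  have "(\<Sum>\<nu> \<in> {\<nu> \<in> finite_eigenvalues S N. a < \<nu> \<and> \<nu> \<le> b}. theta S N \<nu>) \<le> C" if "a < b" for a
  proof -
    have "(\<Sum>\<nu> | a < \<nu> \<and> \<nu> \<le> b \<and> n_R S I N \<nu> \<noteq> 0. n_R S I N \<nu>)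
        \<le> (\<Sum>\<nu> | t1 < \<nu> \<and> \<nu> \<le> b \<and> n_R S I N \<nu> \<noteq> 0. n_R S I N \<nu>)"
    proof (rule sum_mono2)
      show "finite {\<nu>. t1 < \<nu> \<and> \<nu> \<le> b \<and> n_R S I N \<nu> \<noteq> 0}"
        by (rule count(5)) (auto simp: t1_def)
      show "{\<nu>. a < \<nu> \<and> \<nu> \<le> b \<and> n_R S I N \<nu> \<noteq> 0} \<subseteq> {\<nu>. t1 < \<nu> \<and> \<nu> \<le> b \<and> n_R S I N \<nu> \<noteq> 0}"
        using n0 by (auto simp: t1_def min_def) (metis not_le)
    qed (use count(2) in auto)
    then show ?thesis using count(7)[of a b] count(3)[of a] that unfolding C_def by simp
  qed
  then show ?thesis by blast
qed

theorem theorem3p7: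
  fixes S :: "nat \<Rightarrow> real \<Rightarrow> ('n::finite) mat2"
    and R :: "nat \<Rightarrow> 'n mat2"
    and N :: nat
  assumes S_Cp1: "\<And>k. k \<le> N \<Longrightarrow> Cp1 (S k)"
    and S_symplectic: "\<And>k t. k \<le> N \<Longrightarrow> symplectic (S k t)"
    and S_monotone: "\<And>k. k \<le> N \<Longrightarrow> Psi_nonneg (S k)"
    and R_symplectic: "\<And>k. k \<le> N + 1 \<Longrightarrow> symplectic (R k)"
    and R_last: "R (N + 1) = mat 1"
  shows
    "(\<forall>t. conjoined_basis N (\<lambda>k. transformed S R k t) (\<lambda>k. transformed_sol S R k t)) \<and>
     (\<forall>a b. a < b \<longrightarrow>
        finite {\<nu>. a < \<nu> \<and> \<nu> \<le> b \<and> n_R S R N \<nu> \<noteq> 0} \<and>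
        finite {\<nu> \<in> finite_eigenvalues S N. a < \<nu> \<and> \<nu> \<le> b} \<and>
        l_d_transformed S R N b - l_d_transformed S R N a
          + (\<Sum>\<nu> | a < \<nu> \<and> \<nu> \<le> b \<and> n_R S R N \<nu> \<noteq> 0. n_R S R N \<nu>)
        = (\<Sum>\<nu> \<in> {\<nu> \<in> finite_eigenvalues S N. a < \<nu> \<and> \<nu> \<le> b}. theta S N \<nu>)) \<and>
     ((\<exists>t0. \<forall>t\<le>t0. \<forall>k\<le>N. rank (upper_right (S k t)) = left_rank (\<lambda>s. upper_right (S k s)) t)
      \<longrightarrow>
        (\<forall>b. \<exists>C. \<forall>a<b. (\<Sum>\<nu> | a < \<nu> \<and> \<nu> \<le> b \<and> n_R S R N \<nu> \<noteq> 0. n_R S R N \<nu>) \<le> C) \<and>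
        (finite_eigenvalues S N \<noteq> {} \<longrightarrow>
           (\<exists>t1 \<in> finite_eigenvalues S N. \<forall>\<nu> \<in> finite_eigenvalues S N. t1 \<le> \<nu>)) \<and>
        (\<forall>a b. a < b \<longrightarrow> (\<forall>\<nu> \<in> finite_eigenvalues S N. a < \<nu>) \<longrightarrow>
           finite {\<nu> \<in> finite_eigenvalues S N. \<nu> \<le> b} \<and>
           l_d_transformed S R N b - l_d_transformed S R N a
             + (\<Sum>\<nu> | a < \<nu> \<and> \<nu> \<le> b \<and> n_R S R N \<nu> \<noteq> 0. n_R S R N \<nu>)
           = (\<Sum>\<nu> \<in> {\<nu> \<in> finite_eigenvalues S N. \<nu> \<le> b}. theta S N \<nu>)))"
proof -
  note count = finite_eigenvalue_count[where S = S and N = N and R = R, OF S_Cp1 S_symplectic S_monotone R_symplectic R_last]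
  note prob = transformed_problem[where S = S and N = N and R = R, OF S_Cp1 S_symplectic S_monotone R_symplectic]
  have conj: "conjoined_basis N (\<lambda>k. transformed S R k t) (\<lambda>k. transformed_sol S R k t)" for t
    unfolding conjoined_basis_def
  proof (intro conjI allI impI)
    fix k
    show "transformed_sol S R (k + 1) t = transformed S R k t ** transformed_sol S R k t" if "k \<le> N"
      by (rule prob(2)) (use that in auto)
    assume "k \<le> N + 1"
    then have "monotone_curve (transformed_sol S R k)" by (intro prob(3)) auto
    then have lag: "lagrangian (transformed_sol S R k t)" by (simp add: monotone_curve_def)
    show "rank (transformed_sol S R k t) = CARD('n)"
      "transpose (upper (transformed_sol S R k t)) ** lower (transformed_sol S R k t) =
       transpose (lower (transformed_sol S R k t)) ** upper (transformed_sol S R k t)"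
      by (rule lagrangian_conjoined[OF lag])+
  qed
  show ?thesis
  proof (intro conjI)
    show "\<forall>t. conjoined_basis N (\<lambda>k. transformed S R k t) (\<lambda>k. transformed_sol S R k t)"
      using conj by blast
    show "\<forall>a b. a < b \<longrightarrow>
        finite {\<nu>. a < \<nu> \<and> \<nu> \<le> b \<and> n_R S R N \<nu> \<noteq> 0} \<and>
        finite {\<nu> \<in> finite_eigenvalues S N. a < \<nu> \<and> \<nu> \<le> b} \<and>
        l_d_transformed S R N b - l_d_transformed S R N a
          + (\<Sum>\<nu> | a < \<nu> \<and> \<nu> \<le> b \<and> n_R S R N \<nu> \<noteq> 0. n_R S R N \<nu>)
        = (\<Sum>\<nu> \<in> {\<nu> \<in> finite_eigenvalues S N. a < \<nu> \<and> \<nu> \<le> b}. theta S N \<nu>)"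
      by (intro allI impI conjI count(5,6,7)) auto
  next
    show "(\<exists>t0. \<forall>t\<le>t0. \<forall>k\<le>N. rank (upper_right (S k t)) = left_rank (\<lambda>s. upper_right (S k s)) t)
      \<longrightarrow>
        (\<forall>b. \<exists>C. \<forall>a<b. (\<Sum>\<nu> | a < \<nu> \<and> \<nu> \<le> b \<and> n_R S R N \<nu> \<noteq> 0. n_R S R N \<nu>) \<le> C) \<and>
        (finite_eigenvalues S N \<noteq> {} \<longrightarrow>
           (\<exists>t1 \<in> finite_eigenvalues S N. \<forall>\<nu> \<in> finite_eigenvalues S N. t1 \<le> \<nu>)) \<and>
        (\<forall>a b. a < b \<longrightarrow> (\<forall>\<nu> \<in> finite_eigenvalues S N. a < \<nu>) \<longrightarrow>
           finite {\<nu> \<in> finite_eigenvalues S N. \<nu> \<le> b} \<and>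
           l_d_transformed S R N b - l_d_transformed S R N a
             + (\<Sum>\<nu> | a < \<nu> \<and> \<nu> \<le> b \<and> n_R S R N \<nu> \<noteq> 0. n_R S R N \<nu>)
           = (\<Sum>\<nu> \<in> {\<nu> \<in> finite_eigenvalues S N. \<nu> \<le> b}. theta S N \<nu>))"
    proof (rule impI, elim exE, intro conjI allI impI)
      fix t0
      assume const: "\<forall>t\<le>t0. \<forall>k\<le>N. rank (upper_right (S k t)) = left_rank (\<lambda>s. upper_right (S k s)) t"
      have bound: "\<exists>C. \<forall>a<b. (\<Sum>\<nu> \<in> {\<nu> \<in> finite_eigenvalues S N. a < \<nu> \<and> \<nu> \<le> b}. theta S N \<nu>) \<le> C" for b
        by (rule eigenvalue_count_bounded[where S = S and N = N, OF S_Cp1 S_symplectic S_monotone const])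
      show "\<exists>C. \<forall>a<b. (\<Sum>\<nu> | a < \<nu> \<and> \<nu> \<le> b \<and> n_R S R N \<nu> \<noteq> 0. n_R S R N \<nu>) \<le> C" for b
      proof -
        obtain C where C: "\<And>a. a < b \<Longrightarrow> (\<Sum>\<nu> \<in> {\<nu> \<in> finite_eigenvalues S N. a < \<nu> \<and> \<nu> \<le> b}. theta S N \<nu>) \<le> C"
          using bound by blast
        have "(\<Sum>\<nu> | a < \<nu> \<and> \<nu> \<le> b \<and> n_R S R N \<nu> \<noteq> 0. n_R S R N \<nu>) \<le> C + int (2 * CARD('n) * (N + 1))" if "a < b" for a
          using C[OF that] count(7)[of a b] count(3)[of b] count(4)[of a] that by linarith
        then show ?thesis by blast
      qed
      show "\<exists>t1 \<in> finite_eigenvalues S N. \<forall>\<nu> \<in> finite_eigenvalues S N. t1 \<le> \<nu>" if ne: "finite_eigenvalues S N \<noteq> {}"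
      proof -
        obtain b where b: "b \<in> finite_eigenvalues S N" using ne by blast
        define E where "E = {\<nu> \<in> finite_eigenvalues S N. \<nu> \<le> b}"
        obtain C where C: "\<And>a. a < b \<Longrightarrow> (\<Sum>\<nu> \<in> {\<nu> \<in> finite_eigenvalues S N. a < \<nu> \<and> \<nu> \<le> b}. theta S N \<nu>) \<le> C"
          using bound by blast
        \<comment> \<open>Every eigenvalue contributes at least \<open>1\<close> to the bounded sums, so finite sets of them have bounded size.\<close>
        have "card G \<le> nat C" if G: "G \<subseteq> E" "finite G" for G
        proof (cases "G = {}")
          case False
          define a where "a = Min G - 1"
          have Min: "Min G \<in> E" using Min_in[OF G(2) False] G(1) by blast
          have ab: "a < b" using Min by (simp add: a_def E_def)
          have sub: "G \<subseteq> {\<nu> \<in> finite_eigenvalues S N. a < \<nu> \<and> \<nu> \<le> b}"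
          proof
            fix x assume x: "x \<in> G"
            then have "Min G \<le> x" by (rule Min_le[OF G(2)])
            then show "x \<in> {\<nu> \<in> finite_eigenvalues S N. a < \<nu> \<and> \<nu> \<le> b}"
              using x G(1) by (auto simp: a_def E_def)
          qed
          have "int (card G) = (\<Sum>\<nu>\<in>G. 1)" by simp
          also have "\<dots> \<le> (\<Sum>\<nu>\<in>G. theta S N \<nu>)"
            by (rule sum_mono) (use sub in \<open>auto simp: finite_eigenvalues_def\<close>)
          also have "\<dots> \<le> (\<Sum>\<nu> \<in> {\<nu> \<in> finite_eigenvalues S N. a < \<nu> \<and> \<nu> \<le> b}. theta S N \<nu>)"
            by (rule sum_mono2) (use count(6)[of a b] count(1) ab sub in auto)
          also have "\<dots> \<le> C" by (rule C[OF ab])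
          finally show ?thesis by simp
        qed simp
        then have finE: "finite E" using finite_if_finite_subsets_card_bdd[of E "nat C"] by blast
        have "b \<in> E" using b by (simp add: E_def)
        then have "Min E \<in> E" "Min E \<le> b" using Min_in[OF finE] Min_le[OF finE] by auto
        moreover have "Min E \<le> \<nu>" if "\<nu> \<in> finite_eigenvalues S N" for \<nu>
          using that Min_le[OF finE, of \<nu>] \<open>Min E \<le> b\<close> by (cases "\<nu> \<le> b") (auto simp: E_def)
        ultimately show ?thesis unfolding E_def by blast
      qed
      fix a b assume ab: "a < b" and all: "\<forall>\<nu> \<in> finite_eigenvalues S N. a < \<nu>"
      then have e: "{\<nu> \<in> finite_eigenvalues S N. \<nu> \<le> b} = {\<nu> \<in> finite_eigenvalues S N. a < \<nu> \<and> \<nu> \<le> b}"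
        by auto
      show "finite {\<nu> \<in> finite_eigenvalues S N. \<nu> \<le> b}" unfolding e by (rule count(6)) (use ab in auto)
      show "l_d_transformed S R N b - l_d_transformed S R N a
             + (\<Sum>\<nu> | a < \<nu> \<and> \<nu> \<le> b \<and> n_R S R N \<nu> \<noteq> 0. n_R S R N \<nu>)
           = (\<Sum>\<nu> \<in> {\<nu> \<in> finite_eigenvalues S N. \<nu> \<le> b}. theta S N \<nu>)"
        unfolding e by (rule count(7)) (use ab in auto)
    qed
  qed
qed

end
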